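(* In the setting described in the context, let $X=K\oplus Z_0=K\oplus Z_1$ be two closed complements of $K=\ker L$, and suppose that for $i=0,1$ there are compatible topological splittings $Y=\operatorname{Ran}L\oplus Y_{K,i}$ with $Y_{K,i}=Z_i^\circ$ and such that the restriction maps $\rho_i:Y_{K,i}\to K^*$, $\rho_i(y)=\langle y,\cdot\rangle_{Y,X}|_K$, are isomorphisms. If $\Gamma_0,\Gamma_1:(K,0)\to(\mathbb R,0)$ are the corresponding Lyapunov--Schmidt reduced energies, then there is a real analytic local diffeomorphism $\varphi:(K,0)\to(K,0)$ such that $$\Gamma_1\circ\varphi=\Gamma_0,\qquad \varphi(0)=0,\qquad D\varphi(0)=\operatorname{id}_K,$$ where the first equality is an equality of germs at $0$.
   Context: Setting. $X,Y$ are real Banach spaces with a continuous bilinear pairing $\langle\cdot,\cdot\rangle_{Y,X}:Y\times X\to\mathbb R$; $U\subseteq X$ is an open neighborhood of $0$; $E:U\to\mathbb R$ is real analytic with $E(0)=0$, $dE(0)=0$; $M:U\to Y$ is a real analytic map with $dE(x)[v]=\langle M(x),v\rangle_{Y,X}$ for all $x\in U$, $v\in X$. $L:=DM(0):X\to Y$ is assumed Fredholm and $K:=\ker L$. For a subspace $Z\subset X$, $Z^\circ:=\{y\in Y:\langle y,z\rangle_{Y,X}=0\ \forall z\in Z\}$. Reduced energy attached to a compatible splitting. Given $X=K\oplus Z_i$ and $Y=\operatorname{Ran}L\oplus Y_{K,i}$ as in the claim, let $R_i:Y\to\operatorname{Ran}L$ be the continuous projection along $Y_{K,i}$. By the analytic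 implicit function theorem there is a unique real analytic germ $\psi_i:(K,0)\to(Z_i,0)$ with $R_iM(\xi+\psi_i(\xi))=0$ for $\xi\in K$ near $0$. The reduced energy is $\Gamma_i(\xi):=E(\xi+\psi_i(\xi))$. *)

theory Defs
  imports "HOL-Analysis.Analysis"
begin

definition linear_map_on :: "'a::real_vector set \<Rightarrow> ('a \<Rightarrow> 'b::real_vector) \<Rightarrow> bool" where
  "linear_map_on V f \<longleftrightarrow>
     (\<forall>x\<in>V. \<forall>y\<in>V. f (x + y) = f x + f y) \<and> (\<forall>c. \<forall>x\<in>V. f (c *\<^sub>R x) = c *\<^sub>R f x)"

text \<open>An \<open>n\<close>-linear map on a subspace \<open>V\<close> takes its arguments as a list of length \<open>n\<close> with entries
  in \<open>V\<close>; \<open>C\<close> is an upper bound for its operator norm.\<close>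

definition bounded_multilinear_on ::
    "'a::real_normed_vector set \<Rightarrow> nat \<Rightarrow> ('a list \<Rightarrow> 'b::real_normed_vector) \<Rightarrow> real \<Rightarrow> bool" where
  "bounded_multilinear_on V n m C \<longleftrightarrow> 0 \<le> C \<and>
     (\<forall>xs. length xs = n \<and> set xs \<subseteq> V \<longrightarrow>
        (\<forall>i<n. linear_map_on V (\<lambda>x. m (xs[i := x]))) \<and>
        norm (m xs) \<le> C * prod_list (map norm xs))"

text \<open>Real analyticity at \<open>a\<close> of a map defined near \<open>a\<close> on the subspace \<open>V\<close> (\<open>V = UNIV\<close> is the usual
  notion): a power series expansion \<open>f (a + h) = (\<Sum>n. m n (h, \<dots>, h))\<close> into continuous \<open>n\<close>-linear
  terms on \<open>V\<close> with \<open>(\<Sum>n. norm (m n) * r ^ n) < \<infinity>\<close>.  Symmetry of \<open>m n\<close> is not demanded, since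
  symmetrizing changes neither the diagonal values nor the bound.\<close>

definition real_analytic_at ::
    "'a::real_normed_vector set \<Rightarrow> ('a \<Rightarrow> 'b::real_normed_vector) \<Rightarrow> 'a \<Rightarrow> bool" where
  "real_analytic_at V f a \<longleftrightarrow>
     (\<exists>r>0. \<exists>m c. (\<forall>n. bounded_multilinear_on V n (m n) (c n)) \<and> summable (\<lambda>n. c n * r ^ n) \<and>
        (\<forall>h\<in>V. norm h < r \<longrightarrow> (\<lambda>n. m n (replicate n h)) sums f (a + h)))"

definition real_analytic_on ::
    "'a::real_normed_vector set \<Rightarrow> ('a \<Rightarrow> 'b::real_normed_vector) \<Rightarrow> 'a set \<Rightarrow> bool" where
  "real_analytic_on V f S \<longleftrightarrow>
     openin (top_of_set V) S \<and> (\<forall>a\<in>S. real_analytic_at V f a)"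

definition analytic_local_diffeo :: "'a::real_normed_vector set \<Rightarrow> ('a \<Rightarrow> 'a) \<Rightarrow> bool" where
  "analytic_local_diffeo V \<phi> \<longleftrightarrow> \<phi> 0 = 0 \<and>
     (\<exists>W W'. 0 \<in> W \<and> bij_betw \<phi> W W' \<and> real_analytic_on V \<phi> W \<and>
        real_analytic_on V (inv_into W \<phi>) W')"

definition null_space :: "('a \<Rightarrow> 'b::zero) \<Rightarrow> 'a set" where
  "null_space L = {x. L x = 0}"

definition fredholm :: "('a::real_normed_vector \<Rightarrow> 'b::real_normed_vector) \<Rightarrow> bool" where
  "fredholm L \<longleftrightarrow> bounded_linear L \<and>
     (\<exists>F. finite F \<and> null_space L = span F) \<and>
     closed (range L) \<and>
     (\<exists>F. finite F \<and> span (range L \<union> F) = UNIV)"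

definition direct_sum :: "'a::real_vector set \<Rightarrow> 'a set \<Rightarrow> bool" where
  "direct_sum A B \<longleftrightarrow> subspace A \<and> subspace B \<and> A \<inter> B = {0} \<and>
     (\<forall>x. \<exists>a\<in>A. \<exists>b\<in>B. x = a + b)"

definition proj_along :: "'a::real_vector set \<Rightarrow> 'a set \<Rightarrow> 'a \<Rightarrow> 'a" where
  "proj_along A B x = (THE a. a \<in> A \<and> x - a \<in> B)"

definition topological_splitting :: "'a::real_normed_vector set \<Rightarrow> 'a set \<Rightarrow> bool" where
  "topological_splitting A B \<longleftrightarrow> direct_sum A B \<and> bounded_linear (proj_along A B)"

definition annihilator :: "('y \<Rightarrow> 'x \<Rightarrow> real) \<Rightarrow> 'x set \<Rightarrow> 'y set" where
  "annihilator p Z = {y. \<forall>z\<in>Z. p y z = 0}"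

text \<open>Elements of \<open>K\<^sup>*\<close> are functions restricted to \<open>K\<close>, i.e. \<open>undefined\<close> off \<open>K\<close>.\<close>

definition dual_on :: "'x::real_normed_vector set \<Rightarrow> ('x \<Rightarrow> real) set" where
  "dual_on K = {f \<in> extensional K. linear_map_on K f \<and> (\<exists>C. \<forall>x\<in>K. \<bar>f x\<bar> \<le> C * norm x)}"

text \<open>The last conjunct says that \<open>\<rho> : Z\<^sup>\<circ> \<rightarrow> K\<^sup>*\<close> is an isomorphism.  The map is linear by construction;
  for Fredholm \<open>L\<close> both spaces are finite-dimensional, so bicontinuity is automatic.\<close>

definition compatible_splitting ::
    "('y::real_normed_vector \<Rightarrow> 'x::real_normed_vector \<Rightarrow> real) \<Rightarrow> ('x \<Rightarrow> 'y) \<Rightarrow> 'x set \<Rightarrow> bool" where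
  "compatible_splitting p L Z \<longleftrightarrow>
     closed Z \<and> direct_sum (null_space L) Z \<and>
     topological_splitting (range L) (annihilator p Z) \<and>
     bij_betw (\<lambda>y. restrict (p y) (null_space L)) (annihilator p Z) (dual_on (null_space L))"

text \<open>\<open>\<psi>\<close> represents the Lyapunov--Schmidt germ \<open>(K,0) \<rightarrow> (Z,0)\<close> attached to the splitting given
  by \<open>Z\<close>.\<close>

definition lyapunov_schmidt_germ ::
    "('y::real_normed_vector \<Rightarrow> 'x::real_normed_vector \<Rightarrow> real) \<Rightarrow> ('x \<Rightarrow> 'y) \<Rightarrow> ('x \<Rightarrow> 'y) \<Rightarrow>
     'x set \<Rightarrow> ('x \<Rightarrow> 'x) \<Rightarrow> bool" where
  "lyapunov_schmidt_germ p M L Z \<psi> \<longleftrightarrow> \<psi> 0 = 0 \<and>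
     (\<exists>W. 0 \<in> W \<and> real_analytic_on (null_space L) \<psi> W \<and>
        (\<forall>\<xi>\<in>W. \<psi> \<xi> \<in> Z \<and> proj_along (range L) (annihilator p Z) (M (\<xi> + \<psi> \<xi>)) = 0))"

definition reduced_energy :: "('x::real_vector \<Rightarrow> real) \<Rightarrow> ('x \<Rightarrow> 'x) \<Rightarrow> 'x \<Rightarrow> real" where
  "reduced_energy E \<psi> \<xi> = E (\<xi> + \<psi> \<xi>)"

end

theory Submission
  imports Defs
begin

text \<open>Write \<open>x0 = \<xi> + \<psi>0 \<xi>\<close>, let \<open>\<eta>\<close> be the projection of \<open>x0\<close> to \<open>K\<close> along \<open>Z1\<close>, and
  \<open>x1 = \<eta> + \<psi>1 \<eta>\<close>.  As \<open>x0 - x1\<close> lies in \<open>Z1\<close>, where \<open>L\<close> is invertible, and \<open>M x1\<close> projects to \<open>0\<close>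
  in the range of \<open>L\<close>, a Neumann series gives \<open>x0 - x1 = T (M x0)\<close> with \<open>T\<close> analytic in \<open>\<xi>\<close>.
  Now \<open>M x0\<close> lies in the annihilator of \<open>Z0\<close>, hence is given by the gradient \<open>g\<close> of the reduced
  energy \<open>\<Gamma>0\<close>.  For \<open>\<phi> = \<eta> + S g\<close> with a matrix \<open>S\<close>, Taylor expansion of \<open>E\<close> at \<open>x0\<close> writes
  \<open>\<Gamma>1 (\<phi> \<xi>) - \<Gamma>0 \<xi>\<close> as a quadratic form in \<open>g\<close>, and the vanishing of its coefficients is an
  analytic equation for \<open>S\<close> that at \<open>\<xi> = 0\<close> reads \<open>S = const\<close>, because the Hessian of \<open>E\<close> at \<open>0\<close>
  has \<open>K\<close> in its radical.  The implicit function theorem solves it, and \<open>\<phi>\<close> is tangent to the identity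
  since \<open>g\<close> vanishes to second order.

  Analyticity is handled by series in the coordinates of \<open>K\<close> with a weighted \<open>\<ell>1\<close> norm of the
  coefficients; this norm is submultiplicative and complete, so Neumann series and Picard iteration
  stay inside the analytic maps.\<close>

section \<open>Power series indexed by words\<close>

text \<open>Taking \<phi> = \<eta> is not enough. The displacement from x0 to x1 is linear in g with
  analytic coefficients, and M x0 = sum of g_i y_i is linear in g as well, so already the
  first-order Taylor term is quadratic in g: the energy defect is of second order in g but not zero.
  Adding the kernel vector S g changes the first-order term by g^T S g to leading order, because the
  vectors y_i of the annihilator of Z0 are dual to the basis of K. This has the shape of the defect,
  so a matrix can absorb it. The second-order term also involves S, which might spoil solvability.
  At \<xi> = 0, however, it is the Hessian on vectors of the form (kernel vector) - P y_j, where P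
  inverts L on Z1; the kernel part drops out and S with it. Hence the equation for the deviation of
  S from its value at \<xi> = 0 is a fixed point equation whose right-hand side has derivative zero
  in the unknown. K is a subspace and not a type, so basis vectors are their own indices and all
  vectors of the ambient type are letters. The set of letters is in general infinite, and bounds
  have to be uniform in the letter.\<close>

text \<open>Words in the letters \<open>i\<close> stand for non-commutative multi-indices, so that the product of two
  monomials is concatenation and symmetrization never arises.\<close>

definition word_monomial :: "('i \<Rightarrow> real) \<Rightarrow> 'i list \<Rightarrow> real" where
  "word_monomial t w = prod_list (map t w)"

definition word_expansion ::
    "real \<Rightarrow> ('i list \<Rightarrow> 'b::real_normed_vector) \<Rightarrow> (('i \<Rightarrow> real) \<Rightarrow> 'b) \<Rightarrow> bool" where
  "word_expansion \<rho> a f \<longleftrightarrow> (\<lambda>w. norm (a w) * \<rho> ^ length w) summable_on UNIV \<and>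
     (\<forall>t. (\<forall>i. \<bar>t i\<bar> \<le> \<rho>) \<longrightarrow> ((\<lambda>w. word_monomial t w *\<^sub>R a w) has_sum f t) UNIV)"

text \<open>Permuted words give the same monomial, so a function does not determine its
  coefficients; hence a bound \<open>c\<close> for some choice of them instead of a norm of
  \<open>f\<close>.\<close>

definition word_series ::
    "real \<Rightarrow> (('i \<Rightarrow> real) \<Rightarrow> 'b::real_normed_vector) \<Rightarrow> real \<Rightarrow> bool" where
  "word_series \<rho> f c \<longleftrightarrow>
     (\<exists>a. word_expansion \<rho> a f \<and> (\<Sum>\<^sub>\<infinity>w. norm (a w) * \<rho> ^ length w) \<le> c)"

lemma word_monomial_simps [simp]:
  "word_monomial t [] = 1"
  "word_monomial t (i # w) = t i * word_monomial t w"
  "word_monomial t (v @ w) = word_monomial t v * word_monomial t w"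
  by (auto simp: word_monomial_def)

lemma abs_word_monomial_le:
  assumes "\<And>i. \<bar>t i\<bar> \<le> \<rho>"
  shows "\<bar>word_monomial t w\<bar> \<le> \<rho> ^ length w"
proof (induction w)
  case (Cons i w)
  have "0 \<le> \<rho>" using assms[of i] by linarith
  with Cons assms[of i] show ?case by (auto simp: abs_mult intro!: mult_mono)
qed simp

lemma word_monomial_zero: "word_monomial (\<lambda>_. 0) w = (if w = [] then 1 else 0)"
  by (cases w) auto

lemma word_seriesE:
  assumes "word_series \<rho> f c"
  obtains a where "(\<lambda>w. norm (a w) * \<rho> ^ length w) summable_on UNIV"
    and "(\<Sum>\<^sub>\<infinity>w. norm (a w) * \<rho> ^ length w) \<le> c"
    and "\<And>t. (\<And>i. \<bar>t i\<bar> \<le> \<rho>) \<Longrightarrow> ((\<lambda>w. word_monomial t w *\<^sub>R a w) has_sum f t) UNIV"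
  using assms unfolding word_series_def word_expansion_def by blast

lemma word_seriesI:
  assumes "(\<lambda>w. norm (a w) * \<rho> ^ length w) summable_on UNIV"
    and "(\<Sum>\<^sub>\<infinity>w. norm (a w) * \<rho> ^ length w) \<le> c"
    and "\<And>t. (\<And>i. \<bar>t i\<bar> \<le> \<rho>) \<Longrightarrow> ((\<lambda>w. word_monomial t w *\<^sub>R a w) has_sum f t) UNIV"
  shows "word_series \<rho> f c"
  using assms unfolding word_series_def word_expansion_def by blast

lemma word_series_mono: "word_series \<rho> f c \<Longrightarrow> c \<le> d \<Longrightarrow> word_series \<rho> f d"
  unfolding word_series_def by force

lemma word_series_nonneg:
  assumes "0 \<le> \<rho>" "word_series \<rho> f c"
  shows "0 \<le> c"
proof -
  obtain a where "word_expansion \<rho> a f" "(\<Sum>\<^sub>\<infinity>w. norm (a w) * \<rho> ^ length w) \<le> c"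
    using assms(2) unfolding word_series_def by blast
  moreover have "0 \<le> (\<Sum>\<^sub>\<infinity>w. norm (a w) * \<rho> ^ length w)"
    using assms(1) by (intro infsum_nonneg) auto
  ultimately show ?thesis by linarith
qed

lemma word_series_norm_le:
  assumes "word_series \<rho> f c" "\<And>i. \<bar>t i\<bar> \<le> \<rho>"
  shows "norm (f t) \<le> c"
proof -
  obtain a where a: "(\<lambda>w. norm (a w) * \<rho> ^ length w) summable_on UNIV"
    "(\<Sum>\<^sub>\<infinity>w. norm (a w) * \<rho> ^ length w) \<le> c"
    "((\<lambda>w. word_monomial t w *\<^sub>R a w) has_sum f t) UNIV"
    using assms by (auto elim: word_seriesE)
  have "norm (word_monomial t w *\<^sub>R a w) \<le> norm (a w) * \<rho> ^ length w" for w
    using mult_left_mono[OF abs_word_monomial_le[OF assms(2)] norm_ge_zero[of "a w"]]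
    by (simp add: mult.commute)
  then show ?thesis
    using norm_infsum_le[OF a(3) has_sum_infsum[OF a(1)]] a(2) by fastforce
qed

lemma word_series_radius_mono:
  fixes f :: "('i \<Rightarrow> real) \<Rightarrow> 'b::real_normed_vector"
  assumes "word_series \<rho> f c" "0 \<le> \<theta>" "\<theta> \<le> \<rho>"
  shows "word_series \<theta> f c"
proof -
  obtain a where a: "(\<lambda>w. norm (a w) * \<rho> ^ length w) summable_on UNIV"
    "(\<Sum>\<^sub>\<infinity>w. norm (a w) * \<rho> ^ length w) \<le> c"
    "\<And>t. (\<And>i. \<bar>t i\<bar> \<le> \<rho>) \<Longrightarrow> ((\<lambda>w. word_monomial t w *\<^sub>R a w) has_sum f t) UNIV"
    using assms(1) by (rule word_seriesE) blast
  have le: "norm (a w) * \<theta> ^ length w \<le> norm (a w) * \<rho> ^ length w" for w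
    using assms(2,3) by (intro mult_left_mono power_mono) auto
  have s: "(\<lambda>w. norm (a w) * \<theta> ^ length w) summable_on UNIV"
    by (rule summable_on_comparison_test[OF a(1)]) (use le assms in auto)
  show ?thesis
  proof (rule word_seriesI[OF s])
    show "(\<Sum>\<^sub>\<infinity>w. norm (a w) * \<theta> ^ length w) \<le> c"
      using infsum_mono[OF s a(1) le] a(2) by simp
  next
    fix t :: "'i \<Rightarrow> real" assume "\<And>i. \<bar>t i\<bar> \<le> \<theta>"
    then have "\<bar>t i\<bar> \<le> \<rho>" for i using assms(3) order_trans by blast
    then show "((\<lambda>w. word_monomial t w *\<^sub>R a w) has_sum f t) UNIV" by (rule a(3))
  qed
qed

text \<open>Completeness of the weighted norm: the coefficients are summed word by word, and
  absolute summability over the pairs \<open>(k, w)\<close> permits both orders of summation. Most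
  closure properties below present their function as such a sum, so the coefficients of a product or
  a composition are never written down.\<close>

lemma word_series_infsum:
  fixes f :: "'k \<Rightarrow> ('i \<Rightarrow> real) \<Rightarrow> 'b::banach"
  assumes "0 < \<rho>" and f: "\<And>k. word_series \<rho> (f k) (c k)" and c: "c summable_on UNIV"
    and F: "\<And>t. (\<And>i. \<bar>t i\<bar> \<le> \<rho>) \<Longrightarrow> ((\<lambda>k. f k t) has_sum F t) UNIV"
  shows "word_series \<rho> F (infsum c UNIV)"
proof -
  define Q where "Q k a \<longleftrightarrow> word_expansion \<rho> a (f k) \<and>
      (\<Sum>\<^sub>\<infinity>w. norm (a w) * \<rho> ^ length w) \<le> c k" for k a
  have "\<exists>a. Q k a" for k using f[of k] unfolding word_series_def Q_def .
  then obtain a where a: "\<And>k. Q k (a k)" using choice[of Q] by blast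
  have a1: "(\<lambda>w. norm (a k w) * \<rho> ^ length w) summable_on UNIV" for k
    using a[of k] unfolding Q_def word_expansion_def by blast
  have a2: "(\<Sum>\<^sub>\<infinity>w. norm (a k w) * \<rho> ^ length w) \<le> c k" for k
    using a[of k] unfolding Q_def by blast
  have a3: "((\<lambda>w. word_monomial t w *\<^sub>R a k w) has_sum f k t) UNIV"
    if "\<And>i. \<bar>t i\<bar> \<le> \<rho>" for k t
    using a[of k] that unfolding Q_def word_expansion_def by blast
  define N where "N = (\<lambda>(k, w). norm (a k w) * \<rho> ^ length w)"
  define g where "g k = (\<Sum>\<^sub>\<infinity>w. norm (a k w) * \<rho> ^ length w)" for k
  have g0: "0 \<le> g k" for k
    unfolding g_def using assms(1) by (intro infsum_nonneg) auto
  have gs: "g summable_on UNIV"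
    by (rule summable_on_comparison_test[OF c]) (use a2 g0 in \<open>auto simp: g_def\<close>)
  have Ns: "N summable_on UNIV \<times> UNIV"
    by (rule summable_on_SigmaI[OF _ gs]) (use a1 assms(1) in \<open>auto simp: N_def g_def\<close>)
  define T where "T = infsum N (UNIV \<times> UNIV)"
  have NT: "(N has_sum T) (UNIV \<times> UNIV)" using Ns by (simp add: T_def)
  have gT: "(g has_sum T) UNIV"
    by (rule has_sum_SigmaD[OF NT]) (use a1 in \<open>auto simp: N_def g_def\<close>)
  have Tc: "T \<le> infsum c UNIV"
    using has_sum_mono[OF gT has_sum_infsum[OF c]] a2 by (auto simp: g_def)
  \<comment> \<open>Fubini: the same absolutely summable family, now with \<open>k\<close> as the
    inner index.\<close>
  have NT': "((\<lambda>(w, k). norm (a k w) * \<rho> ^ length w) has_sum T) (UNIV \<times> UNIV)"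
    using NT unfolding has_sum_swap[of N] by (simp add: N_def)
  have s1: "(\<lambda>k. norm (a k w) * \<rho> ^ length w) summable_on UNIV" for w
    using summable_on_SigmaD1[OF has_sum_imp_summable[OF NT'], of w] by simp
  have s2: "(\<lambda>k. norm (a k w)) summable_on UNIV" for w
    using summable_on_cmult_left[OF s1[of w], of "inverse (\<rho> ^ length w)"] assms(1)
    by (simp add: mult.assoc)
  define b where "b w = (\<Sum>\<^sub>\<infinity>k. a k w)" for w
  have b: "((\<lambda>k. a k w) has_sum b w) UNIV" for w
    using Infinite_Sum.abs_summable_summable[OF s2] by (simp add: b_def)
  define h where "h w = (\<Sum>\<^sub>\<infinity>k. norm (a k w) * \<rho> ^ length w)" for w
  have hT: "(h has_sum T) UNIV"
    by (rule has_sum_SigmaD[OF NT']) (use s1 in \<open>auto simp: h_def\<close>)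
  have bh: "norm (b w) * \<rho> ^ length w \<le> h w" for w
  proof -
    have "norm (b w) \<le> (\<Sum>\<^sub>\<infinity>k. norm (a k w))" unfolding b_def by (rule norm_infsum_bound[OF s2])
    then have "norm (b w) * \<rho> ^ length w \<le> (\<Sum>\<^sub>\<infinity>k. norm (a k w)) * \<rho> ^ length w"
      using assms(1) by (intro mult_right_mono) auto
    also have "\<dots> = h w" unfolding h_def by (rule infsum_cmult_left[symmetric]) (rule s2)
    finally show ?thesis .
  qed
  have bs: "(\<lambda>w. norm (b w) * \<rho> ^ length w) summable_on UNIV"
    by (rule summable_on_comparison_test[OF has_sum_imp_summable[OF hT]])
      (use bh assms(1) in auto)
  show ?thesis
  proof (rule word_seriesI[OF bs])
    show "(\<Sum>\<^sub>\<infinity>w. norm (b w) * \<rho> ^ length w) \<le> infsum c UNIV"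
      using has_sum_mono[OF has_sum_infsum[OF bs] hT] bh Tc by fastforce
  next
    fix t :: "'i \<Rightarrow> real" assume t: "\<And>i. \<bar>t i\<bar> \<le> \<rho>"
    define G where "G = (\<lambda>(k, w). word_monomial t w *\<^sub>R a k w)"
    have "norm (G kw) \<le> N kw" for kw
      unfolding G_def N_def
      using mult_right_mono[OF abs_word_monomial_le[of t \<rho> "snd kw"], of "norm (a (fst kw) (snd kw))"] t
      by (auto simp: case_prod_beta mult.commute)
    then have "(\<lambda>kw. norm (G kw)) summable_on UNIV \<times> UNIV"
      by (intro Infinite_Sum.abs_summable_on_comparison_test'[OF Ns]) auto
    then have "G summable_on UNIV \<times> UNIV" by (rule Infinite_Sum.abs_summable_summable)
    then obtain V where V: "(G has_sum V) (UNIV \<times> UNIV)" unfolding summable_on_def by blast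
    have "((\<lambda>k. f k t) has_sum V) UNIV"
      by (rule has_sum_SigmaD[OF V]) (use a3 t in \<open>auto simp: G_def\<close>)
    then have VF: "V = F t" using F[of t] t has_sum_unique by blast
    have V': "((\<lambda>(w, k). word_monomial t w *\<^sub>R a k w) has_sum V) (UNIV \<times> UNIV)"
      using V unfolding has_sum_swap[of G] by (simp add: G_def)
    have "((\<lambda>w. word_monomial t w *\<^sub>R b w) has_sum V) UNIV"
      by (rule has_sum_SigmaD[OF V'])
        (auto intro!: has_sum_bounded_linear[OF bounded_linear_scaleR_right] b)
    then show "((\<lambda>w. word_monomial t w *\<^sub>R b w) has_sum F t) UNIV" by (simp add: VF)
  qed
qed

section \<open>Sums, products and substitutions of word series\<close>

lemma word_series_monomial:
  "word_series \<rho> (\<lambda>t. word_monomial t w *\<^sub>R x) (norm x * \<rho> ^ length w)"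
proof -
  define a where "a v = (if v = w then x else 0)" for v
  have *: "((\<lambda>v. norm (a v) * \<rho> ^ length v) has_sum (norm x * \<rho> ^ length w)) UNIV"
    by (rule has_sum_finite_neutralI[of "{w}"]) (auto simp: a_def)
  have "((\<lambda>v. word_monomial t v *\<^sub>R a v) has_sum (word_monomial t w *\<^sub>R x)) UNIV" for t
    by (rule has_sum_finite_neutralI[of "{w}"]) (auto simp: a_def)
  with * show ?thesis
    by (intro word_seriesI[of a]) (auto simp: has_sum_imp_summable infsumI)
qed

lemma word_series_const: "word_series \<rho> (\<lambda>t. x) (norm x)"
  using word_series_monomial[of \<rho> "[]" x] by simp

lemma word_series_var: "word_series \<rho> (\<lambda>t. t i) \<rho>"
  using word_series_monomial[of \<rho> "[i]" "1::real"] by simp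

lemma word_series_linear:
  fixes f :: "('i \<Rightarrow> real) \<Rightarrow> 'b::real_normed_vector"
  assumes "bounded_linear h" "\<And>x. norm (h x) \<le> K * norm x" "0 \<le> \<rho>" "word_series \<rho> f c" "0 \<le> K"
  shows "word_series \<rho> (\<lambda>t. h (f t)) (K * c)"
proof -
  obtain a where a: "(\<lambda>w. norm (a w) * \<rho> ^ length w) summable_on UNIV"
    "(\<Sum>\<^sub>\<infinity>w. norm (a w) * \<rho> ^ length w) \<le> c"
    "\<And>t. (\<And>i. \<bar>t i\<bar> \<le> \<rho>) \<Longrightarrow> ((\<lambda>w. word_monomial t w *\<^sub>R a w) has_sum f t) UNIV"
    using assms(4) by (rule word_seriesE) blast
  have le: "norm (h (a w)) * \<rho> ^ length w \<le> K * (norm (a w) * \<rho> ^ length w)" for w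
    using mult_right_mono[OF assms(2)[of "a w"], of "\<rho> ^ length w"] assms(3) by (simp add: mult.assoc)
  have Ks: "(\<lambda>w. K * (norm (a w) * \<rho> ^ length w)) summable_on UNIV"
    using a(1) by (rule summable_on_cmult_right)
  have s: "(\<lambda>w. norm (h (a w)) * \<rho> ^ length w) summable_on UNIV"
    by (rule summable_on_comparison_test[OF Ks]) (use le assms in auto)
  show ?thesis
  proof (rule word_seriesI[OF s])
    have "(\<Sum>\<^sub>\<infinity>w. norm (h (a w)) * \<rho> ^ length w) \<le> (\<Sum>\<^sub>\<infinity>w. K * (norm (a w) * \<rho> ^ length w))"
      by (rule infsum_mono[OF s Ks]) (rule le)
    also have "\<dots> = K * (\<Sum>\<^sub>\<infinity>w. norm (a w) * \<rho> ^ length w)"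
      by (rule infsum_cmult_right) (rule a(1))
    also have "\<dots> \<le> K * c" using a(2) assms(5) by (rule mult_left_mono)
    finally show "(\<Sum>\<^sub>\<infinity>w. norm (h (a w)) * \<rho> ^ length w) \<le> K * c" .
  next
    fix t :: "'i \<Rightarrow> real" assume t: "\<And>i. \<bar>t i\<bar> \<le> \<rho>"
    interpret h: bounded_linear h by fact
    show "((\<lambda>w. word_monomial t w *\<^sub>R h (a w)) has_sum h (f t)) UNIV"
      using has_sum_bounded_linear[OF assms(1) a(3)[OF t]] by (simp add: h.scaleR)
  qed
qed

lemma word_series_add:
  fixes f :: "('i \<Rightarrow> real) \<Rightarrow> 'b::real_normed_vector"
  assumes "word_series \<rho> f c" "word_series \<rho> g d" "0 \<le> \<rho>"
  shows "word_series \<rho> (\<lambda>t. f t + g t) (c + d)"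
proof -
  obtain a where a: "(\<lambda>w. norm (a w) * \<rho> ^ length w) summable_on UNIV"
    "(\<Sum>\<^sub>\<infinity>w. norm (a w) * \<rho> ^ length w) \<le> c"
    "\<And>t. (\<And>i. \<bar>t i\<bar> \<le> \<rho>) \<Longrightarrow> ((\<lambda>w. word_monomial t w *\<^sub>R a w) has_sum f t) UNIV"
    using assms(1) by (rule word_seriesE) blast
  obtain b where b: "(\<lambda>w. norm (b w) * \<rho> ^ length w) summable_on UNIV"
    "(\<Sum>\<^sub>\<infinity>w. norm (b w) * \<rho> ^ length w) \<le> d"
    "\<And>t. (\<And>i. \<bar>t i\<bar> \<le> \<rho>) \<Longrightarrow> ((\<lambda>w. word_monomial t w *\<^sub>R b w) has_sum g t) UNIV"
    using assms(2) by (rule word_seriesE) blast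
  have le: "norm (a w + b w) * \<rho> ^ length w
      \<le> norm (a w) * \<rho> ^ length w + norm (b w) * \<rho> ^ length w" for w
    using mult_right_mono[OF norm_triangle_ineq[of "a w" "b w"], of "\<rho> ^ length w"] assms(3)
    by (simp add: distrib_right)
  have s': "(\<lambda>w. norm (a w) * \<rho> ^ length w + norm (b w) * \<rho> ^ length w) summable_on UNIV"
    using a(1) b(1) by (rule summable_on_add)
  have s: "(\<lambda>w. norm (a w + b w) * \<rho> ^ length w) summable_on UNIV"
    by (rule summable_on_comparison_test[OF s']) (use le assms in auto)
  show ?thesis
  proof (rule word_seriesI[OF s])
    have "(\<Sum>\<^sub>\<infinity>w. norm (a w + b w) * \<rho> ^ length w)
        \<le> (\<Sum>\<^sub>\<infinity>w. norm (a w) * \<rho> ^ length w + norm (b w) * \<rho> ^ length w)"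
      by (rule infsum_mono[OF s s']) (rule le)
    also have "\<dots> \<le> c + d" using a(2) b(2) infsum_add[OF a(1) b(1)] by simp
    finally show "(\<Sum>\<^sub>\<infinity>w. norm (a w + b w) * \<rho> ^ length w) \<le> c + d" .
  next
    fix t :: "'i \<Rightarrow> real" assume t: "\<And>i. \<bar>t i\<bar> \<le> \<rho>"
    show "((\<lambda>w. word_monomial t w *\<^sub>R (a w + b w)) has_sum f t + g t) UNIV"
      using has_sum_add[OF a(3)[OF t] b(3)[OF t]] by (simp add: scaleR_add_right)
  qed
qed

lemma word_series_monomial_mult:
  fixes f :: "('i \<Rightarrow> real) \<Rightarrow> 'b::banach"
  assumes "word_series \<rho> f c" "0 < \<rho>"
  shows "word_series \<rho> (\<lambda>t. word_monomial t v *\<^sub>R f t) (\<rho> ^ length v * c)"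
proof -
  obtain a where a: "(\<lambda>w. norm (a w) * \<rho> ^ length w) summable_on UNIV"
    "(\<Sum>\<^sub>\<infinity>w. norm (a w) * \<rho> ^ length w) \<le> c"
    "\<And>t. (\<And>i. \<bar>t i\<bar> \<le> \<rho>) \<Longrightarrow> ((\<lambda>w. word_monomial t w *\<^sub>R a w) has_sum f t) UNIV"
    using assms(1) by (rule word_seriesE) blast
  define C where "C w = \<rho> ^ length v * (norm (a w) * \<rho> ^ length w)" for w
  have Cs: "C summable_on UNIV" unfolding C_def using a(1) by (rule summable_on_cmult_right)
  have "word_series \<rho> (\<lambda>t. word_monomial t v *\<^sub>R f t) (infsum C UNIV)"
  proof (rule word_series_infsum[where f = "\<lambda>w t. word_monomial t (v @ w) *\<^sub>R a w", OF assms(2) _ Cs])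
    show "word_series \<rho> (\<lambda>t. word_monomial t (v @ w) *\<^sub>R a w) (C w)" for w
      using word_series_monomial[of \<rho> "v @ w" "a w"] unfolding C_def
      by (simp add: power_add mult_ac)
  next
    fix t :: "'i \<Rightarrow> real" assume t: "\<And>i. \<bar>t i\<bar> \<le> \<rho>"
    show "((\<lambda>w. word_monomial t (v @ w) *\<^sub>R a w) has_sum word_monomial t v *\<^sub>R f t) UNIV"
      using has_sum_bounded_linear[OF bounded_linear_scaleR_right[of "word_monomial t v"] a(3)[OF t]]
      by simp
  qed
  moreover have "infsum C UNIV = \<rho> ^ length v * (\<Sum>\<^sub>\<infinity>w. norm (a w) * \<rho> ^ length w)"
    unfolding C_def by (rule infsum_cmult_right) (rule a(1))
  moreover have "\<dots> \<le> \<rho> ^ length v * c" using a(2) assms(2) by (intro mult_left_mono) auto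
  ultimately show ?thesis by (auto elim: word_series_mono)
qed

text \<open>Reduces bounds on a function linear in a word series \<open>f\<close> to bounds for constant \<open>f\<close>.\<close>

lemma word_series_linear_param:
  fixes f :: "('i \<Rightarrow> real) \<Rightarrow> 'a::real_normed_vector" and h :: "'a \<Rightarrow> ('i \<Rightarrow> real) \<Rightarrow> 'b::banach"
  assumes "0 < \<rho>" "0 \<le> K" "word_series \<rho> f c"
    and lin: "\<And>t. (\<And>i. \<bar>t i\<bar> \<le> \<rho>) \<Longrightarrow> bounded_linear (\<lambda>x. h x t)"
    and h: "\<And>x. word_series \<rho> (h x) (norm x * K)"
  shows "word_series \<rho> (\<lambda>t. h (f t) t) (c * K)"
proof -
  obtain a where a: "(\<lambda>w. norm (a w) * \<rho> ^ length w) summable_on UNIV"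
    "(\<Sum>\<^sub>\<infinity>w. norm (a w) * \<rho> ^ length w) \<le> c"
    "\<And>t. (\<And>i. \<bar>t i\<bar> \<le> \<rho>) \<Longrightarrow> ((\<lambda>w. word_monomial t w *\<^sub>R a w) has_sum f t) UNIV"
    using assms(3) by (rule word_seriesE) blast
  define C where "C w = (norm (a w) * \<rho> ^ length w) * K" for w
  have Cs: "C summable_on UNIV" unfolding C_def using a(1) by (rule summable_on_cmult_left)
  have "word_series \<rho> (\<lambda>t. h (f t) t) (infsum C UNIV)"
  proof (rule word_series_infsum[where f = "\<lambda>w t. word_monomial t w *\<^sub>R h (a w) t", OF assms(1) _ Cs])
    show "word_series \<rho> (\<lambda>t. word_monomial t w *\<^sub>R h (a w) t) (C w)" for w
      using word_series_monomial_mult[OF h[of "a w"] assms(1), of w] unfolding C_def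
      by (simp add: mult_ac)
  next
    fix t :: "'i \<Rightarrow> real" assume t: "\<And>i. \<bar>t i\<bar> \<le> \<rho>"
    interpret bounded_linear "\<lambda>x. h x t" using lin t by blast
    show "((\<lambda>w. word_monomial t w *\<^sub>R h (a w) t) has_sum h (f t) t) UNIV"
      using has_sum_bounded_linear[OF bounded_linear_axioms a(3)[of t]] t by (simp add: scaleR)
  qed
  moreover have "infsum C UNIV = (\<Sum>\<^sub>\<infinity>w. norm (a w) * \<rho> ^ length w) * K"
    unfolding C_def by (rule infsum_cmult_left) (rule a(1))
  moreover have "\<dots> \<le> c * K" using a(2) assms(2) by (intro mult_right_mono) auto
  ultimately show ?thesis by (auto elim: word_series_mono)
qed

lemma word_series_bilinear:
  fixes f :: "('i \<Rightarrow> real) \<Rightarrow> 'a::real_normed_vector" and g :: "('i \<Rightarrow> real) \<Rightarrow> 'b::real_normed_vector"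
    and prod :: "'a \<Rightarrow> 'b \<Rightarrow> 'c::banach"
  assumes "bounded_bilinear prod" "\<And>x y. norm (prod x y) \<le> norm x * norm y * K" "0 \<le> K"
    "word_series \<rho> f c" "word_series \<rho> g d" "0 < \<rho>"
  shows "word_series \<rho> (\<lambda>t. prod (f t) (g t)) (c * (K * d))"
proof (rule word_series_linear_param[where h = "\<lambda>x t. prod x (g t)"])
  interpret bounded_bilinear prod by fact
  show "0 \<le> K * d" using word_series_nonneg[OF _ assms(5)] assms(3,6) by simp
  show "bounded_linear (\<lambda>x. prod x (g t))" for t by (rule bounded_linear_left)
  show "word_series \<rho> (\<lambda>t. prod x (g t)) (norm x * (K * d))" for x
    using word_series_linear[OF bounded_linear_right[of x], where K = "norm x * K"
        and \<rho> = \<rho> and f = g and c = d] assms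
    by (simp add: mult_ac)
qed (use assms in auto)

lemma word_series_mult:
  fixes f g :: "('i \<Rightarrow> real) \<Rightarrow> real"
  assumes "word_series \<rho> f c" "word_series \<rho> g d" "0 < \<rho>"
  shows "word_series \<rho> (\<lambda>t. f t * g t) (c * d)"
  using word_series_bilinear[OF bounded_bilinear_mult, of 1 \<rho> f c g d] assms by (simp add: abs_mult)

lemma word_series_blinfun_apply:
  fixes A :: "('i \<Rightarrow> real) \<Rightarrow> 'a::real_normed_vector \<Rightarrow>\<^sub>L 'b::banach"
  assumes "word_series \<rho> A c" "word_series \<rho> f d" "0 < \<rho>"
  shows "word_series \<rho> (\<lambda>t. blinfun_apply (A t) (f t)) (c * d)"
  using word_series_bilinear[OF bounded_bilinear_blinfun_apply, of 1 \<rho> A c f d] assms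
  by (simp add: norm_blinfun)

lemma word_series_word_monomial:
  assumes "\<And>j. word_series \<theta> (\<sigma> j) \<rho>" "0 < \<theta>"
  shows "word_series \<theta> (\<lambda>t. word_monomial (\<lambda>j. \<sigma> j t) w) (\<rho> ^ length w)"
proof (induction w)
  case Nil
  then show ?case using word_series_const[of \<theta> "1::real"] by simp
next
  case (Cons j w)
  then show ?case using word_series_mult[OF assms(1)[of j] Cons assms(2)] by simp
qed

text \<open>Substitution does not increase the bound: a monomial of degree n in functions of norm at
  most \<open>\<rho>\<close> has norm at most \<open>\<rho> ^ n\<close>, exactly the weight of its
  coefficient.\<close>

lemma word_series_subst:
  fixes f :: "('j \<Rightarrow> real) \<Rightarrow> 'b::banach" and \<sigma> :: "'j \<Rightarrow> ('i \<Rightarrow> real) \<Rightarrow> real"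
  assumes "word_series \<rho> f c" "\<And>j. word_series \<theta> (\<sigma> j) \<rho>" "0 < \<theta>"
  shows "word_series \<theta> (\<lambda>t. f (\<lambda>j. \<sigma> j t)) c"
proof -
  obtain a where a: "(\<lambda>w. norm (a w) * \<rho> ^ length w) summable_on UNIV"
    "(\<Sum>\<^sub>\<infinity>w. norm (a w) * \<rho> ^ length w) \<le> c"
    "\<And>t. (\<And>i. \<bar>t i\<bar> \<le> \<rho>) \<Longrightarrow> ((\<lambda>w. word_monomial t w *\<^sub>R a w) has_sum f t) UNIV"
    using assms(1) by (rule word_seriesE) blast
  have "word_series \<theta> (\<lambda>t. f (\<lambda>j. \<sigma> j t)) (\<Sum>\<^sub>\<infinity>w. norm (a w) * \<rho> ^ length w)"
  proof (rule word_series_infsum[where f = "\<lambda>w t. word_monomial (\<lambda>j. \<sigma> j t) w *\<^sub>R a w", OF assms(3) _ a(1)])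
    show "word_series \<theta> (\<lambda>t. word_monomial (\<lambda>j. \<sigma> j t) w *\<^sub>R a w) (norm (a w) * \<rho> ^ length w)" for w
      using word_series_linear[OF bounded_linear_scaleR_left[of "a w"] _ _
          word_series_word_monomial[where \<sigma> = \<sigma>, OF assms(2,3), of w], of "norm (a w)"] assms(3)
      by simp
  next
    fix t :: "'i \<Rightarrow> real" assume "\<And>i. \<bar>t i\<bar> \<le> \<theta>"
    then show "((\<lambda>w. word_monomial (\<lambda>j. \<sigma> j t) w *\<^sub>R a w) has_sum f (\<lambda>j. \<sigma> j t)) UNIV"
      using word_series_norm_le[OF assms(2)] by (intro a(3)) simp
  qed
  then show ?thesis using a(2) by (rule word_series_mono)
qed

section \<open>Low-order coefficients and shrinking of the radius\<close>

lemma word_expansion_Nil: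
  assumes "word_expansion \<rho> a f" "0 \<le> \<rho>"
  shows "a [] = f (\<lambda>_. 0)"
proof -
  have "((\<lambda>w. word_monomial (\<lambda>_. 0) w *\<^sub>R a w) has_sum f (\<lambda>_. 0)) UNIV"
    using assms unfolding word_expansion_def by simp
  moreover have "((\<lambda>w. word_monomial (\<lambda>_. 0) w *\<^sub>R a w) has_sum a []) UNIV"
    by (rule has_sum_finite_neutralI[of "{[]}"]) (auto simp: word_monomial_zero)
  ultimately show ?thesis using has_sum_unique by blast
qed

text \<open>A word of length at least \<open>k\<close> gains the factor
  \<open>(\<theta> / \<rho>) ^ k\<close> when the radius shrinks. All smallness of norms comes from
  here.\<close>

lemma word_series_shrink:
  fixes f :: "('i \<Rightarrow> real) \<Rightarrow> 'b::real_normed_vector"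
  assumes "word_expansion \<rho> a f" "(\<Sum>\<^sub>\<infinity>w. norm (a w) * \<rho> ^ length w) \<le> c"
    and "\<And>w. length w < k \<Longrightarrow> a w = 0" and "0 \<le> \<theta>" "\<theta> \<le> \<rho>" "0 < \<rho>"
  shows "word_series \<theta> f ((\<theta> / \<rho>) ^ k * c)"
proof -
  have s0: "(\<lambda>w. norm (a w) * \<rho> ^ length w) summable_on UNIV"
    using assms(1) by (simp add: word_expansion_def)
  have le: "norm (a w) * \<theta> ^ length w \<le> (\<theta> / \<rho>) ^ k * (norm (a w) * \<rho> ^ length w)" for w
  proof (cases "length w < k")
    case False
    have "\<theta> ^ length w = (\<theta> / \<rho>) ^ length w * \<rho> ^ length w"
      using assms(6) by (simp add: power_divide)
    also have "\<dots> \<le> (\<theta> / \<rho>) ^ k * \<rho> ^ length w"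
      using False assms(4-6) by (intro mult_right_mono power_decreasing) auto
    finally have "norm (a w) * \<theta> ^ length w \<le> norm (a w) * ((\<theta> / \<rho>) ^ k * \<rho> ^ length w)"
      by (rule mult_left_mono) simp
    then show ?thesis by (simp only: mult_ac)
  qed (simp add: assms(3))
  have s': "(\<lambda>w. (\<theta> / \<rho>) ^ k * (norm (a w) * \<rho> ^ length w)) summable_on UNIV"
    using s0 by (rule summable_on_cmult_right)
  have s: "(\<lambda>w. norm (a w) * \<theta> ^ length w) summable_on UNIV"
    by (rule summable_on_comparison_test[OF s']) (use le assms in auto)
  show ?thesis
  proof (rule word_seriesI[OF s])
    have "(\<Sum>\<^sub>\<infinity>w. norm (a w) * \<theta> ^ length w)
        \<le> (\<Sum>\<^sub>\<infinity>w. (\<theta> / \<rho>) ^ k * (norm (a w) * \<rho> ^ length w))"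
      by (rule infsum_mono[OF s s']) (rule le)
    also have "\<dots> = (\<theta> / \<rho>) ^ k * (\<Sum>\<^sub>\<infinity>w. norm (a w) * \<rho> ^ length w)"
      by (rule infsum_cmult_right) (rule s0)
    also have "\<dots> \<le> (\<theta> / \<rho>) ^ k * c" using assms by (intro mult_left_mono) auto
    finally show "(\<Sum>\<^sub>\<infinity>w. norm (a w) * \<theta> ^ length w) \<le> (\<theta> / \<rho>) ^ k * c" .
  next
    fix t :: "'i \<Rightarrow> real" assume "\<And>i. \<bar>t i\<bar> \<le> \<theta>"
    then have "\<bar>t i\<bar> \<le> \<rho>" for i using assms(5) order_trans by blast
    then show "((\<lambda>w. word_monomial t w *\<^sub>R a w) has_sum f t) UNIV"
      using assms(1) by (simp add: word_expansion_def)
  qed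
qed

lemma word_series_small:
  assumes "word_series \<rho> f c" "f (\<lambda>_. 0) = 0" "0 \<le> \<theta>" "\<theta> \<le> \<rho>" "0 < \<rho>"
  shows "word_series \<theta> f (\<theta> / \<rho> * c)"
proof -
  obtain a where a: "word_expansion \<rho> a f" "(\<Sum>\<^sub>\<infinity>w. norm (a w) * \<rho> ^ length w) \<le> c"
    using assms(1) unfolding word_series_def by blast
  have "a [] = 0" using word_expansion_Nil[OF a(1)] assms by simp
  then show ?thesis using word_series_shrink[OF a, of 1] assms by simp
qed

text \<open>A one-letter word has no other arrangement, so its coefficient, unlike the general one,
  is determined by \<open>f\<close>: it is the partial derivative at 0. Thus a derivative hypothesis
  can be read as the vanishing of a coefficient.\<close>

lemma word_expansion_singleton:
  assumes "word_expansion \<rho> a f" "0 < \<rho>"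
    and "((\<lambda>\<tau>. f ((\<lambda>_. 0)(i := \<tau>))) has_vector_derivative D) (at 0)"
  shows "a [i] = D"
proof -
  define c where "c = (\<Sum>\<^sub>\<infinity>w. norm (a w) * \<rho> ^ length w)"
  have s0: "(\<lambda>w. norm (a w) * \<rho> ^ length w) summable_on UNIV"
    using assms(1) by (simp add: word_expansion_def)
  have c0: "0 \<le> c" unfolding c_def using assms(2) by (intro infsum_nonneg) auto
  have est: "norm (f ((\<lambda>_. 0)(i := \<tau>)) - f (\<lambda>_. 0) - \<tau> *\<^sub>R a [i]) \<le> (\<bar>\<tau>\<bar> / \<rho>)\<^sup>2 * c"
    if "\<bar>\<tau>\<bar> \<le> \<rho>" for \<tau>
  proof -
    define t where "t = (\<lambda>_. 0)(i := \<tau>)"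
    have t: "\<bar>t j\<bar> \<le> \<bar>\<tau>\<bar>" for j by (simp add: t_def)
    then have "\<bar>t j\<bar> \<le> \<rho>" for j using that order_trans by blast
    then have h1: "((\<lambda>w. word_monomial t w *\<^sub>R a w) has_sum f t) UNIV"
      using assms(1) by (simp add: word_expansion_def)
    \<comment> \<open>The constant and linear terms are subtracted inside the sum; what is left has
      order two.\<close>
    have h2: "((\<lambda>w. if w = [] \<or> w = [i] then - (word_monomial t w *\<^sub>R a w) else 0)
        has_sum - (f (\<lambda>_. 0) + \<tau> *\<^sub>R a [i])) UNIV"
      by (rule has_sum_finite_neutralI[of "{[], [i]}"])
        (use word_expansion_Nil[OF assms(1)] assms(2) in \<open>auto simp: t_def\<close>)
    have h: "((\<lambda>w. if w = [] \<or> w = [i] then 0 else word_monomial t w *\<^sub>R a w)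
        has_sum (f t + - (f (\<lambda>_. 0) + \<tau> *\<^sub>R a [i]))) UNIV"
      by (rule has_sum_cong[THEN iffD1, OF _ has_sum_add[OF h1 h2]]) auto
    have le: "norm (if w = [] \<or> w = [i] then 0 else word_monomial t w *\<^sub>R a w)
        \<le> (\<bar>\<tau>\<bar> / \<rho>)\<^sup>2 * (norm (a w) * \<rho> ^ length w)" for w
    proof (cases "length w < 2")
      \<comment> \<open>On the \<open>i\<close>-axis every one-letter word other than
        \<open>[i]\<close> has monomial 0.\<close>
      case True
      then have "w = [] \<or> w = [i] \<or> word_monomial t w = 0"
        by (cases w; cases "tl w") (auto simp: t_def)
      then show ?thesis using assms(2) by auto
    next
      case False
      have "\<bar>word_monomial t w\<bar> \<le> \<bar>\<tau>\<bar> ^ length w" using t by (rule abs_word_monomial_le)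
      also have "\<dots> = (\<bar>\<tau>\<bar> / \<rho>) ^ length w * \<rho> ^ length w"
        using assms(2) by (simp add: power_divide)
      also have "\<dots> \<le> (\<bar>\<tau>\<bar> / \<rho>)\<^sup>2 * \<rho> ^ length w"
        using False assms(2) that by (intro mult_right_mono power_decreasing) auto
      finally have "norm (word_monomial t w *\<^sub>R a w) \<le> (\<bar>\<tau>\<bar> / \<rho>)\<^sup>2 * (norm (a w) * \<rho> ^ length w)"
        using mult_right_mono[of _ _ "norm (a w)"] by (fastforce simp: mult_ac)
      then show ?thesis using False by auto
    qed
    have "((\<lambda>w. (\<bar>\<tau>\<bar> / \<rho>)\<^sup>2 * (norm (a w) * \<rho> ^ length w)) has_sum (\<bar>\<tau>\<bar> / \<rho>)\<^sup>2 * c) UNIV"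
      unfolding c_def using s0 by (intro has_sum_cmult_right) simp
    from norm_infsum_le[OF h this le] show ?thesis by (simp add: t_def algebra_simps)
  qed
  have "((\<lambda>\<tau>. f ((\<lambda>_. 0)(i := \<tau>))) has_derivative (\<lambda>\<tau>. \<tau> *\<^sub>R a [i])) (at 0)"
    unfolding has_derivative_at
  proof (intro conjI)
    show "bounded_linear (\<lambda>\<tau>. \<tau> *\<^sub>R a [i])" by (rule bounded_linear_scaleR_left)
    show "(\<lambda>\<tau>. norm (f ((\<lambda>_. 0)(i := 0 + \<tau>)) - f ((\<lambda>_. 0)(i := 0)) - \<tau> *\<^sub>R a [i]) / norm \<tau>)
        \<midarrow>0\<rightarrow> 0"
    proof (rule tendsto_0_le[where K = 1])
      show "((\<lambda>\<tau>. \<bar>\<tau>\<bar> * (c / \<rho>\<^sup>2)) \<longlongrightarrow> 0) (at 0)"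
        using assms(2) by (auto intro!: tendsto_eq_intros)
      have "\<forall>\<^sub>F \<tau> in at 0. \<bar>\<tau>\<bar> < \<rho>"
        using assms(2) by (auto simp: eventually_at intro!: exI[of _ \<rho>])
      then show "\<forall>\<^sub>F \<tau> in at 0. norm (norm (f ((\<lambda>_. 0)(i := 0 + \<tau>)) - f ((\<lambda>_. 0)(i := 0)) -
          \<tau> *\<^sub>R a [i]) / norm \<tau>) \<le> norm (\<bar>\<tau>\<bar> * (c / \<rho>\<^sup>2)) * 1"
      proof eventually_elim
        case (elim \<tau>)
        have "(\<lambda>_. 0)(i := 0) = (\<lambda>_. 0::real)" by auto
        moreover have "\<bar>\<tau>\<bar> * (c / \<rho>\<^sup>2) * \<bar>\<tau>\<bar> = (\<bar>\<tau>\<bar> / \<rho>)\<^sup>2 * c"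
          by (simp add: power_divide power2_eq_square)
        ultimately show ?case using est[of \<tau>] elim c0
          by (cases "\<tau> = 0") (auto simp: pos_divide_le_eq)
      qed
    qed
  qed
  then show ?thesis
    using assms(3) vector_derivative_unique_at unfolding has_vector_derivative_def[symmetric]
    by metis
qed

section \<open>Difference quotients of analytic maps\<close>

lemma prod_list_norm_mono:
  assumes "\<And>x. x \<in> set xs \<Longrightarrow> norm (f x) \<le> norm (g x)"
  shows "prod_list (map (\<lambda>x. norm (f x)) xs) \<le> prod_list (map (\<lambda>x. norm (g x)) xs)"
  using assms
proof (induction xs)
  case (Cons x xs)
  have "0 \<le> prod_list (map (\<lambda>x. norm (f x)) xs)" by (rule prod_list_nonneg) auto
  then show ?case using Cons by (auto intro!: mult_mono)
qed simp

lemma bounded_multilinear_norm: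
  assumes "bounded_multilinear_on UNIV n m C" "length xs = n"
  shows "norm (m xs) \<le> C * prod_list (map norm xs)"
  using assms unfolding bounded_multilinear_on_def by simp

lemma bounded_multilinear_update:
  assumes "bounded_multilinear_on UNIV n m C" "length xs = n" "i < n"
  shows "m (xs[i := x + y]) = m (xs[i := x]) + m (xs[i := y])"
    and "m (xs[i := c *\<^sub>R x]) = c *\<^sub>R m (xs[i := x])"
  using assms unfolding bounded_multilinear_on_def linear_map_on_def by simp_all

lemma bounded_multilinear_slot:
  assumes "bounded_multilinear_on UNIV n m C" "n = Suc (length xs + length ys)"
  shows "bounded_linear (\<lambda>v. m (xs @ v # ys))"
    and "norm (m (xs @ v # ys)) \<le> C * (prod_list (map norm xs) * prod_list (map norm ys)) * norm v"
proof -
  show bd: "norm (m (xs @ v # ys)) \<le> C * (prod_list (map norm xs) * prod_list (map norm ys)) * norm v" for v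
    using bounded_multilinear_norm[OF assms(1), of "xs @ v # ys"] assms(2) by (simp add: mult_ac)
  show "bounded_linear (\<lambda>v. m (xs @ v # ys))"
  proof (rule bounded_linear_intro)
    show "m (xs @ (x + y) # ys) = m (xs @ x # ys) + m (xs @ y # ys)" for x y
      using bounded_multilinear_update(1)[OF assms(1), of "xs @ 0 # ys" "length xs" x y] assms(2)
      by simp
    show "m (xs @ (c *\<^sub>R x) # ys) = c *\<^sub>R m (xs @ x # ys)" for c x
      using bounded_multilinear_update(2)[OF assms(1), of "xs @ 0 # ys" "length xs" c x] assms(2)
      by simp
    show "norm (m (xs @ x # ys)) \<le> norm x * (C * (prod_list (map norm xs) * prod_list (map norm ys)))" for x
      using bd[of x] by (simp add: mult_ac)
  qed
qed

lemma bounded_multilinear_Cons: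
  fixes m :: "'a::real_normed_vector list \<Rightarrow> 'b::real_normed_vector"
  assumes "bounded_multilinear_on UNIV (Suc n) m C"
  shows "bounded_multilinear_on UNIV n (\<lambda>xs. m (x # xs)) (C * norm x)"
  unfolding bounded_multilinear_on_def
proof (intro conjI allI impI)
  show "0 \<le> C * norm x" using assms unfolding bounded_multilinear_on_def by simp
next
  fix xs :: "'a list" and i assume xs: "length xs = n \<and> set xs \<subseteq> UNIV" and "i < n"
  then show "linear_map_on UNIV (\<lambda>y. m (x # xs[i := y]))"
    using bounded_multilinear_update[OF assms, of "x # xs" "Suc i"]
    unfolding linear_map_on_def by simp
next
  fix xs :: "'a list" assume "length xs = n \<and> set xs \<subseteq> UNIV"
  then show "norm (m (x # xs)) \<le> C * norm x * prod_list (map norm xs)"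
    using bounded_multilinear_norm[OF assms, of "x # xs"] by (simp add: mult_ac)
qed

text \<open>One slot is peeled off at a time: with the first argument frozen the map has one slot
  less, and linearity in that argument lets \<open>f\<close> be put back.\<close>

lemma word_series_multilinear:
  fixes m :: "'a::real_normed_vector list \<Rightarrow> 'b::banach" and f :: "('i \<Rightarrow> real) \<Rightarrow> 'a"
  assumes "bounded_multilinear_on UNIV n m C" "word_series \<rho> f d" "0 < \<rho>"
  shows "word_series \<rho> (\<lambda>t. m (replicate n (f t))) (C * d ^ n)"
  using assms(1)
proof (induction n arbitrary: m C)
  case 0
  have "norm (m []) \<le> C" using bounded_multilinear_norm[OF 0, of "[]"] by simp
  then show ?case using word_series_mono[OF word_series_const[of \<rho> "m []"]] by simp
next
  case (Suc n)
  have C: "0 \<le> C" using Suc.prems unfolding bounded_multilinear_on_def by simp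
  have d: "0 \<le> d" using word_series_nonneg[OF _ assms(2)] assms(3) by simp
  have "word_series \<rho> (\<lambda>t. m (f t # replicate n (f t))) (d * (C * d ^ n))"
  proof (rule word_series_linear_param[where h = "\<lambda>x t. m (x # replicate n (f t))", OF assms(3) _ assms(2)])
    show "0 \<le> C * d ^ n" using C d by simp
    show "bounded_linear (\<lambda>x. m (x # replicate n (f t)))" for t
      using bounded_multilinear_slot(1)[OF Suc.prems, of "[]" "replicate n (f t)"] by simp
    show "word_series \<rho> (\<lambda>t. m (x # replicate n (f t))) (norm x * (C * d ^ n))" for x
      using Suc.IH[OF bounded_multilinear_Cons[OF Suc.prems, of x]] by (simp add: mult_ac)
  qed
  then show ?case by (simp add: mult_ac)
qed

lemma bounded_multilinear_sum:
  fixes m :: "'k \<Rightarrow> 'a::real_normed_vector list \<Rightarrow> 'b::real_normed_vector"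
  assumes "finite I" "\<And>k. k \<in> I \<Longrightarrow> bounded_multilinear_on UNIV n (m k) (C k)"
  shows "bounded_multilinear_on UNIV n (\<lambda>xs. \<Sum>k\<in>I. m k xs) (\<Sum>k\<in>I. C k)"
  unfolding bounded_multilinear_on_def
proof (intro conjI allI impI)
  show "0 \<le> sum C I" using assms unfolding bounded_multilinear_on_def by (simp add: sum_nonneg)
next
  fix xs :: "'a list" and i assume xs: "length xs = n \<and> set xs \<subseteq> UNIV" and "i < n"
  then show "linear_map_on UNIV (\<lambda>y. \<Sum>k\<in>I. m k (xs[i := y]))"
    using bounded_multilinear_update[OF assms(2), of _ xs i]
    unfolding linear_map_on_def by (simp add: sum.distrib scaleR_sum_right)
next
  fix xs :: "'a list" assume "length xs = n \<and> set xs \<subseteq> UNIV"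
  then show "norm (\<Sum>k\<in>I. m k xs) \<le> sum C I * prod_list (map norm xs)"
    using bounded_multilinear_norm[OF assms(2), of _ xs] sum_norm_le[of I "\<lambda>k. m k xs"]
    by (simp add: sum_distrib_right)
qed

text \<open>The \<open>k\<close>-th term of the telescoping sum for \<open>m (y, \<dots>, y) - m (x, \<dots>, x)\<close>.\<close>

definition slot_map ::
    "('a::real_normed_vector list \<Rightarrow> 'b::real_normed_vector) \<Rightarrow> nat \<Rightarrow> ('a \<times> 'a) list \<Rightarrow> 'a \<Rightarrow>\<^sub>L 'b" where
  "slot_map m k zs = Blinfun (\<lambda>v. m (map fst (take k zs) @ v # map snd (drop k zs)))"

lemma slot_map_apply:
  assumes "bounded_multilinear_on UNIV (Suc n) m C" "length zs = n" "k \<le> n"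
  shows "blinfun_apply (slot_map m k zs) v = m (map fst (take k zs) @ v # map snd (drop k zs))"
  unfolding slot_map_def
  using bounded_multilinear_slot(1)[OF assms(1), of "map fst (take k zs)" "map snd (drop k zs)"] assms
  by (simp add: bounded_linear_Blinfun_apply)

text \<open>Regarded as a function of pairs the slot map is again multilinear, with the same bound
  because both projections of a pair are norm-decreasing. This makes the difference quotient an
  analytic map on the product space.\<close>

lemma bounded_multilinear_slot_map:
  assumes "bounded_multilinear_on UNIV (Suc n) m C" "k \<le> n"
  shows "bounded_multilinear_on UNIV n (slot_map m k) C"
  unfolding bounded_multilinear_on_def
proof (intro conjI allI impI)
  show C: "0 \<le> C" using assms unfolding bounded_multilinear_on_def by simp
  fix zs :: "('a \<times> 'a) list" assume "length zs = n \<and> set zs \<subseteq> UNIV"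
  then have zs: "length zs = n" by simp
  {
    fix i assume i: "i < n"
    \<comment> \<open>Entries before position \<open>k\<close> keep their index and use the first
      component; later ones are shifted by one, as \<open>v\<close> has been inserted, and use the
      second.\<close>
    have *: "map fst (take k (zs[i := z])) @ v # map snd (drop k (zs[i := z])) =
        (if i < k then (map fst (take k zs) @ v # map snd (drop k zs))[i := fst z]
         else (map fst (take k zs) @ v # map snd (drop k zs))[Suc i := snd z])" for z v
      using i zs assms(2)
      by (auto simp: take_update_swap map_update drop_update_swap list_update_append Suc_diff_le
          take_update_cancel list_update_beyond)
    define A where "A v = map fst (take k zs) @ v # map snd (drop k zs)" for v
    have A: "length (A v) = Suc n" for v using zs assms(2) by (simp add: A_def)
    have app: "blinfun_apply (slot_map m k (zs[i := z])) v =
        (if i < k then m ((A v)[i := fst z]) else m ((A v)[Suc i := snd z]))" for z v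
      using slot_map_apply[OF assms(1), of "zs[i := z]" k v] zs assms(2) by (simp add: * A_def)
    show "linear_map_on UNIV (\<lambda>z. slot_map m k (zs[i := z]))"
      unfolding linear_map_on_def
      using bounded_multilinear_update[OF assms(1) A] i
      by (auto intro!: blinfun_eqI simp: app blinfun.add_left blinfun.scaleR_left)
  }
  show "norm (slot_map m k zs) \<le> C * prod_list (map norm zs)"
  proof (rule norm_blinfun_bound)
    have nn: "0 \<le> prod_list (map norm ws)" for ws :: "('a \<times> 'a) list"
      by (rule prod_list_nonneg) auto
    show "0 \<le> C * prod_list (map norm zs)" using C nn by simp
    fix v
    have "norm (blinfun_apply (slot_map m k zs) v) \<le>
        C * (prod_list (map norm (map fst (take k zs))) * prod_list (map norm (map snd (drop k zs)))) * norm v"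
      unfolding slot_map_apply[OF assms(1) zs assms(2)]
      by (rule bounded_multilinear_slot(2)[OF assms(1)]) (use zs assms in simp)
    also have "\<dots> \<le> C * (prod_list (map norm (take k zs)) * prod_list (map norm (drop k zs))) * norm v"
      using C prod_list_norm_mono[of "take k zs" fst "\<lambda>z. z"] prod_list_norm_mono[of "drop k zs" snd "\<lambda>z. z"] nn
      by (intro mult_right_mono mult_left_mono mult_mono)
        (auto simp: comp_def norm_fst_le norm_snd_le intro!: prod_list_nonneg)
    also have "prod_list (map norm (take k zs)) * prod_list (map norm (drop k zs)) = prod_list (map norm zs)"
      by (metis append_take_drop_id map_append prod_list.append)
    finally show "norm (blinfun_apply (slot_map m k zs) v) \<le> C * prod_list (map norm zs) * norm v" .
  qed
qed

lemma slot_map_telescope: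
  assumes "bounded_multilinear_on UNIV (Suc n) m C"
  shows "(\<Sum>k\<le>n. blinfun_apply (slot_map m k (replicate n (x, y))) (y - x))
    = m (replicate (Suc n) y) - m (replicate (Suc n) x)"
proof -
  \<comment> \<open>\<open>h k\<close> and \<open>h (Suc k)\<close> differ exactly in slot
    \<open>k\<close>, which holds \<open>y\<close> in the former and \<open>x\<close> in the
    latter.\<close>
  define h where "h k = m (replicate k x @ replicate (Suc n - k) y)" for k
  have "blinfun_apply (slot_map m k (replicate n (x, y))) (y - x) = h k - h (Suc k)" if "k \<le> n" for k
  proof -
    interpret bounded_linear "\<lambda>v. m (replicate k x @ v # replicate (n - k) y)"
      using bounded_multilinear_slot(1)[OF assms, of "replicate k x" "replicate (n - k) y"] that by simp
    have "h k = m (replicate k x @ y # replicate (n - k) y)"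
      unfolding h_def using that by (simp add: Suc_diff_le)
    moreover have "h (Suc k) = m (replicate k x @ x # replicate (n - k) y)"
      unfolding h_def by (metis append.assoc append_Cons append_Nil diff_Suc_Suc replicate_Suc replicate_append_same)
    ultimately show ?thesis
      using slot_map_apply[OF assms, of "replicate n (x, y)" k "y - x"] that diff
      by (simp add: take_replicate min_absorb1)
  qed
  then show ?thesis using sum_telescope[of h n] by (simp add: h_def)
qed

lemma real_analytic_atE:
  assumes "real_analytic_at UNIV F 0"
  obtains r m c where "0 < r" "\<And>n. bounded_multilinear_on UNIV n (m n) (c n)"
    "summable (\<lambda>n. c n * r ^ n)" "\<And>n. 0 \<le> c n"
    "\<And>h. norm h < r \<Longrightarrow> (\<lambda>n. m n (replicate n h)) sums F h"
proof -
  obtain r m c where "0 < r" and m: "\<And>n. bounded_multilinear_on UNIV n (m n) (c n)"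
    and "summable (\<lambda>n. c n * r ^ n)" "\<And>h. norm h < r \<Longrightarrow> (\<lambda>n. m n (replicate n h)) sums F h"
    using assms unfolding real_analytic_at_def by auto
  moreover have "0 \<le> c n" for n using m[of n] unfolding bounded_multilinear_on_def by blast
  ultimately show ?thesis using that by blast
qed

lemma bounded_multilinear_replicate:
  assumes "bounded_multilinear_on UNIV n m C" "norm h \<le> r"
  shows "norm (m (replicate n h)) \<le> C * r ^ n"
proof -
  have "norm (m (replicate n h)) \<le> C * norm h ^ n"
    using bounded_multilinear_norm[OF assms(1), of "replicate n h"] by simp
  also have "\<dots> \<le> C * r ^ n"
    using assms unfolding bounded_multilinear_on_def by (intro mult_left_mono power_mono) auto
  finally show ?thesis .
qed

lemma real_analytic_at_bounded:
  fixes F :: "'a::real_normed_vector \<Rightarrow> 'b::banach"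
  assumes "real_analytic_at UNIV F 0"
  obtains r C where "0 < r" "\<And>h. norm h < r \<Longrightarrow> norm (F h) \<le> C"
proof -
  obtain r m c where r: "0 < r" "\<And>n. bounded_multilinear_on UNIV n (m n) (c n)"
    "summable (\<lambda>n. c n * r ^ n)" "\<And>n. 0 \<le> c n"
    "\<And>h. norm h < r \<Longrightarrow> (\<lambda>n. m n (replicate n h)) sums F h"
    using assms by (rule real_analytic_atE) blast
  have "norm (F h) \<le> (\<Sum>n. c n * r ^ n)" if "norm h < r" for h
  proof -
    have le: "norm (m n (replicate n h)) \<le> c n * r ^ n" for n
      using bounded_multilinear_replicate[OF r(2), of h r n] that by simp
    then have "summable (\<lambda>n. norm (m n (replicate n h)))"
      by (intro summable_comparison_test'[OF r(3), of 0]) auto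
    then show ?thesis
      using suminf_le[OF le _ r(3)] summable_norm[of "\<lambda>n. m n (replicate n h)"] sums_unique[OF r(5)[OF that]]
      by simp
  qed
  then show ?thesis using that r(1) by blast
qed

text \<open>An exact increment formula whose quotient is analytic in both endpoints jointly. Applied
  to a map and then to its quotient it takes the place of Taylor's theorem with integral
  remainder.\<close>

lemma real_analytic_difference_quotient:
  fixes F :: "'a::real_normed_vector \<Rightarrow> 'b::banach"
  assumes "real_analytic_at UNIV F 0"
  obtains D :: "'a \<times> 'a \<Rightarrow> 'a \<Rightarrow>\<^sub>L 'b" and r where "real_analytic_at UNIV D 0" "0 < r"
    "\<And>x y. norm x < r \<Longrightarrow> norm y < r \<Longrightarrow> F y - F x = blinfun_apply (D (x, y)) (y - x)"
proof -
  obtain r m c where r: "0 < r" "\<And>n. bounded_multilinear_on UNIV n (m n) (c n)"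
    "summable (\<lambda>n. c n * r ^ n)" "\<And>n. 0 \<le> c n"
    "\<And>h. norm h < r \<Longrightarrow> (\<lambda>n. m n (replicate n h)) sums F h"
    using assms by (rule real_analytic_atE) blast
  define d where "d n zs = (\<Sum>k\<le>n. slot_map (m (Suc n)) k zs)" for n zs
  define D where "D z = (\<Sum>n. d n (replicate n z))" for z
  \<comment> \<open>The bounds of the quotient are those of the formally differentiated series,
    which converges strictly inside radius \<open>r\<close>.\<close>
  define s where "s = r / 2"
  have s: "0 < s" "s < r" using r(1) by (auto simp: s_def)
  \<comment> \<open>Degree \<open>n\<close> of the quotient comes from degree \<open>Suc n\<close>
    of \<open>F\<close>, with one term for each of the \<open>Suc n\<close> slots.\<close>
  define e where "e n = of_nat (Suc n) * c (Suc n)" for n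
  have d: "bounded_multilinear_on UNIV n (d n) (e n)" for n
    using bounded_multilinear_sum[of "{..n}" n "\<lambda>k. slot_map (m (Suc n)) k" "\<lambda>_. c (Suc n)"]
      bounded_multilinear_slot_map[OF r(2)] unfolding d_def e_def by simp
  have es: "summable (\<lambda>n. e n * s ^ n)"
  proof -
    have "summable (\<lambda>n. c n * x ^ n)" if "norm x < r" for x
    proof (rule summable_comparison_test'[OF r(3), of 0])
      have "\<bar>x\<bar> ^ n \<le> r ^ n" for n using that by (intro power_mono) auto
      then show "norm (c n * x ^ n) \<le> c n * r ^ n" for n
        using r(4)[of n] by (simp add: abs_mult power_abs mult_left_mono)
    qed
    then have "summable (\<lambda>n. diffs c n * s ^ n)"
      using termdiff_converges[of s r c] s by simp
    then show ?thesis by (simp add: diffs_def e_def)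
  qed
  have Ds: "(\<lambda>n. d n (replicate n z)) sums D z" if "norm z < s" for z
  proof -
    have "norm (d n (replicate n z)) \<le> e n * s ^ n" for n
      using bounded_multilinear_replicate[OF d, of z s n] that by simp
    then have "summable (\<lambda>n. d n (replicate n z))"
      by (intro summable_norm_cancel[OF summable_comparison_test'[OF es, of 0]]) auto
    then show ?thesis unfolding D_def by (rule summable_sums)
  qed
  have "real_analytic_at UNIV D 0"
    unfolding real_analytic_at_def using s(1) d es Ds by (intro exI[of _ s] conjI exI[of _ d] exI[of _ e]) auto
  moreover have "F y - F x = blinfun_apply (D (x, y)) (y - x)"
    if "norm x < s / 2" "norm y < s / 2" for x y
  proof -
    have "norm (x, y) < s" using that norm_Pair_le[of x y] by simp
    then have "(\<lambda>n. blinfun_apply (d n (replicate n (x, y))) (y - x)) sums blinfun_apply (D (x, y)) (y - x)"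
      by (intro bounded_linear.sums[OF blinfun.bounded_linear_left] Ds)
    moreover have "blinfun_apply (d n (replicate n (x, y))) (y - x) =
        m (Suc n) (replicate (Suc n) y) - m (Suc n) (replicate (Suc n) x)" for n
      using slot_map_telescope[OF r(2)] unfolding d_def by (simp add: blinfun.sum_left)
    moreover have "(\<lambda>n. m n (replicate n y) - m n (replicate n x)) sums (F y - F x)"
      using that s by (intro sums_diff r(5)) auto
    then have "(\<lambda>n. m (Suc n) (replicate (Suc n) y) - m (Suc n) (replicate (Suc n) x)) sums (F y - F x)"
      using sums_Suc_iff[of "\<lambda>n. m n (replicate n y) - m n (replicate n x)" "F y - F x"] by simp
    ultimately show ?thesis using sums_unique2 by simp
  qed
  ultimately show ?thesis using that[of D "s / 2"] s(1) by simp
qed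

lemma real_analytic_at_tendsto:
  fixes F :: "'a::real_normed_vector \<Rightarrow> 'b::banach"
  assumes "real_analytic_at UNIV F 0"
  shows "(F \<longlongrightarrow> F 0) (nhds 0)"
proof -
  obtain D r where D: "real_analytic_at UNIV D 0" "0 < r"
    "\<And>x y. norm x < r \<Longrightarrow> norm y < r \<Longrightarrow> F y - F x = blinfun_apply (D (x, y)) (y - x)"
    using real_analytic_difference_quotient[OF assms] by metis
  obtain s C where s: "0 < s" "\<And>z. norm z < s \<Longrightarrow> norm (D z) \<le> C"
    using D(1) by (rule real_analytic_at_bounded) blast
  have "\<forall>\<^sub>F y in nhds 0. norm y < min r s"
    using D(2) s(1) by (auto simp: eventually_nhds_metric intro!: exI[of _ "min r s"])
  then have "\<forall>\<^sub>F y in nhds 0. norm (F y - F 0) \<le> norm y * C"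
  proof eventually_elim
    case (elim y)
    have "norm (F y - F 0) \<le> norm (D (0, y)) * norm y"
      using D(3)[of 0 y] elim D(2) by (simp add: norm_blinfun)
    also have "\<dots> \<le> C * norm y" using s(2)[of "(0, y)"] elim
      by (intro mult_right_mono) (auto simp: norm_Pair)
    finally show ?case by (simp add: mult.commute)
  qed
  moreover have "((\<lambda>y::'a. norm y * C) \<longlongrightarrow> 0) (nhds 0)"
    using tendsto_mult_left_zero[OF tendsto_norm_zero[OF tendsto_ident_at[of 0 UNIV]], of C]
    by (auto simp: tendsto_nhds_iff)
  ultimately have "((\<lambda>y. F y - F 0) \<longlongrightarrow> 0) (nhds 0)" by (rule Lim_null_comparison)
  then show ?thesis by (rule Lim_null[THEN iffD2])
qed

text \<open>The quotient of \<open>D\<close> itself bounds \<open>D (x, y) - D (x, x)\<close> by a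
  multiple of \<open>norm (y - x)\<close>, so replacing \<open>D (x, y)\<close> by
  \<open>D (x, x)\<close> costs a quadratic error. Since \<open>D\<close> is an arbitrary analytic
  quotient, this identifies the diagonal values of every quotient obtained from the previous
  lemma.\<close>

lemma real_analytic_has_derivative_diagonal:
  fixes F :: "'a::real_normed_vector \<Rightarrow> 'b::banach"
  assumes D: "real_analytic_at UNIV D 0" "0 < r"
    "\<And>x y. norm x < r \<Longrightarrow> norm y < r \<Longrightarrow> F y - F x = blinfun_apply (D (x, y)) (y - x)"
  shows "\<forall>\<^sub>F x in nhds 0. (F has_derivative blinfun_apply (D (x, x))) (at x)"
proof -
  obtain D' r' where D': "real_analytic_at UNIV D' 0" "0 < r'"
    "\<And>x y. norm x < r' \<Longrightarrow> norm y < r' \<Longrightarrow> D y - D x = blinfun_apply (D' (x, y)) (y - x)"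
    using real_analytic_difference_quotient[OF D(1)] by metis
  obtain s C where s: "0 < s" "\<And>z. norm z < s \<Longrightarrow> norm (D' z) \<le> C"
    using D'(1) by (rule real_analytic_at_bounded) blast
  \<comment> \<open>A pair is bounded by the sum of its entries, used once for points and once more
    for pairs of points; hence the factors 2 and 4.\<close>
  define \<delta> where "\<delta> = min r (min (r' / 2) (s / 4))"
  have \<delta>: "0 < \<delta>" "\<delta> \<le> r" "2 * \<delta> \<le> r'" "4 * \<delta> \<le> s" using D(2) D'(2) s(1) by (auto simp: \<delta>_def)
  have "(F has_derivative blinfun_apply (D (x, x))) (at x)" if x: "norm x < \<delta>" for x
  proof (rule has_derivativeI_sandwich[where H = "\<lambda>y. C * norm (y - x)"])
    show "0 < \<delta> - norm x" using x by simp
    show "bounded_linear (blinfun_apply (D (x, x)))" by (rule blinfun.bounded_linear_right)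
    have "((\<lambda>y. C * norm (y - x)) \<longlongrightarrow> C * norm (x - x)) (at x)" by (intro tendsto_intros)
    then show "((\<lambda>y. C * norm (y - x)) \<longlongrightarrow> 0) (at x)" by simp
    fix y assume y: "y \<in> UNIV" "y \<noteq> x" "dist y x < \<delta> - norm x"
    then have ny: "norm y < \<delta>" using norm_triangle_sub[of y x] by (simp add: dist_norm)
    have xx: "norm (x, x) < 2 * \<delta>" "norm (x, y) < 2 * \<delta>"
      using norm_Pair_le[of x x] norm_Pair_le[of x y] x ny by simp_all
    then have "norm ((x, x), (x, y)) < 4 * \<delta>" using norm_Pair_le[of "(x, x)" "(x, y)"] by linarith
    then have C: "norm (D' ((x, x), (x, y))) \<le> C" using s(2) \<delta> by simp
    have "F y - F x - blinfun_apply (D (x, x)) (y - x) = blinfun_apply (D (x, y) - D (x, x)) (y - x)"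
      using D(3)[of x y] x ny \<delta> by (simp add: blinfun.diff_left)
    also have "D (x, y) - D (x, x) = blinfun_apply (D' ((x, x), (x, y))) (0, y - x)"
      using D'(3)[of "(x, x)" "(x, y)"] xx \<delta> by simp
    finally have "norm (F y - F x - blinfun_apply (D (x, x)) (y - x))
        \<le> norm (blinfun_apply (D' ((x, x), (x, y))) (0, y - x)) * norm (y - x)"
      by (simp add: norm_blinfun)
    also have "\<dots> \<le> (C * norm (0::'a, y - x)) * norm (y - x)"
      by (intro mult_right_mono order_trans[OF norm_blinfun] C) auto
    finally show "norm (F y - F x - blinfun_apply (D (x, x)) (y - x)) / norm (y - x) \<le> C * norm (y - x)"
      using y by (simp add: divide_simps norm_Pair)
  qed
  then show ?thesis using \<delta>(1) unfolding eventually_nhds_metric by (auto intro!: exI[of _ \<delta>])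
qed

section \<open>Germs of word series\<close>

text \<open>Neighbourhoods of 0 in the sup norm over all letters. The product topology would be too
  coarse, as it controls finitely many letters only.\<close>

definition polydisc_filter :: "('i \<Rightarrow> real) filter" where
  "polydisc_filter = (INF \<rho>\<in>{0<..}. principal {t. \<forall>i. \<bar>t i\<bar> \<le> \<rho>})"

lemma eventually_polydisc_filter:
  "eventually P polydisc_filter \<longleftrightarrow> (\<exists>\<rho>>0. \<forall>t. (\<forall>i. \<bar>t i\<bar> \<le> \<rho>) \<longrightarrow> P t)"
  unfolding polydisc_filter_def
proof (subst eventually_INF_base)
  fix a b :: real assume "a \<in> {0<..}" "b \<in> {0<..}"
  then show "\<exists>x\<in>{0<..}. principal {t. \<forall>i. \<bar>t i\<bar> \<le> x} \<le>
      inf (principal {t. \<forall>i. \<bar>t i\<bar> \<le> a}) (principal {t. \<forall>i. \<bar>t i\<bar> \<le> b})"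
    by (intro bexI[of _ "min a b"]) auto
qed (auto simp: eventually_principal)

definition analytic_germ :: "(('i \<Rightarrow> real) \<Rightarrow> 'b::real_normed_vector) \<Rightarrow> bool" where
  "analytic_germ f \<longleftrightarrow> (\<exists>\<rho>>0. \<exists>c. word_series \<rho> f c)"

lemma eventually_at_right_0I: "0 < \<rho> \<Longrightarrow> (\<And>\<theta>. 0 < \<theta> \<Longrightarrow> \<theta> < \<rho> \<Longrightarrow> P \<theta>) \<Longrightarrow> eventually P (at_right (0::real))"
  unfolding eventually_at_right_field by auto

lemma analytic_germI:
  assumes "\<forall>\<^sub>F \<rho> in at_right 0. word_series \<rho> f c"
  shows "analytic_germ f"
proof -
  have "\<forall>\<^sub>F \<rho> in at_right (0::real). 0 < \<rho> \<and> word_series \<rho> f c"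
    using assms eventually_at_right_less[of "0::real"] by eventually_elim auto
  from eventually_happens'[OF _ this] show ?thesis unfolding analytic_germ_def by auto
qed

lemma analytic_germE:
  assumes "analytic_germ f"
  obtains c where "\<forall>\<^sub>F \<rho> in at_right 0. word_series \<rho> f c"
proof -
  obtain \<rho> c where "0 < \<rho>" "word_series \<rho> f c" using assms unfolding analytic_germ_def by blast
  then have "\<forall>\<^sub>F \<theta> in at_right 0. word_series \<theta> f c"
    by (intro eventually_at_right_0I[of \<rho>]) (auto intro: word_series_radius_mono)
  then show ?thesis using that by blast
qed

lemma analytic_germ_small:
  assumes "analytic_germ f" "f (\<lambda>_. 0) = 0" "0 < \<epsilon>"
  shows "\<forall>\<^sub>F \<rho> in at_right 0. word_series \<rho> f \<epsilon>"
proof -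
  obtain \<rho> c where \<rho>: "0 < \<rho>" "word_series \<rho> f c" using assms(1) unfolding analytic_germ_def by blast
  have c: "0 \<le> c" using word_series_nonneg[OF _ \<rho>(2)] \<rho>(1) by simp
  show ?thesis
  proof (rule eventually_at_right_0I[of "min \<rho> (\<epsilon> * \<rho> / (c + 1))"])
    show "0 < min \<rho> (\<epsilon> * \<rho> / (c + 1))" using \<rho>(1) c assms(3) by simp
    fix \<theta> assume \<theta>: "0 < \<theta>" "\<theta> < min \<rho> (\<epsilon> * \<rho> / (c + 1))"
    then have "\<theta> * (c + 1) < \<epsilon> * \<rho>" using c by (simp add: pos_less_divide_eq)
    then have "\<theta> / \<rho> * c \<le> \<epsilon>" using \<rho>(1) \<theta>(1) by (simp add: divide_simps algebra_simps)
    moreover have "word_series \<theta> f (\<theta> / \<rho> * c)"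
      using \<theta> \<rho> assms(2) by (intro word_series_small) auto
    ultimately show "word_series \<theta> f \<epsilon>" by (rule word_series_mono[rotated])
  qed
qed

lemma analytic_germ_const: "analytic_germ (\<lambda>t. x)"
  by (rule analytic_germI[of _ "norm x"]) (simp add: word_series_const)

lemma analytic_germ_var: "analytic_germ (\<lambda>t. t i)"
  unfolding analytic_germ_def using word_series_var[of 1 i] by (intro exI[of _ 1]) auto

lemma analytic_germ_linear:
  assumes "bounded_linear h" "analytic_germ f"
  shows "analytic_germ (\<lambda>t. h (f t))"
proof -
  interpret bounded_linear h by fact
  obtain K where K: "0 \<le> K" "\<And>x. norm (h x) \<le> norm x * K" using nonneg_bounded by blast
  obtain c where c: "\<forall>\<^sub>F \<rho> in at_right 0. word_series \<rho> f c" using assms(2) by (rule analytic_germE)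
  from c eventually_at_right_less[of "0::real"]
  have "\<forall>\<^sub>F \<rho> in at_right 0. word_series \<rho> (\<lambda>t. h (f t)) (K * c)"
    by eventually_elim (rule word_series_linear[OF assms(1)], use K in \<open>auto simp: mult.commute\<close>)
  then show ?thesis by (rule analytic_germI)
qed

lemma analytic_germ_add:
  assumes "analytic_germ f" "analytic_germ g"
  shows "analytic_germ (\<lambda>t. f t + g t)"
proof -
  obtain c where c: "\<forall>\<^sub>F \<rho> in at_right 0. word_series \<rho> f c" using assms(1) by (rule analytic_germE)
  obtain d where d: "\<forall>\<^sub>F \<rho> in at_right 0. word_series \<rho> g d" using assms(2) by (rule analytic_germE)
  from c d eventually_at_right_less[of "0::real"]
  have "\<forall>\<^sub>F \<rho> in at_right 0. word_series \<rho> (\<lambda>t. f t + g t) (c + d)"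
    by eventually_elim (rule word_series_add, auto)
  then show ?thesis by (rule analytic_germI)
qed

lemma analytic_germ_bilinear:
  fixes prod :: "'a::real_normed_vector \<Rightarrow> 'b::real_normed_vector \<Rightarrow> 'c::banach"
  assumes "bounded_bilinear prod" "analytic_germ f" "analytic_germ g"
  shows "analytic_germ (\<lambda>t. prod (f t) (g t))"
proof -
  interpret bounded_bilinear prod by fact
  obtain K where K: "0 \<le> K" "\<And>x y. norm (prod x y) \<le> norm x * norm y * K"
    using nonneg_bounded by blast
  obtain c where c: "\<forall>\<^sub>F \<rho> in at_right 0. word_series \<rho> f c" using assms(2) by (rule analytic_germE)
  obtain d where d: "\<forall>\<^sub>F \<rho> in at_right 0. word_series \<rho> g d" using assms(3) by (rule analytic_germE)
  from c d eventually_at_right_less[of "0::real"]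
  have "\<forall>\<^sub>F \<rho> in at_right 0. word_series \<rho> (\<lambda>t. prod (f t) (g t)) (c * (K * d))"
    by eventually_elim (rule word_series_bilinear[OF assms(1)], use K in auto)
  then show ?thesis by (rule analytic_germI)
qed

lemmas analytic_germ_uminus = analytic_germ_linear[OF bounded_linear_minus[OF bounded_linear_ident]]
lemmas analytic_germ_scaleR = analytic_germ_bilinear[OF bounded_bilinear_scaleR]
lemmas analytic_germ_blinfun_apply = analytic_germ_bilinear[OF bounded_bilinear_blinfun_apply]
lemmas analytic_germ_compose = analytic_germ_bilinear[OF bounded_bilinear_blinfun_compose]

lemma analytic_germ_diff: "analytic_germ f \<Longrightarrow> analytic_germ g \<Longrightarrow> analytic_germ (\<lambda>t. f t - g t)"
  using analytic_germ_add[OF _ analytic_germ_uminus, of f g] by simp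

lemma analytic_germ_Pair:
  assumes "analytic_germ f" "analytic_germ g"
  shows "analytic_germ (\<lambda>t. (f t, g t))"
proof -
  have "analytic_germ (\<lambda>t. (f t, 0) + (0, g t))"
    by (intro analytic_germ_add analytic_germ_linear[OF _ assms(1)] analytic_germ_linear[OF _ assms(2)]
        bounded_linear_Pair bounded_linear_ident bounded_linear_zero)
  then show ?thesis by simp
qed

lemma analytic_germ_sum:
  assumes "\<And>i. i \<in> I \<Longrightarrow> analytic_germ (f i)"
  shows "analytic_germ (\<lambda>t. \<Sum>i\<in>I. f i t)"
  using assms
proof (induction I rule: infinite_finite_induct)
  case (insert x F)
  then show ?case by (auto intro!: analytic_germ_add)
qed (auto intro: analytic_germ_const)

lemma eventually_norm_le_of_word_series:
  assumes "\<forall>\<^sub>F \<rho> in at_right 0. word_series \<rho> f c"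
  shows "\<forall>\<^sub>F t in polydisc_filter. norm (f t) \<le> c"
proof -
  have "\<forall>\<^sub>F \<rho> in at_right (0::real). 0 < \<rho> \<and> word_series \<rho> f c"
    using assms eventually_at_right_less[of "0::real"] by eventually_elim auto
  from eventually_happens'[OF _ this] show ?thesis
    unfolding eventually_polydisc_filter using word_series_norm_le[of _ f c] by auto
qed

lemma analytic_germ_tendsto:
  assumes "analytic_germ f"
  shows "(f \<longlongrightarrow> f (\<lambda>_. 0)) polydisc_filter"
proof (rule tendstoI)
  fix e :: real assume "0 < e"
  then have "\<forall>\<^sub>F \<rho> in at_right 0. word_series \<rho> (\<lambda>t. f t - f (\<lambda>_. 0)) (e / 2)"
    by (intro analytic_germ_small analytic_germ_diff assms analytic_germ_const) auto
  from eventually_norm_le_of_word_series[OF this]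
  show "\<forall>\<^sub>F t in polydisc_filter. dist (f t) (f (\<lambda>_. 0)) < e"
    by eventually_elim (use \<open>0 < e\<close> in \<open>simp add: dist_norm\<close>)
qed

text \<open>As \<open>f\<close> vanishes at 0, its norm drops below \<open>r / 2\<close> on a small
  polydisc, and the homogeneous terms of \<open>F\<close> evaluated at \<open>f\<close> form a
  convergent series of word series.\<close>

lemma analytic_germ_comp:
  fixes F :: "'a::real_normed_vector \<Rightarrow> 'b::banach" and f :: "('i \<Rightarrow> real) \<Rightarrow> 'a"
  assumes "real_analytic_at UNIV F 0" "analytic_germ f" "f (\<lambda>_. 0) = 0"
  shows "analytic_germ (\<lambda>t. F (f t))"
proof -
  obtain r m c where r: "0 < r" "\<And>n. bounded_multilinear_on UNIV n (m n) (c n)"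
    "summable (\<lambda>n. c n * r ^ n)" "\<And>n. 0 \<le> c n"
    "\<And>h. norm h < r \<Longrightarrow> (\<lambda>n. m n (replicate n h)) sums F h"
    using assms(1) by (rule real_analytic_atE) blast
  define d where "d n = c n * (r / 2) ^ n" for n
  have d: "summable d"
  proof (rule summable_comparison_test'[OF r(3), of 0])
    show "norm (d n) \<le> c n * r ^ n" for n
      using r(1,4) unfolding d_def by (auto intro!: mult_left_mono power_mono)
  qed
  have ds: "d summable_on UNIV"
  proof (rule norm_summable_imp_summable_on)
    have "norm (d n) = d n" for n using r(1,4) by (simp add: d_def)
    then show "summable (\<lambda>n. norm (d n))" using d by simp
  qed
  have "\<forall>\<^sub>F \<rho> in at_right 0. word_series \<rho> f (r / 2)"
    using analytic_germ_small[OF assms(2,3)] r(1) by simp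
  with eventually_at_right_less[of "0::real"]
  have "\<forall>\<^sub>F \<rho> in at_right 0. word_series \<rho> (\<lambda>t. F (f t)) (infsum d UNIV)"
  proof eventually_elim
    case (elim \<rho>)
    show ?case
    proof (rule word_series_infsum[where f = "\<lambda>n t. m n (replicate n (f t))", OF elim(1) _ ds])
      show "word_series \<rho> (\<lambda>t. m n (replicate n (f t))) (d n)" for n
        unfolding d_def by (rule word_series_multilinear[OF r(2) elim(2,1)])
      fix t :: "'i \<Rightarrow> real" assume t: "\<And>i. \<bar>t i\<bar> \<le> \<rho>"
      have ft: "norm (f t) \<le> r / 2" using word_series_norm_le[OF elim(2)] t by blast
      have "norm (m n (replicate n (f t))) \<le> d n" for n
        unfolding d_def using bounded_multilinear_replicate[OF r(2) ft] .
      then have "summable (\<lambda>n. norm (m n (replicate n (f t))))"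
        by (intro summable_comparison_test'[OF d, of 0]) auto
      then show "((\<lambda>n. m n (replicate n (f t))) has_sum F (f t)) UNIV"
        by (rule norm_summable_imp_has_sum) (use ft r in auto)
    qed
  qed
  then show ?thesis by (rule analytic_germI)
qed

text \<open>\<open>N\<close> vanishes at 0, so its norm is at most 1/2 on a small polydisc. Only the
  fixed point equation is exported; uniqueness is recovered at the place of use from the smallness
  of \<open>N\<close>.\<close>

lemma analytic_germ_neumann:
  fixes N :: "('i \<Rightarrow> real) \<Rightarrow> 'a::banach \<Rightarrow>\<^sub>L 'a"
  assumes "analytic_germ N" "N (\<lambda>_. 0) = 0" "analytic_germ b"
  obtains z where "analytic_germ z"
    "\<forall>\<^sub>F t in polydisc_filter. z t = b t + blinfun_apply (N t) (z t)"
proof -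
  define x where "x n t = ((blinfun_apply (N t)) ^^ n) (b t)" for n t
  define z where "z t = (\<Sum>n. x n t)" for t
  obtain c where c: "\<forall>\<^sub>F \<rho> in at_right 0. word_series \<rho> b c" using assms(3) by (rule analytic_germE)
  define d where "d n = c * (1 / 2) ^ n" for n :: nat
  have d: "summable (\<lambda>n. d n)" unfolding d_def by (intro summable_mult summable_geometric) simp
  have N: "\<forall>\<^sub>F \<rho> in at_right 0. word_series \<rho> N (1 / 2)"
    by (rule analytic_germ_small[OF assms(1,2)]) simp
  have x: "\<forall>\<^sub>F \<rho> in at_right 0. 0 < \<rho> \<and> (\<forall>n. word_series \<rho> (x n) (d n))"
    using c N eventually_at_right_less[of "0::real"]
  proof eventually_elim
    case (elim \<rho>)
    have "word_series \<rho> (x n) (d n)" for n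
    proof (induction n)
      case 0
      then show ?case using elim(1) by (simp add: x_def d_def)
    next
      case (Suc n)
      show ?case using word_series_blinfun_apply[OF elim(2) Suc elim(3)] by (simp add: x_def d_def mult_ac)
    qed
    then show ?case using elim by simp
  qed
  have sums: "summable (\<lambda>n. norm (x n t))"
    if "\<forall>n. word_series \<rho> (x n) (d n)" "\<And>i. \<bar>t i\<bar> \<le> \<rho>" for \<rho> t
  proof (rule summable_comparison_test'[OF d, of 0])
    show "norm (norm (x n t)) \<le> d n" for n using word_series_norm_le[of \<rho> "x n" "d n" t] that by simp
  qed
  have "\<forall>\<^sub>F \<rho> in at_right 0. word_series \<rho> z (infsum d UNIV)"
    using x
  proof eventually_elim
    case (elim \<rho>)
    then have d0: "0 \<le> d n" for n using word_series_nonneg[of \<rho> "x n" "d n"] by simp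
    show ?case
    proof (rule word_series_infsum[of \<rho> x d])
      show "d summable_on UNIV" using norm_summable_imp_summable_on[of d] d d0 by simp
      fix t :: "'i \<Rightarrow> real" assume t: "\<And>i. \<bar>t i\<bar> \<le> \<rho>"
      have "summable (\<lambda>n. norm (x n t))" using sums elim t by blast
      then show "((\<lambda>n. x n t) has_sum z t) UNIV"
        by (intro norm_summable_imp_has_sum) (auto simp: z_def summable_sums summable_norm_cancel)
    qed (use elim in auto)
  qed
  then have gz: "analytic_germ z" by (rule analytic_germI)
  obtain \<rho> where \<rho>: "0 < \<rho>" "\<forall>n. word_series \<rho> (x n) (d n)"
    using eventually_happens'[OF _ x] by auto
  have "z t = b t + blinfun_apply (N t) (z t)" if "\<And>i. \<bar>t i\<bar> \<le> \<rho>" for t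
  proof -
    have s: "summable (\<lambda>n. x n t)" using sums[OF \<rho>(2) that] by (rule summable_norm_cancel)
    have xS: "x (Suc n) t = blinfun_apply (N t) (x n t)" for n by (simp add: x_def)
    have z1: "z t = x 0 t + (\<Sum>n. x (Suc n) t)" unfolding z_def using suminf_split_head[OF s] by simp
    have z2: "(\<Sum>n. x (Suc n) t) = blinfun_apply (N t) (z t)"
      using bounded_linear.suminf[OF blinfun.bounded_linear_right[of "N t"] s]
      unfolding xS z_def by (rule sym)
    have "x 0 t = b t" by (simp add: x_def)
    then show ?thesis using z1 unfolding z2 by simp
  qed
  then have "\<forall>\<^sub>F t in polydisc_filter. z t = b t + blinfun_apply (N t) (z t)"
    unfolding eventually_polydisc_filter using \<rho>(1) by blast
  with gz show ?thesis using that by blast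
qed

section \<open>Lipschitz estimates for substitution\<close>

lemma word_series_word_monomial_diff:
  assumes "\<And>j. word_series \<theta> (\<sigma> j) \<rho>" "\<And>j. word_series \<theta> (\<sigma>' j) \<rho>"
    "\<And>j. word_series \<theta> (\<lambda>t. \<sigma> j t - \<sigma>' j t) \<delta>" "0 < \<theta>"
  shows "word_series \<theta> (\<lambda>t. word_monomial (\<lambda>j. \<sigma> j t) w - word_monomial (\<lambda>j. \<sigma>' j t) w)
    (real (length w) * \<rho> ^ (length w - 1) * \<delta>)"
proof (induction w)
  case Nil
  then show ?case using word_series_const[of \<theta> "0::real"] by simp
next
  case (Cons j w)
  \<comment> \<open>Product rule: exchange the first letter, then the remaining word.\<close>
  have "word_series \<theta> (\<lambda>t. (\<sigma> j t - \<sigma>' j t) * word_monomial (\<lambda>j. \<sigma> j t) w +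
        \<sigma>' j t * (word_monomial (\<lambda>j. \<sigma> j t) w - word_monomial (\<lambda>j. \<sigma>' j t) w))
      (\<delta> * \<rho> ^ length w + \<rho> * (real (length w) * \<rho> ^ (length w - 1) * \<delta>))"
    by (intro word_series_add word_series_mult word_series_word_monomial assms Cons less_imp_le)
  moreover have "\<delta> * \<rho> ^ length w + \<rho> * (real (length w) * \<rho> ^ (length w - 1) * \<delta>) =
      real (length (j # w)) * \<rho> ^ (length (j # w) - 1) * \<delta>"
    by (cases w) (auto simp: algebra_simps)
  moreover have "(\<lambda>t. (\<sigma> j t - \<sigma>' j t) * word_monomial (\<lambda>j. \<sigma> j t) w +
        \<sigma>' j t * (word_monomial (\<lambda>j. \<sigma> j t) w - word_monomial (\<lambda>j. \<sigma>' j t) w)) =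
      (\<lambda>t. word_monomial (\<lambda>j. \<sigma> j t) (j # w) - word_monomial (\<lambda>j. \<sigma>' j t) (j # w))"
    by (auto simp: algebra_simps)
  ultimately show ?case by (simp only:)
qed

text \<open>The source of contraction: for words of length at least two a factor
  \<open>\<rho>\<close> survives, which can be made small. For length one the left-hand side is 1
  and nothing is gained.\<close>

lemma length_times_power_le:
  fixes \<rho> \<rho>0 :: real
  assumes "2 \<le> l" "0 < \<rho>" "\<rho> \<le> \<rho>0 / 2"
  shows "real l * \<rho> ^ (l - 1) \<le> 2 * \<rho> / \<rho>0\<^sup>2 * \<rho>0 ^ l"
proof -
  obtain k where k: "l = Suc (Suc k)" using assms(1) by (metis add_2_eq_Suc le_Suc_ex)
  have "real l \<le> 2 * 2 ^ k" unfolding k by (induction k) auto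
  moreover have "\<rho> ^ k \<le> (\<rho>0 / 2) ^ k" using assms by (intro power_mono) auto
  ultimately have "real l * \<rho> ^ k \<le> (2 * 2 ^ k) * (\<rho>0 / 2) ^ k"
    using assms by (intro mult_mono) auto
  also have "\<dots> = 2 * \<rho>0 ^ k" by (simp add: power_divide)
  finally have "real l * \<rho> ^ k * \<rho> \<le> 2 * \<rho>0 ^ k * \<rho>" using assms by (intro mult_right_mono) auto
  then show ?thesis using assms by (simp add: k power2_eq_square mult_ac)
qed

text \<open>The empty word cancels in the difference, one-letter words drop out by the alternative
  \<open>first\<close>, and longer words carry the small factor of the preceding estimate. The
  alternative fits an implicit equation: parameter letters receive the same substitution on both
  sides, and letters of unknowns have coefficient 0.\<close>

lemma word_series_lipschitz:
  fixes f :: "('j \<Rightarrow> real) \<Rightarrow> 'b::banach" and \<sigma> \<sigma>' :: "'j \<Rightarrow> ('i \<Rightarrow> real) \<Rightarrow> real"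
  assumes a: "word_expansion \<rho>0 a f" "(\<Sum>\<^sub>\<infinity>w. norm (a w) * \<rho>0 ^ length w) \<le> c"
    and \<rho>: "0 < \<rho>" "\<rho> \<le> \<rho>0 / 2"
    and first: "\<And>j. a [j] = 0 \<or> \<sigma> j = \<sigma>' j"
    and \<sigma>: "\<And>j. word_series \<theta> (\<sigma> j) \<rho>" "\<And>j. word_series \<theta> (\<sigma>' j) \<rho>"
    "\<And>j. word_series \<theta> (\<lambda>t. \<sigma> j t - \<sigma>' j t) \<delta>" "0 < \<theta>"
  shows "word_series \<theta> (\<lambda>t. f (\<lambda>j. \<sigma> j t) - f (\<lambda>j. \<sigma>' j t)) (2 * \<rho> / \<rho>0\<^sup>2 * c * \<delta>)"
proof -
  have \<delta>: "0 \<le> \<delta>" using word_series_nonneg[OF _ \<sigma>(3)] \<sigma>(4) by simp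
  define K where "K = 2 * \<rho> / \<rho>0\<^sup>2"
  have K: "0 \<le> K" using \<rho> by (simp add: K_def)
  have s0: "(\<lambda>w. norm (a w) * \<rho>0 ^ length w) summable_on UNIV"
    using a(1) unfolding word_expansion_def by blast
  define C where "C w = (K * \<delta>) * (norm (a w) * \<rho>0 ^ length w)" for w
  have Cs: "C summable_on UNIV" unfolding C_def using s0 by (rule summable_on_cmult_right)
  have "word_series \<theta> (\<lambda>t. f (\<lambda>j. \<sigma> j t) - f (\<lambda>j. \<sigma>' j t)) (infsum C UNIV)"
  proof (rule word_series_infsum[where f = "\<lambda>w t.
        (word_monomial (\<lambda>j. \<sigma> j t) w - word_monomial (\<lambda>j. \<sigma>' j t) w) *\<^sub>R a w", OF \<sigma>(4) _ Cs])
    fix w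
    show "word_series \<theta> (\<lambda>t. (word_monomial (\<lambda>j. \<sigma> j t) w - word_monomial (\<lambda>j. \<sigma>' j t) w) *\<^sub>R a w) (C w)"
    proof (cases "2 \<le> length w")
      case True
      define B where "B = real (length w) * \<rho> ^ (length w - 1) * \<delta>"
      have "word_series \<theta> (\<lambda>t. (word_monomial (\<lambda>j. \<sigma> j t) w - word_monomial (\<lambda>j. \<sigma>' j t) w) *\<^sub>R a w)
          (norm (a w) * B)"
        using word_series_linear[OF bounded_linear_scaleR_left[of "a w"] _ _
            word_series_word_monomial_diff[where \<sigma> = \<sigma> and \<sigma>' = \<sigma>' and w = w, OF \<sigma>], of "norm (a w)"] \<sigma>(4)
        unfolding B_def by simp
      moreover have "norm (a w) * B \<le> C w"
      proof -
        have "B \<le> (K * \<rho>0 ^ length w) * \<delta>"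
          unfolding B_def K_def using length_times_power_le[OF True \<rho>] \<delta> by (intro mult_right_mono) auto
        from mult_left_mono[OF this norm_ge_zero[of "a w"]] show ?thesis by (simp add: C_def mult_ac)
      qed
      ultimately show ?thesis by (rule word_series_mono)
    next
      case False
      have "(\<lambda>t. (word_monomial (\<lambda>j. \<sigma> j t) w - word_monomial (\<lambda>j. \<sigma>' j t) w) *\<^sub>R a w) = (\<lambda>t. 0)"
        using False first[of "hd w"] by (cases w; cases "tl w") auto
      moreover have "0 \<le> C w" using K \<delta> \<rho> by (simp add: C_def)
      moreover have "word_series \<theta> (\<lambda>t::'i \<Rightarrow> real. 0::'b) 0"
        using word_series_const[of \<theta> "0::'b"] by simp
      ultimately show ?thesis by (auto elim: word_series_mono)
    qed
  next
    fix t :: "'i \<Rightarrow> real" assume t: "\<And>i. \<bar>t i\<bar> \<le> \<theta>"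
    have "((\<lambda>w. word_monomial (\<lambda>j. \<tau> j t) w *\<^sub>R a w) has_sum f (\<lambda>j. \<tau> j t)) UNIV"
      if "\<And>j. word_series \<theta> (\<tau> j) \<rho>" for \<tau>
    proof -
      have "\<bar>\<tau> j t\<bar> \<le> \<rho>0" for j using word_series_norm_le[OF that[of j], of t] t \<rho> by simp
      then show ?thesis using a(1) unfolding word_expansion_def by simp
    qed
    from has_sum_add[OF this[of \<sigma>, OF \<sigma>(1)]
        has_sum_bounded_linear[OF bounded_linear_minus[OF bounded_linear_ident] this[of \<sigma>', OF \<sigma>(2)]]]
    show "((\<lambda>w. (word_monomial (\<lambda>j. \<sigma> j t) w - word_monomial (\<lambda>j. \<sigma>' j t) w) *\<^sub>R a w)
        has_sum f (\<lambda>j. \<sigma> j t) - f (\<lambda>j. \<sigma>' j t)) UNIV"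
      by (simp add: scaleR_diff_left)
  qed
  moreover have "infsum C UNIV = (K * \<delta>) * (\<Sum>\<^sub>\<infinity>w. norm (a w) * \<rho>0 ^ length w)"
    unfolding C_def by (rule infsum_cmult_right) (rule s0)
  moreover have "\<dots> \<le> (K * \<delta>) * c" using a(2) K \<delta> by (intro mult_left_mono) auto
  ultimately show ?thesis by (auto simp: K_def mult_ac elim: word_series_mono)
qed

text \<open>The pointwise form of the estimate above; it serves to prove injectivity of maps close
  to the identity. The bound on \<rho> is solved from the condition that the constant
  \<open>2 * \<rho> / \<rho>0\<^sup>2 * c\<close> be at most \<open>\<epsilon>\<close>.\<close>

lemma analytic_germ_pointwise_lipschitz:
  fixes f :: "('j \<Rightarrow> real) \<Rightarrow> 'b::banach"
  assumes "analytic_germ f" "0 < \<epsilon>"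
    and "\<And>j. ((\<lambda>\<tau>. f ((\<lambda>_. 0)(j := \<tau>))) has_vector_derivative 0) (at 0)"
  obtains \<rho> where "0 < \<rho>" "\<And>x y \<delta>. (\<And>j. \<bar>x j\<bar> \<le> \<rho>) \<Longrightarrow> (\<And>j. \<bar>y j\<bar> \<le> \<rho>) \<Longrightarrow>
    (\<And>j. \<bar>x j - y j\<bar> \<le> \<delta>) \<Longrightarrow> norm (f x - f y) \<le> \<epsilon> * \<delta>"
proof -
  obtain \<rho>0 c a where a: "0 < \<rho>0" "word_expansion \<rho>0 a f"
    "(\<Sum>\<^sub>\<infinity>w. norm (a w) * \<rho>0 ^ length w) \<le> c"
    using assms(1) unfolding analytic_germ_def word_series_def by blast
  have c: "0 \<le> c" using order_trans[OF infsum_nonneg a(3)] a(1) by simp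
  have first: "a [j] = 0" for j by (rule word_expansion_singleton[OF a(2,1) assms(3)])
  define \<rho> where "\<rho> = min (\<rho>0 / 2) (\<epsilon> * \<rho>0\<^sup>2 / (2 * (c + 1)))"
  have "0 < \<rho>" using a(1) c assms(2) by (simp add: \<rho>_def)
  moreover have "\<rho> \<le> \<rho>0 / 2" unfolding \<rho>_def by (rule min.cobounded1)
  ultimately have \<rho>: "0 < \<rho>" "\<rho> \<le> \<rho>0 / 2" by auto
  have "\<rho> \<le> \<epsilon> * \<rho>0\<^sup>2 / (2 * (c + 1))" by (simp add: \<rho>_def)
  then have "2 * \<rho> * (c + 1) \<le> \<epsilon> * \<rho>0\<^sup>2" using c by (simp add: pos_le_divide_eq mult_ac)
  then have L: "2 * \<rho> / \<rho>0\<^sup>2 * c \<le> \<epsilon>" using a(1) \<rho>(1) by (simp add: pos_divide_le_eq algebra_simps)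
  show ?thesis
  proof (rule that[OF \<rho>(1)])
    fix x y :: "'j \<Rightarrow> real" and \<delta>
    assume xy: "\<And>j. \<bar>x j\<bar> \<le> \<rho>" "\<And>j. \<bar>y j\<bar> \<le> \<rho>" "\<And>j. \<bar>x j - y j\<bar> \<le> \<delta>"
    \<comment> \<open>Points are treated as constant word series in a single dummy letter, so the
      lemma on substitutions applies to them.\<close>
    have const: "word_series 1 (\<lambda>t::unit \<Rightarrow> real. v) d" if "\<bar>v\<bar> \<le> d" for v d :: real
      using word_series_mono[OF word_series_const[of 1 v], of d] that by simp
    have "word_series 1 (\<lambda>t::unit \<Rightarrow> real. f (\<lambda>j. x j) - f (\<lambda>j. y j)) (2 * \<rho> / \<rho>0\<^sup>2 * c * \<delta>)"
      by (rule word_series_lipschitz[where \<sigma> = "\<lambda>j t. x j" and \<sigma>' = "\<lambda>j t. y j", OF a(2,3) \<rho>])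
        (use first xy in \<open>auto intro!: const\<close>)
    from word_series_norm_le[OF this, of "\<lambda>_. 0"]
    have "norm (f x - f y) \<le> 2 * \<rho> / \<rho>0\<^sup>2 * c * \<delta>" by simp
    also have "\<dots> \<le> \<epsilon> * \<delta>"
      using L xy(3)[of undefined] by (intro mult_right_mono) auto
    finally show "norm (f x - f y) \<le> \<epsilon> * \<delta>" .
  qed
qed

section \<open>The analytic implicit function theorem\<close>

text \<open>Smallness is uniform in \<open>j\<close>, since a substitution must bring all of its
  possibly infinitely many letters below one radius. In particular every member vanishes at
  0.\<close>

definition vanishing_family :: "('j \<Rightarrow> ('i \<Rightarrow> real) \<Rightarrow> real) \<Rightarrow> bool" where
  "vanishing_family \<sigma> \<longleftrightarrow> (\<forall>\<epsilon>>0. \<forall>\<^sub>F \<theta> in at_right 0. \<forall>j. word_series \<theta> (\<sigma> j) \<epsilon>)"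

lemma vanishing_family_analytic_germ: "vanishing_family \<sigma> \<Longrightarrow> analytic_germ (\<sigma> j)"
  unfolding vanishing_family_def
  by (rule analytic_germI[of _ 1]) (auto elim!: eventually_mono dest!: spec[of _ 1])

text \<open>Covers renaming of letters and setting some letters to 0.\<close>

lemma vanishing_family_subset:
  assumes "\<And>j. (\<exists>i. \<tau> j = (\<lambda>t. t i)) \<or> \<tau> j = (\<lambda>t. 0)"
  shows "vanishing_family \<tau>"
  unfolding vanishing_family_def
proof (intro allI impI)
  fix \<epsilon> :: real assume \<epsilon>: "0 < \<epsilon>"
  have "word_series \<theta> (\<tau> j) \<epsilon>" if "0 < \<theta>" "\<theta> < \<epsilon>" for \<theta> j
    using assms[of j]
  proof
    assume "\<exists>i. \<tau> j = (\<lambda>t. t i)"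
    then show ?thesis using word_series_mono[OF word_series_var, of \<theta> \<epsilon>] that by auto
  next
    assume "\<tau> j = (\<lambda>t. 0)"
    then show ?thesis using word_series_mono[OF word_series_const[of \<theta> "0::real"], of \<epsilon>] \<epsilon> by simp
  qed
  then show "\<forall>\<^sub>F \<theta> in at_right 0. \<forall>j. word_series \<theta> (\<tau> j) \<epsilon>"
    using \<epsilon> by (intro eventually_at_right_0I[of \<epsilon>]) auto
qed

lemma vanishing_family_case_sum:
  fixes \<sigma> :: "'j \<Rightarrow> ('i \<Rightarrow> real) \<Rightarrow> real"
  assumes "vanishing_family \<sigma>"
  shows "vanishing_family (\<lambda>l t. case_sum t (\<lambda>j. \<sigma> j t) l)"
  unfolding vanishing_family_def
proof (intro allI impI)
  fix \<epsilon> :: real assume "0 < \<epsilon>"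
  moreover have "vanishing_family (\<lambda>i t. t (i::'i))" by (rule vanishing_family_subset) blast
  ultimately have "\<forall>\<^sub>F \<theta> in at_right 0. \<forall>j. word_series \<theta> (\<sigma> j) \<epsilon>"
    and "\<forall>\<^sub>F \<theta> in at_right 0. \<forall>i::'i. word_series \<theta> (\<lambda>t. t i) \<epsilon>"
    using assms unfolding vanishing_family_def by auto
  then show "\<forall>\<^sub>F \<theta> in at_right 0. \<forall>l. word_series \<theta> (\<lambda>t. case_sum t (\<lambda>j. \<sigma> j t) l) \<epsilon>"
  proof eventually_elim
    case (elim \<theta>)
    then show ?case by (intro allI, rename_tac l, case_tac l) auto
  qed
qed

lemma analytic_germ_subst:
  fixes f :: "('j \<Rightarrow> real) \<Rightarrow> 'b::banach" and \<sigma> :: "'j \<Rightarrow> ('i \<Rightarrow> real) \<Rightarrow> real"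
  assumes "analytic_germ f" "vanishing_family \<sigma>"
  shows "analytic_germ (\<lambda>t. f (\<lambda>j. \<sigma> j t))"
proof -
  obtain \<rho> c where \<rho>: "0 < \<rho>" "word_series \<rho> f c" using assms(1) unfolding analytic_germ_def by blast
  have "\<forall>\<^sub>F \<theta> in at_right 0. \<forall>j. word_series \<theta> (\<sigma> j) \<rho>"
    using assms(2) \<rho>(1) unfolding vanishing_family_def by blast
  with eventually_at_right_less[of "0::real"]
  have "\<forall>\<^sub>F \<theta> in at_right 0. word_series \<theta> (\<lambda>t. f (\<lambda>j. \<sigma> j t)) c"
    by eventually_elim (auto intro: word_series_subst[OF \<rho>(2)])
  then show ?thesis by (rule analytic_germI)
qed

lemma eventually_polydisc_subst:
  assumes "vanishing_family \<sigma>" "eventually P polydisc_filter"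
  shows "\<forall>\<^sub>F t in polydisc_filter. P (\<lambda>j. \<sigma> j t)"
proof -
  obtain \<rho> where \<rho>: "0 < \<rho>" "\<And>s. (\<And>j. \<bar>s j\<bar> \<le> \<rho>) \<Longrightarrow> P s"
    using assms(2) unfolding eventually_polydisc_filter by blast
  have "\<forall>\<^sub>F \<theta> in at_right 0. 0 < \<theta> \<and> (\<forall>j. word_series \<theta> (\<sigma> j) \<rho>)"
    using assms(1) \<rho>(1) eventually_at_right_less[of "0::real"]
    unfolding vanishing_family_def by (auto intro: eventually_conj)
  from eventually_happens'[OF _ this] obtain \<theta> where "0 < \<theta>" "\<And>j. word_series \<theta> (\<sigma> j) \<rho>" by auto
  then show ?thesis unfolding eventually_polydisc_filter
    using \<rho>(2) word_series_norm_le[of \<theta> "\<sigma> _" \<rho>] by (metis real_norm_def)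
qed

text \<open>Picard iteration; the norms of the successive differences decrease geometrically because no
  word of length one contains a letter for an unknown.\<close>

theorem analytic_germ_implicit_function:
  fixes G :: "'j \<Rightarrow> ('i + 'j \<Rightarrow> real) \<Rightarrow> real"
  assumes J: "finite J" "\<And>j. j \<notin> J \<Longrightarrow> G j = (\<lambda>_. 0)"
    and germ: "\<And>j. analytic_germ (G j)" and G0: "\<And>j. G j (\<lambda>_. 0) = 0"
    and first: "\<And>j k. ((\<lambda>\<tau>. G j ((\<lambda>_. 0)(Inr k := \<tau>))) has_vector_derivative 0) (at 0)"
  obtains \<sigma> where "vanishing_family \<sigma>"
    "\<forall>\<^sub>F t in polydisc_filter. \<forall>j. \<sigma> j t = G j (case_sum t (\<lambda>j. \<sigma> j t))"
proof -
  \<comment> \<open>Finiteness of \<open>J\<close> yields one radius for all components; those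
    outside \<open>J\<close> are zero.\<close>
  have "\<forall>j\<in>J. \<forall>\<^sub>F \<rho> in at_right 0. word_series \<rho> (G j) 1"
    using analytic_germ_small[OF germ G0] by simp
  then have "\<forall>\<^sub>F \<rho> in at_right 0. \<forall>j\<in>J. word_series \<rho> (G j) 1"
    using J(1) by (rule eventually_ball_finite[rotated])
  then have "\<forall>\<^sub>F \<rho> in at_right (0::real). 0 < \<rho> \<and> (\<forall>j\<in>J. word_series \<rho> (G j) 1)"
    using eventually_at_right_less[of "0::real"] by eventually_elim auto
  from eventually_happens'[OF _ this] obtain \<rho>0 where
    \<rho>0: "0 < \<rho>0" "\<And>j. j \<in> J \<Longrightarrow> word_series \<rho>0 (G j) 1" by auto
  define c :: real where "c = 1"
  have "word_series \<rho>0 (\<lambda>_::'i + 'j \<Rightarrow> real. 0::real) 1"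
    using word_series_mono[OF word_series_const[of \<rho>0 "0::real"], of 1] by simp
  then have "word_series \<rho>0 (G j) c" for j using \<rho>0(2)[of j] J(2)[of j] by (cases "j \<in> J") (auto simp: c_def)
  note G = \<rho>0(1) this G0
  have "\<exists>a. word_expansion \<rho>0 a (G j) \<and> (\<Sum>\<^sub>\<infinity>w. norm (a w) * \<rho>0 ^ length w) \<le> c" for j
    using G(2)[of j] unfolding word_series_def .
  then obtain a where a: "\<And>j. word_expansion \<rho>0 (a j) (G j)"
    "\<And>j. (\<Sum>\<^sub>\<infinity>w. norm (a j w) * \<rho>0 ^ length w) \<le> c"
    using choice[of "\<lambda>j a. word_expansion \<rho>0 a (G j) \<and> (\<Sum>\<^sub>\<infinity>w. norm (a w) * \<rho>0 ^ length w) \<le> c"]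
    by blast
  have a0: "a j [Inr k] = 0" for j k by (rule word_expansion_singleton[OF a(1) G(1) first])
  have c: "0 \<le> c" using word_series_nonneg[OF _ G(2)] G(1) by simp
  \<comment> \<open>The second entry of the minimum makes the constant of
    \<open>word_series_lipschitz\<close> at most 1/2.\<close>
  define \<rho> where "\<rho> = min (\<rho>0 / 2) (\<rho>0\<^sup>2 / (4 * (c + 1)))"
  have "0 < \<rho>" using G(1) c by (simp add: \<rho>_def)
  moreover have "\<rho> \<le> \<rho>0 / 2" unfolding \<rho>_def by (rule min.cobounded1)
  ultimately have \<rho>: "0 < \<rho>" "\<rho> \<le> \<rho>0 / 2" by auto
  have "\<rho> \<le> \<rho>0\<^sup>2 / (4 * (c + 1))" by (simp add: \<rho>_def)
  then have "\<rho> * (4 * (c + 1)) \<le> \<rho>0\<^sup>2" using c by (simp add: pos_le_divide_eq)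
  then have L: "2 * \<rho> / \<rho>0\<^sup>2 * c \<le> 1 / 2"
    using G(1) \<rho>(1) by (simp add: pos_divide_le_eq algebra_simps)
  \<comment> \<open>The first iterate vanishes at 0 and thus has norm at most
    \<open>\<theta> / \<rho>0 * c\<close>; this choice of the parameter radius brings it below
    \<open>\<rho> / 2\<close>.\<close>
  define \<theta> where "\<theta> = min \<rho> (\<rho> * \<rho>0 / (2 * (c + 1)))"
  have \<theta>: "0 < \<theta>" "\<theta> \<le> \<rho>" "\<theta> \<le> \<rho>0"
  proof -
    show "0 < \<theta>" using G(1) c \<rho>(1) by (simp add: \<theta>_def)
    show "\<theta> \<le> \<rho>" unfolding \<theta>_def by (rule min.cobounded1)
    then show "\<theta> \<le> \<rho>0" using \<rho> by linarith
  qed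
  have "\<theta> \<le> \<rho> * \<rho>0 / (2 * (c + 1))" by (simp add: \<theta>_def)
  then have "\<theta> * (2 * (c + 1)) \<le> \<rho> * \<rho>0" using c by (simp add: pos_le_divide_eq)
  then have M: "\<theta> / \<rho>0 * c \<le> \<rho> / 2" using G(1) \<theta>(1) by (simp add: pos_divide_le_eq algebra_simps)
  define subst where "subst \<sigma> = case_sum (\<lambda>i t. t i) \<sigma>"
    for \<sigma> :: "'j \<Rightarrow> ('i \<Rightarrow> real) \<Rightarrow> real"
  have subst_eq: "(\<lambda>l. subst \<sigma> l t) = case_sum t (\<lambda>j. \<sigma> j t)" for \<sigma> t
    by (auto simp: subst_def fun_eq_iff split: sum.split)
  have subst_ws: "word_series \<theta> (subst \<sigma> l) \<rho>" if "\<And>j. word_series \<theta> (\<sigma> j) \<rho>" for \<sigma> l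
    using that word_series_mono[OF word_series_var \<theta>(2)] by (auto simp: subst_def split: sum.split)
  have lip: "word_series \<theta> (\<lambda>t. G j (case_sum t (\<lambda>j. \<sigma> j t)) - G j (case_sum t (\<lambda>j. \<sigma>' j t))) (\<delta> / 2)"
    if \<sigma>: "\<And>j. word_series \<theta> (\<sigma> j) \<rho>" "\<And>j. word_series \<theta> (\<sigma>' j) \<rho>"
      "\<And>j. word_series \<theta> (\<lambda>t. \<sigma> j t - \<sigma>' j t) \<delta>" for \<sigma> \<sigma>' \<delta> j
  proof -
    have \<delta>: "0 \<le> \<delta>" using word_series_nonneg[OF _ \<sigma>(3)] \<theta>(1) by simp
    have "word_series \<theta> (\<lambda>t. G j (\<lambda>l. subst \<sigma> l t) - G j (\<lambda>l. subst \<sigma>' l t)) (2 * \<rho> / \<rho>0\<^sup>2 * c * \<delta>)"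
    proof (rule word_series_lipschitz[where \<sigma> = "subst \<sigma>" and \<sigma>' = "subst \<sigma>'", OF a \<rho> _ _ _ _ \<theta>(1)])
      show "a j [l] = 0 \<or> subst \<sigma> l = subst \<sigma>' l" for l
        using a0 by (cases l) (auto simp: subst_def)
      show "word_series \<theta> (\<lambda>t. subst \<sigma> l t - subst \<sigma>' l t) \<delta>" for l
      proof (cases l)
        case (Inl i)
        have "word_series \<theta> (\<lambda>t::'i \<Rightarrow> real. 0::real) 0" using word_series_const[of \<theta> "0::real"] by simp
        then show ?thesis using Inl \<delta> by (auto simp: subst_def elim: word_series_mono)
      qed (use \<sigma>(3) in \<open>simp add: subst_def\<close>)
    qed (use subst_ws \<sigma> in auto)
    moreover have "2 * \<rho> / \<rho>0\<^sup>2 * c * \<delta> \<le> \<delta> / 2" using mult_right_mono[OF L \<delta>] by simp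
    ultimately show ?thesis unfolding subst_eq by (rule word_series_mono)
  qed
  define S where "S = rec_nat (\<lambda>j t. 0) (\<lambda>_ \<sigma> j t. G j (case_sum t (\<lambda>j. \<sigma> j t)))"
  have S0: "S 0 j t = 0" and SS: "S (Suc n) j t = G j (case_sum t (\<lambda>j. S n j t))" for n j t
    by (simp_all add: S_def)
  have zero: "case_sum (\<lambda>_. 0) (\<lambda>_. 0) = (\<lambda>_. 0::real)" by (auto simp: fun_eq_iff split: sum.split)
  have S_zero: "S n j (\<lambda>_. 0) = 0" for n j
    by (induction n arbitrary: j) (simp_all add: S0 SS zero G(3))
  have zero_ws: "word_series \<theta> (\<lambda>t::'i \<Rightarrow> real. 0::real) d" if "0 \<le> d" for d
    using word_series_mono[OF word_series_const[of \<theta> "0::real"], of d] that by simp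
  have S1: "word_series \<theta> (S 1 j) (\<rho> / 2)" for j
  proof -
    have "word_series \<rho>0 (\<lambda>t. G j (\<lambda>l. subst (\<lambda>j t. 0) l t)) c"
    proof (rule word_series_subst[OF G(2) _ G(1)])
      show "word_series \<rho>0 (subst (\<lambda>j t. 0) l) \<rho>0" for l
        using word_series_var[of \<rho>0] word_series_mono[OF word_series_const[of \<rho>0 "0::real"], of \<rho>0] G(1)
        by (auto simp: subst_def split: sum.split)
    qed
    moreover have "S 1 j = (\<lambda>t. G j (case_sum t (\<lambda>j. 0)))" by (simp add: fun_eq_iff SS S0)
    ultimately have "word_series \<rho>0 (S 1 j) c" unfolding subst_eq by simp
    from word_series_small[OF this S_zero _ \<theta>(3) G(1)] \<theta>(1)
    have "word_series \<theta> (S 1 j) (\<theta> / \<rho>0 * c)" by simp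
    then show ?thesis using M by (rule word_series_mono)
  qed
  \<comment> \<open>The first step uses up half of the room \<open>\<rho>\<close> and every later
    one half of the step before, so no iterate leaves the ball on which the Lipschitz estimate
    holds.\<close>
  have main: "(\<forall>j. word_series \<theta> (\<lambda>t. S (Suc n) j t - S n j t) (\<rho> / 2 * (1 / 2) ^ n)) \<and>
      (\<forall>j. word_series \<theta> (S n j) (\<rho> * (1 - (1 / 2) ^ n)))" for n
  proof (induction n)
    case 0
    then show ?case using S1 zero_ws[of 0] by (simp add: S0)
  next
    case (Suc n)
    have le: "\<rho> * (1 - (1 / 2) ^ k) \<le> \<rho>" for k :: nat using \<rho>(1) by simp
    have "word_series \<theta> (\<lambda>t. (S (Suc n) j t - S n j t) + S n j t)
        (\<rho> / 2 * (1 / 2) ^ n + \<rho> * (1 - (1 / 2) ^ n))" for j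
      using Suc \<theta>(1) by (intro word_series_add) auto
    moreover have "\<rho> / 2 * (1 / 2) ^ n + \<rho> * (1 - (1 / 2) ^ n) = \<rho> * (1 - (1 / 2) ^ Suc n)"
      by (simp add: algebra_simps)
    ultimately have B: "word_series \<theta> (S (Suc n) j) (\<rho> * (1 - (1 / 2) ^ Suc n))" for j by simp
    have "word_series \<theta> (\<lambda>t. S (Suc (Suc n)) j t - S (Suc n) j t) (\<rho> / 2 * (1 / 2) ^ n / 2)" for j
      using lip[of "S (Suc n)" "S n" "\<rho> / 2 * (1 / 2) ^ n" j] Suc word_series_mono[OF B le]
        word_series_mono[OF _ le, of \<theta> "S n _" n]
      unfolding SS[of "Suc n"] SS[of n j] by blast
    with B show ?case by simp
  qed
  have Sws: "word_series \<theta> (S n j) \<rho>" for n j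
    by (rule word_series_mono[of _ _ "\<rho> * (1 - (1 / 2) ^ n)"]) (use main \<rho>(1) in auto)
  define d where "d n = \<rho> / 2 * (1 / 2) ^ n" for n :: nat
  have dws: "word_series \<theta> (\<lambda>t. S (Suc n) j t - S n j t) (d n)" for n j
    using main[of n] by (simp add: d_def)
  define \<sigma> where "\<sigma> j t = (\<Sum>n. S (Suc n) j t - S n j t)" for j t
  have tail_sum: "(d has_sum \<rho>) UNIV"
  proof -
    have "(\<lambda>n. (1 / 2 :: real) ^ n) sums (1 / (1 - 1 / 2))" by (rule geometric_sums) simp
    from sums_mult[OF this, of "\<rho> / 2"] have "d sums \<rho>" by (simp add: d_def[abs_def])
    then show ?thesis using \<rho>(1) by (intro sums_nonneg_imp_has_sum) (auto simp: d_def)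
  qed
  have dsum: "summable d" using has_sum_imp_sums[OF tail_sum] by (rule sums_summable)
  have nsum: "summable (\<lambda>n. norm (S (Suc n) j t - S n j t))" if "\<And>i. \<bar>t i\<bar> \<le> \<theta>" for j t
    by (rule summable_comparison_test'[OF dsum, of 0])
      (use word_series_norm_le[OF dws, of t] that in auto)
  have tail: "word_series \<theta> (\<lambda>t. \<sigma> j t - S n j t) (\<rho> * (1 / 2) ^ n)" for n j
  proof -
    have "word_series \<theta> (\<lambda>t. \<sigma> j t - S n j t) (infsum (\<lambda>k. d (k + n)) UNIV)"
    proof (rule word_series_infsum[where f = "\<lambda>k t. S (Suc (k + n)) j t - S (k + n) j t", OF \<theta>(1) dws])
      have dn: "d (k + n) = (1 / 2) ^ n * d k" for k by (simp add: d_def power_add)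
      show "(\<lambda>k. d (k + n)) summable_on UNIV"
        unfolding dn using has_sum_imp_summable[OF tail_sum] by (rule summable_on_cmult_right)
      fix t :: "'i \<Rightarrow> real" assume t: "\<And>i. \<bar>t i\<bar> \<le> \<theta>"
      have ns: "summable (\<lambda>k. norm (S (Suc k) j t - S k j t))" using nsum t by blast
      have s: "summable (\<lambda>k. S (Suc k) j t - S k j t)" using ns by (rule summable_norm_cancel)
      have "(\<Sum>k<n. S (Suc k) j t - S k j t) = S n j t"
        using sum_lessThan_telescope[of "\<lambda>k. S k j t" n] by (simp add: S0)
      then have "(\<lambda>k. S (Suc (k + n)) j t - S (k + n) j t) sums (\<sigma> j t - S n j t)"
        using sums_split_initial_segment[OF summable_sums[OF s], of n] by (simp add: \<sigma>_def)
      moreover have "summable (\<lambda>k. norm (S (Suc (k + n)) j t - S (k + n) j t))"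
        using summable_ignore_initial_segment[OF ns, of n] by simp
      ultimately show "((\<lambda>k. S (Suc (k + n)) j t - S (k + n) j t) has_sum (\<sigma> j t - S n j t)) UNIV"
        by (rule norm_summable_imp_has_sum[rotated])
    qed
    moreover have "infsum (\<lambda>k. d (k + n)) UNIV = \<rho> * (1 / 2) ^ n"
    proof (rule infsumI)
      have "((\<lambda>k. (1 / 2) ^ n * d k) has_sum ((1 / 2) ^ n * \<rho>)) UNIV"
        using tail_sum by (rule has_sum_cmult_right)
      moreover have "(\<lambda>k. d (k + n)) = (\<lambda>k. (1 / 2) ^ n * d k)" by (simp add: d_def power_add fun_eq_iff)
      ultimately show "((\<lambda>k. d (k + n)) has_sum \<rho> * (1 / 2) ^ n) UNIV" by (simp only: mult.commute)
    qed
    ultimately show ?thesis by simp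
  qed
  have \<sigma>ws: "word_series \<theta> (\<sigma> j) \<rho>" for j using tail[of j 0] by (simp add: S0)
  have eqn: "\<sigma> j t = G j (case_sum t (\<lambda>j. \<sigma> j t))" if t: "\<And>i. \<bar>t i\<bar> \<le> \<theta>" for j t
  proof -
    have bound: "\<bar>\<sigma> j t - G j (case_sum t (\<lambda>j. \<sigma> j t))\<bar> \<le> \<rho> * (1 / 2) ^ n" for n
    proof -
      have "\<bar>\<sigma> j t - S (Suc n) j t\<bar> \<le> \<rho> * (1 / 2) ^ Suc n"
        using word_series_norm_le[OF tail[of j "Suc n"], of t] t by simp
      moreover have "\<bar>G j (case_sum t (\<lambda>j. \<sigma> j t)) - G j (case_sum t (\<lambda>j. S n j t))\<bar>
          \<le> \<rho> * (1 / 2) ^ n / 2"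
        using word_series_norm_le[OF lip[where \<sigma> = \<sigma> and \<sigma>' = "S n" and j = j, OF \<sigma>ws Sws tail], of t] t
        by simp
      ultimately show ?thesis unfolding SS[of n j t] power_Suc by linarith
    qed
    have "(\<lambda>n. \<rho> * (1 / 2) ^ n) \<longlonglongrightarrow> \<rho> * 0"
      by (intro tendsto_mult tendsto_const LIMSEQ_realpow_zero) auto
    then have "\<bar>\<sigma> j t - G j (case_sum t (\<lambda>j. \<sigma> j t))\<bar> \<le> \<rho> * 0"
      by (rule LIMSEQ_le_const) (use bound in auto)
    then show ?thesis by simp
  qed
  have \<sigma>0: "\<sigma> j (\<lambda>_. 0) = 0" for j
  proof -
    have "(\<lambda>n. S (Suc n) j (\<lambda>_. 0) - S n j (\<lambda>_. 0)) = (\<lambda>n. 0)" using S_zero[of _ j] by simp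
    then show ?thesis unfolding \<sigma>_def by simp
  qed
  have "vanishing_family \<sigma>"
    unfolding vanishing_family_def
  proof (intro allI impI)
    fix \<epsilon> :: real assume \<epsilon>: "0 < \<epsilon>"
    have "word_series \<eta> (\<sigma> j) \<epsilon>" if "0 < \<eta>" "\<eta> < min \<theta> (\<epsilon> * \<theta> / \<rho>)" for \<eta> j
    proof -
      have "\<eta> < \<epsilon> * \<theta> / \<rho>" using that by simp
      then have "\<eta> / \<theta> * \<rho> \<le> \<epsilon>" using \<theta>(1) \<rho>(1) by (simp add: field_simps)
      moreover have "word_series \<eta> (\<sigma> j) (\<eta> / \<theta> * \<rho>)"
        using word_series_small[OF \<sigma>ws \<sigma>0 _ _ \<theta>(1)] that by simp
      ultimately show ?thesis by (rule word_series_mono[rotated])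
    qed
    then show "\<forall>\<^sub>F \<eta> in at_right 0. \<forall>j. word_series \<eta> (\<sigma> j) \<epsilon>"
      using \<epsilon> \<theta>(1) \<rho>(1) by (intro eventually_at_right_0I[of "min \<theta> (\<epsilon> * \<theta> / \<rho>)"]) auto
  qed
  moreover have "\<forall>\<^sub>F t in polydisc_filter. \<forall>j. \<sigma> j t = G j (case_sum t (\<lambda>j. \<sigma> j t))"
    unfolding eventually_polydisc_filter using \<theta>(1) by (intro exI[of _ \<theta>] conjI allI impI eqn) auto
  ultimately show ?thesis by (rule that)
qed

section \<open>Bounded right inverses and coordinates\<close>

text \<open>The open mapping theorem onto a closed range. Baire's theorem is applied to the range as
  a closed, hence completely metrizable, subset; successive approximation then turns approximate
  preimages into exact ones.\<close>

lemma bounded_linear_bounded_preimage: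
  fixes L :: "'a::banach \<Rightarrow> 'b::banach"
  assumes "bounded_linear L" "closed (range L)"
  obtains C where "\<And>y. y \<in> range L \<Longrightarrow> \<exists>x. L x = y \<and> norm x \<le> C * norm y"
proof -
  interpret L: bounded_linear L by fact
  define R where "R = range L"
  have subR: "subspace R" unfolding R_def
    using L.linear_axioms linear_subspace_image subspace_UNIV by blast
  define X where "X = top_of_set R"
  have X: "completely_metrizable_space X" unfolding X_def
    using completely_metrizable_space_closedin[OF completely_metrizable_space_euclidean] assms(2)
    by (simp add: R_def)
  define T where "T n = R \<inter> closure (L ` ball 0 (real n))" for n
  have "\<Union>(range T) = R"
  proof
    show "R \<subseteq> \<Union>(range T)"
    proof
      fix y assume y: "y \<in> R"
      then obtain x where x: "y = L x" by (auto simp: R_def)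
      obtain n where "norm x < real n" using reals_Archimedean2 by blast
      then have "y \<in> L ` ball 0 (real n)" unfolding x by (intro imageI) simp
      then have "y \<in> closure (L ` ball 0 (real n))" by (rule closure_subset[THEN subsetD])
      then have "y \<in> T n" using y unfolding T_def by (rule IntI[rotated])
      then show "y \<in> \<Union>(range T)" by blast
    qed
  qed (auto simp: T_def)
  moreover have "X interior_of R = R"
    unfolding X_def by (metis interior_of_topspace topspace_euclidean_subtopology)
  moreover have "R \<noteq> {}" using subspace_0[OF subR] by blast
  ultimately have "X interior_of \<Union>(range T) \<noteq> {}" by simp
  moreover have "closedin X (T n)" for n
    unfolding X_def T_def by (intro closedin_closed_Int closed_closure)
  ultimately obtain n where n: "X interior_of (T n) \<noteq> {}"
    using Baire_category_alt[of X "range T"] X countable_image[OF countableI_type[of UNIV], of T] by blast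
  then obtain y0 where "y0 \<in> X interior_of (T n)" by blast
  then obtain W where W: "open W" "y0 \<in> W" "y0 \<in> R" "R \<inter> W \<subseteq> T n"
    unfolding interior_of_def X_def openin_open by auto
  then obtain \<delta> where \<delta>: "0 < \<delta>" "ball y0 \<delta> \<subseteq> W" using openE by blast
  have near: "\<exists>x. norm x < real n \<and> norm (L x - v) < \<epsilon>" if v: "v \<in> T n" "0 < \<epsilon>" for v \<epsilon>
  proof -
    have "v \<in> closure (L ` ball 0 (real n))" using v(1) by (simp add: T_def)
    then obtain w where "w \<in> L ` ball 0 (real n)" "dist w v < \<epsilon>"
      using v(2) unfolding closure_approachable by blast
    then show ?thesis by (auto simp: dist_norm)
  qed
  \<comment> \<open>A small \<open>y\<close> is the difference of the two points
    \<open>y0 + y\<close> and \<open>y0\<close> of \<open>T n\<close>, so preimages of both are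
    subtracted; hence the bound \<open>2 * real n\<close>.\<close>
  have approx0: "\<exists>x. norm x \<le> 2 * real n \<and> norm (L x - y) < \<epsilon>"
    if y: "y \<in> R" "norm y < \<delta>" and "0 < \<epsilon>" for y \<epsilon>
  proof -
    have "y0 + y \<in> T n"
    proof -
      have "y0 + y \<in> R" using subR W(3) y(1) by (rule subspace_add)
      moreover have "y0 + y \<in> ball y0 \<delta>" using y(2) by (simp add: dist_norm)
      ultimately show ?thesis using W(4) \<delta>(2) by blast
    qed
    then obtain x1 where x1: "norm x1 < real n" "norm (L x1 - (y0 + y)) < \<epsilon> / 2"
      using near[of "y0 + y" "\<epsilon> / 2"] \<open>0 < \<epsilon>\<close> by auto
    have "y0 \<in> T n" using W \<delta> by auto
    then obtain x2 where x2: "norm x2 < real n" "norm (L x2 - y0) < \<epsilon> / 2"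
      using near[of y0 "\<epsilon> / 2"] \<open>0 < \<epsilon>\<close> by auto
    have eq: "L (x1 - x2) - y = (L x1 - (y0 + y)) - (L x2 - y0)" by (simp add: L.diff)
    have "norm (L (x1 - x2) - y) < \<epsilon>"
      unfolding eq using norm_triangle_ineq4[of "L x1 - (y0 + y)" "L x2 - y0"] x1(2) x2(2) by linarith
    moreover have "norm (x1 - x2) \<le> 2 * real n" using norm_triangle_ineq4[of x1 x2] x1 x2 by simp
    ultimately show ?thesis by blast
  qed
  \<comment> \<open>\<open>y\<close> is rescaled to norm \<open>\<delta> / 2\<close>, where the
    preimage has norm at most \<open>2 * real n\<close>; scaling back multiplies this by
    \<open>2 * norm y / \<delta>\<close>.\<close>
  define C where "C = 4 * real n / \<delta>"
  have step: "\<exists>x. norm x \<le> C * norm y \<and> norm (L x - y) \<le> norm y / 2" if y: "y \<in> R" for y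
  proof (cases "y = 0")
    case False
    define s where "s = \<delta> / (2 * norm y)"
    have s: "0 < s" "norm (s *\<^sub>R y) < \<delta>" using \<delta>(1) False by (auto simp: s_def)
    have "s *\<^sub>R y \<in> R" using subR y by (rule subspace_scale)
    then obtain x where x: "norm x \<le> 2 * real n" "norm (L x - s *\<^sub>R y) < s * norm y / 2"
      using approx0[of "s *\<^sub>R y" "s * norm y / 2"] s False by auto
    have "L (x /\<^sub>R s) - y = (L x - s *\<^sub>R y) /\<^sub>R s"
      using s(1) by (simp add: L.scaleR scaleR_diff_right)
    then have "norm (L (x /\<^sub>R s) - y) = norm (L x - s *\<^sub>R y) / s" using s(1) by (simp add: divide_inverse)
    also have "\<dots> \<le> norm y / 2" using x(2) s(1) by (simp add: pos_divide_le_eq mult_ac)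
    finally have "norm (L (x /\<^sub>R s) - y) \<le> norm y / 2" .
    moreover have "norm (x /\<^sub>R s) \<le> C * norm y"
    proof -
      have "norm (x /\<^sub>R s) = norm x / s" using s(1) by (simp add: divide_inverse)
      also have "\<dots> \<le> 2 * real n / s" using x(1) s(1) by (intro divide_right_mono) auto
      also have "\<dots> = C * norm y" using \<delta>(1) False by (simp add: s_def C_def field_simps)
      finally show ?thesis .
    qed
    ultimately show ?thesis by blast
  qed (auto intro!: exI[of _ 0] simp: L.zero)
  then obtain g where g: "\<And>y. y \<in> R \<Longrightarrow> norm (g y) \<le> C * norm y \<and> norm (L (g y) - y) \<le> norm y / 2"
    by metis
  have C: "0 \<le> C" using \<delta>(1) by (simp add: C_def)
  have "\<exists>x. L x = y \<and> norm x \<le> 2 * C * norm y" if y: "y \<in> R" for y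
  proof -
    \<comment> \<open>The residuals left by approximate preimages; each is at most half the previous
      one, so the corrections \<open>g (Y k)\<close> sum to an exact preimage.\<close>
    define Y where "Y = rec_nat y (\<lambda>_ v. v - L (g v))"
    have Y0: "Y 0 = y" and YS: "Y (Suc k) = Y k - L (g (Y k))" for k by (simp_all add: Y_def)
    have YR: "Y k \<in> R" for k
    proof (induction k)
      case (Suc k)
      have "L (g (Y k)) \<in> R" by (simp add: R_def)
      then show ?case using subspace_diff[OF subR Suc] by (simp add: YS)
    qed (simp add: Y0 y)
    have Yn: "norm (Y k) \<le> norm y * (1 / 2) ^ k" for k
    proof (induction k)
      case (Suc k)
      have "norm (Y (Suc k)) \<le> norm (Y k) / 2"
        using g[OF YR[of k]] by (simp add: YS norm_minus_commute)
      then show ?case using Suc by simp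
    qed (simp add: Y0)
    have gn: "norm (g (Y k)) \<le> C * norm y * (1 / 2) ^ k" for k
      using g[OF YR[of k]] mult_left_mono[OF Yn[of k] C] by (simp add: mult.assoc)
    have geo: "(\<lambda>k. C * norm y * (1 / 2) ^ k) sums (C * norm y * 2)"
      using sums_mult[OF geometric_sums[of "1 / 2 :: real"], of "C * norm y"] by simp
    have ns: "summable (\<lambda>k. norm (g (Y k)))"
      by (rule summable_comparison_test'[OF sums_summable[OF geo], of 0]) (use gn in auto)
    have s: "summable (\<lambda>k. g (Y k))" using ns by (rule summable_norm_cancel)
    have "norm (\<Sum>k. g (Y k)) \<le> (\<Sum>k. norm (g (Y k)))" using ns by (rule summable_norm)
    also have "\<dots> \<le> (\<Sum>k. C * norm y * (1 / 2) ^ k)"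
      using gn ns sums_summable[OF geo] by (intro suminf_le) auto
    also have "\<dots> = 2 * C * norm y" using sums_unique[OF geo] by (simp add: mult_ac)
    finally have bound: "norm (\<Sum>k. g (Y k)) \<le> 2 * C * norm y" .
    have "(\<lambda>k. norm y * (1 / 2) ^ k) \<longlonglongrightarrow> norm y * 0"
      by (intro tendsto_mult tendsto_const LIMSEQ_realpow_zero) auto
    then have "Y \<longlonglongrightarrow> 0" using Yn by (intro Lim_null_comparison[of Y]) auto
    then have "(\<lambda>k. Y k - Y (Suc k)) sums (Y 0 - 0)" by (rule telescope_sums')
    moreover have "Y k - Y (Suc k) = L (g (Y k))" for k by (simp add: YS)
    ultimately have "(\<lambda>k. L (g (Y k))) sums y" by (simp add: Y0)
    moreover have "(\<lambda>k. L (g (Y k))) sums L (\<Sum>k. g (Y k))" by (rule L.sums[OF summable_sums[OF s]])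
    ultimately have "L (\<Sum>k. g (Y k)) = y" by (rule sums_unique2[rotated])
    with bound show ?thesis by blast
  qed
  then show ?thesis using that by (auto simp: R_def)
qed

text \<open>Equivalence of norms on a finite-dimensional subspace, by induction on the basis. The
  new basis vector has positive distance from the span of the old ones because, by the induction
  hypothesis, that span contains its limits.\<close>

lemma finite_independent_coordinates_bounded:
  fixes B :: "'a::real_normed_vector set"
  assumes "finite B" "independent B"
  obtains c where "\<And>t. (\<Sum>b\<in>B. \<bar>t b\<bar>) \<le> c * norm (\<Sum>b\<in>B. t b *\<^sub>R b)"
proof -
  have "\<exists>c. \<forall>t. (\<Sum>b\<in>B. \<bar>t b\<bar>) \<le> c * norm (\<Sum>b\<in>B. t b *\<^sub>R b)"
    using assms
  proof (induction B rule: finite_induct)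
    case empty
    then show ?case by simp
  next
    case (insert b B)
    have ind: "independent B" and b: "b \<notin> span B"
      using insert.prems insert.hyps by (auto simp: independent_insert)
    obtain c where c: "\<And>t. (\<Sum>b\<in>B. \<bar>t b\<bar>) \<le> c * norm (\<Sum>b\<in>B. t b *\<^sub>R b)"
      using insert.IH[OF ind] by blast
    define c' where "c' = max c 0"
    have c': "(\<Sum>b\<in>B. \<bar>t b\<bar>) \<le> c' * norm (\<Sum>b\<in>B. t b *\<^sub>R b)" "0 \<le> c'" for t
      using c[of t] mult_right_mono[of c c' "norm (\<Sum>b\<in>B. t b *\<^sub>R b)"] by (auto simp: c'_def)
    \<comment> \<open>Otherwise \<open>b\<close> is a limit of combinations of \<open>B\<close>;
      their coordinates are Cauchy by the induction hypothesis and their limits express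
      \<open>b\<close> through \<open>B\<close>.\<close>
    have "\<exists>\<delta>>0. \<forall>t. \<delta> \<le> norm (b - (\<Sum>b\<in>B. t b *\<^sub>R b))"
    proof (rule ccontr)
      assume "\<not> ?thesis"
      then have "\<exists>t. norm (b - (\<Sum>b\<in>B. t b *\<^sub>R b)) < inverse (real (Suc n))" for n
        by (metis inverse_positive_iff_positive not_le of_nat_0_less_iff zero_less_Suc)
      then obtain t where t: "\<And>n. norm (b - (\<Sum>b\<in>B. t n b *\<^sub>R b)) < inverse (real (Suc n))"
        by metis
      define v where "v n = (\<Sum>b\<in>B. t n b *\<^sub>R b)" for n
      have "(\<lambda>n. b - v n) \<longlonglongrightarrow> 0"
        by (rule Lim_null_comparison[OF _ LIMSEQ_inverse_real_of_nat])
          (use t in \<open>auto simp: v_def intro!: always_eventually less_imp_le\<close>)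
      then have "(\<lambda>n. b - (b - v n)) \<longlonglongrightarrow> b - 0" by (intro tendsto_diff tendsto_const)
      then have lim: "v \<longlonglongrightarrow> b" by simp
      then have vC: "Cauchy v" by (rule LIMSEQ_imp_Cauchy)
      have "\<exists>l. (\<lambda>n. t n i) \<longlonglongrightarrow> l" if "i \<in> B" for i
      proof -
        have le: "\<bar>t m i - t n i\<bar> \<le> c' * norm (v m - v n)" for m n
        proof -
          have "\<bar>t m i - t n i\<bar> \<le> (\<Sum>b\<in>B. \<bar>t m b - t n b\<bar>)"
            using member_le_sum[of i B "\<lambda>b. \<bar>t m b - t n b\<bar>"] that insert.hyps(1) by simp
          also have "\<dots> \<le> c' * norm (\<Sum>b\<in>B. (t m b - t n b) *\<^sub>R b)" by (rule c')
          also have "(\<Sum>b\<in>B. (t m b - t n b) *\<^sub>R b) = v m - v n"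
            by (simp add: v_def scaleR_diff_left sum_subtractf)
          finally show ?thesis .
        qed
        have "Cauchy (\<lambda>n. t n i)"
        proof (rule metric_CauchyI)
          fix e :: real assume e: "0 < e"
          obtain N where N: "\<And>m n. m \<ge> N \<Longrightarrow> n \<ge> N \<Longrightarrow> dist (v m) (v n) < e / (c' + 1)"
            using metric_CauchyD[OF vC, of "e / (c' + 1)"] e c'(2) by auto
          have "dist (t m i) (t n i) < e" if "m \<ge> N" "n \<ge> N" for m n
          proof -
            have "c' * norm (v m - v n) \<le> c' * (e / (c' + 1))"
              using N[OF that] c'(2) by (intro mult_left_mono) (auto simp: dist_norm)
            also have "\<dots> < e" using e c'(2) by (simp add: field_simps)
            finally show ?thesis using le[of m n] by (simp add: dist_norm)
          qed
          then show "\<exists>M. \<forall>m\<ge>M. \<forall>n\<ge>M. dist (t m i) (t n i) < e" by blast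
        qed
        then show ?thesis using Cauchy_convergent convergent_def by blast
      qed
      then obtain l where l: "\<And>i. i \<in> B \<Longrightarrow> (\<lambda>n. t n i) \<longlonglongrightarrow> l i" by metis
      have "v \<longlonglongrightarrow> (\<Sum>i\<in>B. l i *\<^sub>R i)"
        unfolding v_def by (intro tendsto_sum tendsto_scaleR l tendsto_const)
      then have "b = (\<Sum>i\<in>B. l i *\<^sub>R i)" using lim LIMSEQ_unique by blast
      moreover have "(\<Sum>i\<in>B. l i *\<^sub>R i) \<in> span B" by (intro span_sum span_scale span_base)
      ultimately show False using b by simp
    qed
    then obtain \<delta> where \<delta>: "0 < \<delta>" "\<And>t. \<delta> \<le> norm (b - (\<Sum>b\<in>B. t b *\<^sub>R b))" by blast
    \<comment> \<open>The distance \<open>\<delta>\<close> bounds the coordinate at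
      \<open>b\<close>; the others follow from the old estimate for the vector minus its
      \<open>b\<close>-component.\<close>
    have "(\<Sum>i\<in>insert b B. \<bar>t i\<bar>) \<le> (1 / \<delta> + c' * (1 + norm b / \<delta>)) * norm (\<Sum>i\<in>insert b B. t i *\<^sub>R i)" for t
    proof -
      define w where "w = (\<Sum>i\<in>insert b B. t i *\<^sub>R i)"
      define v where "v = (\<Sum>i\<in>B. t i *\<^sub>R i)"
      have w: "w = t b *\<^sub>R b + v" using insert.hyps by (simp add: w_def v_def)
      have tb: "\<bar>t b\<bar> \<le> norm w / \<delta>"
      proof (cases "t b = 0")
        case False
        have "(\<Sum>i\<in>B. (- t i / t b) *\<^sub>R i) = (- 1 / t b) *\<^sub>R v"
          by (simp add: v_def scaleR_sum_right)
        then have "\<delta> \<le> norm (b - (- 1 / t b) *\<^sub>R v)" using \<delta>(2)[of "\<lambda>i. - t i / t b"] by simp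
        also have "b - (- 1 / t b) *\<^sub>R v = (1 / t b) *\<^sub>R w" using False by (simp add: w scaleR_add_right)
        finally show ?thesis using False \<delta>(1) by (simp add: field_simps)
      qed (use \<delta> in auto)
      have "norm v \<le> norm w + \<bar>t b\<bar> * norm b"
        using norm_triangle_ineq4[of w "t b *\<^sub>R b"] by (simp add: w)
      also have "\<dots> \<le> norm w + norm w / \<delta> * norm b"
        using tb by (intro add_left_mono mult_right_mono) auto
      finally have "c' * norm v \<le> c' * (norm w + norm w / \<delta> * norm b)"
        using c'(2) by (rule mult_left_mono)
      then have "(\<Sum>i\<in>B. \<bar>t i\<bar>) \<le> c' * (norm w + norm w / \<delta> * norm b)"
        using c'(1)[of t] by (simp add: v_def)
      then have "(\<Sum>i\<in>insert b B. \<bar>t i\<bar>) \<le> norm w / \<delta> + c' * (norm w + norm w / \<delta> * norm b)"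
        using tb insert.hyps by simp
      also have "\<dots> = (1 / \<delta> + c' * (1 + norm b / \<delta>)) * norm w" by (simp add: algebra_simps)
      finally show ?thesis by (simp add: w_def)
    qed
    then show ?case by blast
  qed
  then show ?thesis using that by blast
qed

text \<open>The n-linear form attached to a word of length n, whose diagonal is the monomial.
  Keeping words non-commutative makes this polarization immediate.\<close>

definition word_pairing :: "('i \<Rightarrow> 'a \<Rightarrow> real) \<Rightarrow> 'i list \<Rightarrow> 'a list \<Rightarrow> real" where
  "word_pairing \<kappa> w xs = prod_list (map2 \<kappa> w xs)"

lemma word_pairing_simps [simp]:
  "word_pairing \<kappa> [] [] = 1"
  "word_pairing \<kappa> (i # w) (x # xs) = \<kappa> i x * word_pairing \<kappa> w xs"
  by (simp_all add: word_pairing_def)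

lemma word_pairing_replicate: "word_pairing \<kappa> w (replicate (length w) x) = word_monomial (\<lambda>i. \<kappa> i x) w"
  by (induction w) auto

lemma word_pairing_update:
  assumes "\<And>i. linear (\<kappa> i)" "length w = length xs" "k < length xs"
  shows "word_pairing \<kappa> w (xs[k := x + y]) = word_pairing \<kappa> w (xs[k := x]) + word_pairing \<kappa> w (xs[k := y])"
    and "word_pairing \<kappa> w (xs[k := c *\<^sub>R x]) = c * word_pairing \<kappa> w (xs[k := x])"
  using assms(2,3)
  by (induction w xs arbitrary: k rule: list_induct2)
    (auto simp: linear_add[OF assms(1)] linear_scale[OF assms(1)] algebra_simps split: nat.split)

lemma abs_word_pairing_le:
  assumes "\<And>i x. \<bar>\<kappa> i x\<bar> \<le> C * norm x" "0 \<le> C" "length w = length xs"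
  shows "\<bar>word_pairing \<kappa> w xs\<bar> \<le> C ^ length xs * prod_list (map norm xs)"
  using assms(3)
proof (induction w xs rule: list_induct2)
  case (Cons i w x xs)
  have "\<bar>\<kappa> i x\<bar> * \<bar>word_pairing \<kappa> w xs\<bar> \<le> (C * norm x) * (C ^ length xs * prod_list (map norm xs))"
    using assms Cons by (intro mult_mono) auto
  then show ?case by (simp add: abs_mult mult_ac)
qed simp

text \<open>The way back from word series to expansions into multilinear maps: words are grouped by
  length. There may be infinitely many words of each length, so every homogeneous term is itself an
  infinite sum.\<close>

lemma real_analytic_at_of_word_series:
  fixes f :: "('i \<Rightarrow> real) \<Rightarrow> 'b::banach" and \<kappa> :: "'i \<Rightarrow> 'a::real_normed_vector \<Rightarrow> real"
  assumes f: "word_series \<rho> f c" "0 < \<rho>" and C: "0 < C"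
    and \<kappa>: "\<And>i. linear (\<kappa> i)" "\<And>i x. \<bar>\<kappa> i x\<bar> \<le> C * norm x"
    and F: "\<And>h. h \<in> V \<Longrightarrow> norm h < \<rho> / C \<Longrightarrow> F (x + h) = f (\<lambda>i. \<kappa> i h)"
  shows "real_analytic_at V F x"
proof -
  obtain a where a: "(\<lambda>w. norm (a w) * \<rho> ^ length w) summable_on UNIV"
    "\<And>t. (\<And>i. \<bar>t i\<bar> \<le> \<rho>) \<Longrightarrow> ((\<lambda>w. word_monomial t w *\<^sub>R a w) has_sum f t) UNIV"
    using f(1) by (rule word_seriesE) blast
  define W where "W n = {w::'i list. length w = n}" for n
  define r where "r = \<rho> / C"
  have r: "0 < r" "C * r = \<rho>" using f(2) C by (auto simp: r_def)
  define m where "m n xs = (\<Sum>\<^sub>\<infinity>w\<in>W n. word_pairing \<kappa> w xs *\<^sub>R a w)" for n xs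
  have as: "(\<lambda>w. norm (a w)) summable_on W n" for n
  proof -
    have "(\<lambda>w. norm (a w) * \<rho> ^ length w) summable_on W n"
      using a(1) by (rule summable_on_subset) auto
    then have "(\<lambda>w. norm (a w) * \<rho> ^ n) summable_on W n"
      by (rule summable_on_cong[THEN iffD1, rotated]) (auto simp: W_def)
    from summable_on_cmult_left[OF this, of "inverse (\<rho> ^ n)"] f(2) show ?thesis
      by (simp add: mult.assoc)
  qed
  define A where "A n = (\<Sum>\<^sub>\<infinity>w\<in>W n. norm (a w))" for n
  have A0: "0 \<le> A n" for n unfolding A_def by (rule infsum_nonneg) auto
  have bound: "norm (word_pairing \<kappa> w xs *\<^sub>R a w) \<le> C ^ n * prod_list (map norm xs) * norm (a w)"
    if "length xs = n" "w \<in> W n" for n xs w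
    using abs_word_pairing_le[OF \<kappa>(2), of w xs] C that by (auto simp: W_def intro!: mult_right_mono)
  have ps: "(\<lambda>w. norm (word_pairing \<kappa> w xs *\<^sub>R a w)) summable_on W n" if "length xs = n" for n xs
    using summable_on_cmult_right[OF as, of "C ^ n * prod_list (map norm xs)" n] bound[OF that]
    by (rule Infinite_Sum.abs_summable_on_comparison_test')
  have ps': "(\<lambda>w. word_pairing \<kappa> w xs *\<^sub>R a w) summable_on W n" if "length xs = n" for n xs
    using ps[OF that] by (rule Infinite_Sum.abs_summable_summable)
  have mult: "bounded_multilinear_on V n (m n) (C ^ n * A n)" for n
    unfolding bounded_multilinear_on_def
  proof (intro conjI allI impI)
    show "0 \<le> C ^ n * A n" using C A0 by simp
  next
    fix xs :: "'a list" and k assume xs: "length xs = n \<and> set xs \<subseteq> V" and k: "k < n"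
    have *: "word_pairing \<kappa> w (xs[k := x + y]) *\<^sub>R a w =
        word_pairing \<kappa> w (xs[k := x]) *\<^sub>R a w + word_pairing \<kappa> w (xs[k := y]) *\<^sub>R a w"
      "word_pairing \<kappa> w (xs[k := d *\<^sub>R x]) *\<^sub>R a w = d *\<^sub>R (word_pairing \<kappa> w (xs[k := x]) *\<^sub>R a w)"
      if "w \<in> W n" for w x y d
      using word_pairing_update[of \<kappa> w xs k] \<kappa>(1) xs k that by (auto simp: W_def scaleR_add_left)
    have add: "m n (xs[k := x + y]) = m n (xs[k := x]) + m n (xs[k := y])" for x y
    proof -
      have "m n (xs[k := x + y]) = (\<Sum>\<^sub>\<infinity>w\<in>W n. word_pairing \<kappa> w (xs[k := x]) *\<^sub>R a w +
          word_pairing \<kappa> w (xs[k := y]) *\<^sub>R a w)"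
        unfolding m_def by (rule infsum_cong) (rule *)
      also have "\<dots> = m n (xs[k := x]) + m n (xs[k := y])"
        unfolding m_def by (rule infsum_add) (rule ps', simp add: xs)+
      finally show ?thesis .
    qed
    have scale: "m n (xs[k := d *\<^sub>R x]) = d *\<^sub>R m n (xs[k := x])" for d x
    proof -
      have "m n (xs[k := d *\<^sub>R x]) = (\<Sum>\<^sub>\<infinity>w\<in>W n. d *\<^sub>R (word_pairing \<kappa> w (xs[k := x]) *\<^sub>R a w))"
        unfolding m_def by (rule infsum_cong) (rule *)
      also have "\<dots> = d *\<^sub>R m n (xs[k := x])" unfolding m_def by (rule infsum_scaleR_right)
      finally show ?thesis .
    qed
    show "linear_map_on V (\<lambda>y. m n (xs[k := y]))"
      unfolding linear_map_on_def using add scale by blast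
  next
    fix xs :: "'a list" assume xs: "length xs = n \<and> set xs \<subseteq> V"
    have "norm (m n xs) \<le> (\<Sum>\<^sub>\<infinity>w\<in>W n. norm (word_pairing \<kappa> w xs *\<^sub>R a w))"
      unfolding m_def by (rule norm_infsum_bound) (use ps xs in blast)
    also have "\<dots> \<le> (\<Sum>\<^sub>\<infinity>w\<in>W n. C ^ n * prod_list (map norm xs) * norm (a w))"
      by (rule infsum_mono) (use ps xs bound summable_on_cmult_right[OF as] in auto)
    also have "\<dots> = C ^ n * prod_list (map norm xs) * A n"
      unfolding A_def by (rule infsum_cmult_right) (rule as)
    finally show "norm (m n xs) \<le> C ^ n * A n * prod_list (map norm xs)" by (simp add: mult_ac)
  qed
  \<comment> \<open>An unordered sum over all words becomes a series over lengths; used for the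
    norms and for the values.\<close>
  have group: "(g has_sum s) UNIV \<Longrightarrow> (\<And>n. (g has_sum h n) (W n)) \<Longrightarrow> h sums s"
    for g :: "'i list \<Rightarrow> 'c::banach" and s h
  proof -
    assume g: "(g has_sum s) UNIV" and h: "\<And>n. (g has_sum h n) (W n)"
    have "bij_betw snd (Sigma UNIV W) (UNIV :: 'i list set)"
      by (rule bij_betwI[where g = "\<lambda>w. (length w, w)"]) (auto simp: W_def)
    from has_sum_reindex_bij_betw[OF this, of g s] g
    have "((\<lambda>x. g (snd x)) has_sum s) (Sigma UNIV W)" by simp
    from has_sum_SigmaD[OF this, of h] h have "(h has_sum s) UNIV" by simp
    then show "h sums s" by (rule has_sum_imp_sums)
  qed
  have "(\<lambda>n. A n * \<rho> ^ n) sums (\<Sum>\<^sub>\<infinity>w. norm (a w) * \<rho> ^ length w)"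
  proof (rule group[OF has_sum_infsum[OF a(1)]])
    fix n
    have "((\<lambda>w. norm (a w) * \<rho> ^ n) has_sum A n * \<rho> ^ n) (W n)"
      unfolding A_def by (intro has_sum_cmult_left has_sum_infsum as)
    then show "((\<lambda>w. norm (a w) * \<rho> ^ length w) has_sum A n * \<rho> ^ n) (W n)"
      by (rule has_sum_cong[THEN iffD1, rotated]) (auto simp: W_def)
  qed
  moreover have "(\<lambda>n. C ^ n * A n * r ^ n) = (\<lambda>n. A n * \<rho> ^ n)"
    unfolding r(2)[symmetric] by (simp add: power_mult_distrib mult_ac)
  ultimately have sm: "summable (\<lambda>n. C ^ n * A n * r ^ n)" by (simp only: sums_summable)
  have "(\<lambda>n. m n (replicate n h)) sums F (x + h)" if h: "h \<in> V" "norm h < r" for h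
  proof -
    have "\<bar>\<kappa> i h\<bar> \<le> \<rho>" for i
      using order_trans[OF \<kappa>(2)[of i h] mult_left_mono[of "norm h" r C]] h C r by simp
    then have "((\<lambda>w. word_monomial (\<lambda>i. \<kappa> i h) w *\<^sub>R a w) has_sum f (\<lambda>i. \<kappa> i h)) UNIV"
      by (rule a(2))
    then have "(\<lambda>n. m n (replicate n h)) sums f (\<lambda>i. \<kappa> i h)"
    proof (rule group)
      fix n
      have "((\<lambda>w. word_pairing \<kappa> w (replicate n h) *\<^sub>R a w) has_sum m n (replicate n h)) (W n)"
        unfolding m_def by (rule has_sum_infsum[OF ps']) simp
      then show "((\<lambda>w. word_monomial (\<lambda>i. \<kappa> i h) w *\<^sub>R a w) has_sum m n (replicate n h)) (W n)"
        by (rule has_sum_cong[THEN iffD1, rotated]) (auto simp: W_def word_pairing_replicate)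
    qed
    then show ?thesis using F h by (simp add: r_def)
  qed
  then show ?thesis
    unfolding real_analytic_at_def using r(1) mult sm by (intro exI[of _ r] conjI exI[of _ m] exI[of _ "\<lambda>n. C ^ n * A n"]) auto
qed

text \<open>Recentering: half of the radius is spent on the coordinates of \<open>x\<close> and half
  remains for the increment. One \<epsilon> serves all \<open>V\<close>, so a map can be treated as
  analytic on the kernel and on the whole space alike.\<close>

lemma analytic_germ_imp_real_analytic_at:
  fixes f :: "('i \<Rightarrow> real) \<Rightarrow> 'b::banach" and \<kappa> :: "'i \<Rightarrow> 'a::real_normed_vector \<Rightarrow> real"
  assumes "analytic_germ f" "0 < C" "\<And>i. linear (\<kappa> i)" "\<And>i x. \<bar>\<kappa> i x\<bar> \<le> C * norm x"
  obtains \<epsilon> where "0 < \<epsilon>"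
    "\<And>V F x. norm x < \<epsilon> \<Longrightarrow> (\<And>h. h \<in> V \<Longrightarrow> norm h < \<epsilon> \<Longrightarrow> F (x + h) = f (\<lambda>i. \<kappa> i (x + h))) \<Longrightarrow>
      real_analytic_at V F x"
proof -
  obtain \<rho> c where f: "0 < \<rho>" "word_series \<rho> f c" using assms(1) unfolding analytic_germ_def by blast
  show ?thesis
  proof (rule that[of "\<rho> / 2 / C"])
    show "0 < \<rho> / 2 / C" using f(1) assms(2) by simp
    fix V F x assume x: "norm x < \<rho> / 2 / C"
      and F: "\<And>h. h \<in> V \<Longrightarrow> norm h < \<rho> / 2 / C \<Longrightarrow> F (x + h) = f (\<lambda>i. \<kappa> i (x + h))"
    have "C * norm x \<le> \<rho> / 2" using x assms(2) by (simp add: field_simps)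
    then have \<kappa>x: "\<bar>\<kappa> i x\<bar> \<le> \<rho> / 2" for i using assms(4)[of i x] by simp
    have "word_series (\<rho> / 2) (\<lambda>t. f (\<lambda>i. \<kappa> i x + t i)) c"
    proof (rule word_series_subst[OF f(2)])
      fix i
      have "word_series (\<rho> / 2) (\<lambda>t. \<kappa> i x + t i) (\<bar>\<kappa> i x\<bar> + \<rho> / 2)"
        using word_series_add[OF word_series_const[of "\<rho> / 2" "\<kappa> i x"] word_series_var[of "\<rho> / 2" i]] f(1)
        by simp
      then show "word_series (\<rho> / 2) (\<lambda>t. \<kappa> i x + t i) \<rho>"
        by (rule word_series_mono) (use \<kappa>x[of i] in simp)
    qed (use f in simp)
    then show "real_analytic_at V F x"
      by (rule real_analytic_at_of_word_series[OF _ _ assms(2-4)])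
        (use f(1) F in \<open>auto simp: linear_add[OF assms(3)]\<close>)
  qed
qed

section \<open>Local diffeomorphisms of a finite-dimensional subspace\<close>

lemma real_analytic_at_cong:
  assumes "real_analytic_at V F x" "0 < \<delta>"
    "\<And>h. h \<in> V \<Longrightarrow> norm h < \<delta> \<Longrightarrow> F (x + h) = G (x + h)"
  shows "real_analytic_at V G x"
proof -
  obtain r m c where "0 < r \<and> (\<forall>n. bounded_multilinear_on V n (m n) (c n)) \<and>
      summable (\<lambda>n. c n * r ^ n) \<and>
      (\<forall>h\<in>V. norm h < r \<longrightarrow> (\<lambda>n. m n (replicate n h)) sums F (x + h))"
    using assms(1) unfolding real_analytic_at_def by blast
  then have r: "0 < r" "\<And>n. bounded_multilinear_on V n (m n) (c n)" "summable (\<lambda>n. c n * r ^ n)"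
    "\<And>h. h \<in> V \<Longrightarrow> norm h < r \<Longrightarrow> (\<lambda>n. m n (replicate n h)) sums F (x + h)" by blast+
  have c: "0 \<le> c n" for n using r(2)[of n] unfolding bounded_multilinear_on_def by blast
  define s where "s = min r \<delta>"
  have s: "0 < s" "s \<le> r" "s \<le> \<delta>" using r(1) assms(2) by (auto simp: s_def)
  have "summable (\<lambda>n. c n * s ^ n)"
  proof (rule summable_comparison_test'[OF r(3), of 0])
    show "norm (c n * s ^ n) \<le> c n * r ^ n" for n
      using s c[of n] by (auto intro!: mult_left_mono power_mono)
  qed
  moreover have "(\<lambda>n. m n (replicate n h)) sums G (x + h)" if "h \<in> V" "norm h < s" for h
    using r(4)[of h] assms(3)[of h] that s by simp
  ultimately show ?thesis
    unfolding real_analytic_at_def using s(1) r(2)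
    by (intro exI[of _ s] conjI exI[of _ m] exI[of _ c]) auto
qed

lemma real_analytic_at_translate:
  "real_analytic_at V F x \<longleftrightarrow> real_analytic_at V (\<lambda>h. F (x + h)) 0"
  unfolding real_analytic_at_def by simp

lemma real_analytic_at_isCont:
  fixes F :: "'a::real_normed_vector \<Rightarrow> 'b::banach"
  assumes "real_analytic_at UNIV F x"
  shows "isCont F x"
proof -
  have "((\<lambda>h. F (x + h)) \<longlongrightarrow> F (x + 0)) (nhds 0)"
    using assms unfolding real_analytic_at_translate[of _ F x] by (rule real_analytic_at_tendsto)
  then have "((\<lambda>h. F (x + h)) \<longlongrightarrow> F x) (at 0)" by (simp add: tendsto_nhds_iff)
  then show ?thesis unfolding isCont_def by (simp add: LIM_offset_zero_iff)
qed

text \<open>Basis vectors index themselves, and letters outside \<open>B\<close> carry the zero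
  functional; thus the whole type serves as the set of letters although finitely many
  matter.\<close>

locale coordinates =
  fixes B :: "'a::banach set" and \<kappa> :: "'a \<Rightarrow> 'a \<Rightarrow> real"
  assumes finite_B: "finite B"
    and bounded_linear_\<kappa>: "\<And>b. bounded_linear (\<kappa> b)"
    and \<kappa>_outside: "\<And>b x. b \<notin> B \<Longrightarrow> \<kappa> b x = 0"
    and \<kappa>_basis: "\<And>b b'. b \<in> B \<Longrightarrow> b' \<in> B \<Longrightarrow> \<kappa> b b' = (if b = b' then 1 else 0)"
begin

lemma \<kappa>_bound: obtains C where "0 < C" "\<And>b x. \<bar>\<kappa> b x\<bar> \<le> C * norm x"
proof -
  have "\<exists>C. \<forall>b\<in>B. \<forall>x. \<bar>\<kappa> b x\<bar> \<le> C * norm x \<and> 0 < C"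
    using finite_B
  proof (induction rule: finite_induct)
    case (insert b F)
    then obtain C where C: "\<forall>b\<in>F. \<forall>x. \<bar>\<kappa> b x\<bar> \<le> C * norm x \<and> 0 < C" by blast
    obtain D where D: "0 < D" "\<And>x. norm (\<kappa> b x) \<le> norm x * D"
      using bounded_linear.pos_bounded[OF bounded_linear_\<kappa>] by blast
    have "\<bar>\<kappa> b' x\<bar> \<le> (max C D) * norm x \<and> 0 < max C D" if "b' \<in> insert b F" for b' x
    proof -
      have "\<bar>\<kappa> b' x\<bar> \<le> C * norm x \<or> \<bar>\<kappa> b' x\<bar> \<le> D * norm x"
        using that C D(2)[of x] by (auto simp: mult.commute)
      moreover have "C * norm x \<le> max C D * norm x" "D * norm x \<le> max C D * norm x"
        by (auto intro: mult_right_mono)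
      ultimately show ?thesis using D(1) by auto
    qed
    then show ?case by blast
  qed auto
  then obtain C where C: "\<And>b x. b \<in> B \<Longrightarrow> \<bar>\<kappa> b x\<bar> \<le> C * norm x" by blast
  have "\<bar>\<kappa> b x\<bar> \<le> max 1 C * norm x" for b x
  proof (cases "b \<in> B")
    case True
    have "C * norm x \<le> max 1 C * norm x" by (auto intro: mult_right_mono)
    then show ?thesis using C[OF True, of x] by linarith
  qed (simp add: \<kappa>_outside)
  then show ?thesis using that[of "max 1 C"] by simp
qed

lemma linear_\<kappa>: "linear (\<kappa> b)"
  using bounded_linear_\<kappa> bounded_linear.linear by blast

lemma \<kappa>_sum: "\<kappa> b (\<Sum>c\<in>B. t c *\<^sub>R c) = (if b \<in> B then t b else 0)"
proof (cases "b \<in> B")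
  case True
  have "\<kappa> b (\<Sum>c\<in>B. t c *\<^sub>R c) = (\<Sum>c\<in>B. t c * \<kappa> b c)"
    by (simp add: linear_sum[OF linear_\<kappa>] linear_scale[OF linear_\<kappa>])
  also have "\<dots> = (\<Sum>c\<in>B. if c = b then t c else 0)"
    by (rule sum.cong) (use True \<kappa>_basis in auto)
  finally show ?thesis using True finite_B by simp
qed (simp add: \<kappa>_outside)

lemma expand:
  assumes "x \<in> span B"
  shows "(\<Sum>b\<in>B. \<kappa> b x *\<^sub>R b) = x"
proof -
  obtain t where "x = (\<Sum>c\<in>B. t c *\<^sub>R c)"
    using assms span_finite[OF finite_B] by auto
  then show ?thesis using \<kappa>_sum[of _ t] by (auto intro!: sum.cong)
qed

lemma tendsto_\<kappa>: "filterlim (\<lambda>x b. \<kappa> b x) polydisc_filter (nhds 0)"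
  unfolding filterlim_iff
proof (intro allI impI)
  fix P :: "('a \<Rightarrow> real) \<Rightarrow> bool" assume "eventually P polydisc_filter"
  then obtain \<rho> where \<rho>: "0 < \<rho>" "\<And>t. (\<And>i. \<bar>t i\<bar> \<le> \<rho>) \<Longrightarrow> P t"
    unfolding eventually_polydisc_filter by blast
  obtain C where C: "0 < C" "\<And>b x. \<bar>\<kappa> b x\<bar> \<le> C * norm x" by (rule \<kappa>_bound) blast
  have "P (\<lambda>b. \<kappa> b x)" if "norm x < \<rho> / C" for x
  proof (rule \<rho>(2))
    have "C * norm x \<le> \<rho>" using that C(1) by (simp add: field_simps)
    then show "\<bar>\<kappa> b x\<bar> \<le> \<rho>" for b using C(2)[of b x] by linarith
  qed
  then show "\<forall>\<^sub>F x in nhds 0. P (\<lambda>b. \<kappa> b x)"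
    unfolding eventually_nhds_metric using \<rho>(1) C(1) by (intro exI[of _ "\<rho> / C"]) auto
qed

end

text \<open>An inverse function theorem. In coordinates the map is the identity plus
  \<open>h\<close> with derivative 0 at the origin, so a local inverse \<sigma> solves \<sigma> = t
  - h(\<sigma>), an instance of the implicit function theorem.\<close>

lemma (in coordinates) analytic_local_diffeo_of_germ:
  fixes f :: "('a \<Rightarrow> real) \<Rightarrow> 'a" and \<phi> :: "'a \<Rightarrow> 'a"
  assumes germ: "analytic_germ f" and ran: "\<And>t. f t \<in> span B" and zero: "f (\<lambda>_. 0) = 0"
    and deriv: "\<And>b. b \<in> B \<Longrightarrow> ((\<lambda>\<tau>. f ((\<lambda>_. 0)(b := \<tau>))) has_vector_derivative b) (at 0)"
    and \<phi>: "\<And>x. \<phi> x = f (\<lambda>b. \<kappa> b x)"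
  shows "analytic_local_diffeo (span B) \<phi>" and "(\<phi> has_derivative (\<lambda>h. h)) (at 0 within span B)"
proof -
  have \<phi>ran: "\<phi> x \<in> span B" for x by (simp add: \<phi> ran)
  have \<phi>0: "\<phi> 0 = 0" using zero by (simp add: \<phi> linear_0[OF linear_\<kappa>])
  obtain C where C: "0 < C" "\<And>b x. \<bar>\<kappa> b x\<bar> \<le> C * norm x" by (rule \<kappa>_bound) blast
  have "\<exists>\<epsilon>>0. \<forall>V F x. norm x < \<epsilon> \<longrightarrow>
      (\<forall>h. h \<in> V \<longrightarrow> norm h < \<epsilon> \<longrightarrow> F (x + h) = f (\<lambda>b. \<kappa> b (x + h))) \<longrightarrow> real_analytic_at V F x"
    by (rule analytic_germ_imp_real_analytic_at[where \<kappa> = \<kappa>, OF germ C(1) linear_\<kappa> C(2)]) auto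
  then obtain \<epsilon>0 where \<epsilon>0: "0 < \<epsilon>0" "\<forall>V F x. norm x < \<epsilon>0 \<longrightarrow>
      (\<forall>h. h \<in> V \<longrightarrow> norm h < \<epsilon>0 \<longrightarrow> F (x + h) = f (\<lambda>b. \<kappa> b (x + h))) \<longrightarrow> real_analytic_at V F x"
    by blast
  have \<phi>an: "real_analytic_at V \<phi> x" if "norm x < \<epsilon>0" for V x
    by (rule \<epsilon>0(2)[rule_format]) (use that \<phi> in auto)

  \<comment> \<open>Letters outside \<open>B\<close> are suppressed, so that \<open>h\<close> does
    not depend on them and its partial derivatives vanish in every letter.\<close>
  define restr :: "('a \<Rightarrow> real) \<Rightarrow> 'a \<Rightarrow> real" where "restr t b = (if b \<in> B then t b else 0)" for t b
  define h where "h b t = \<kappa> b (f (restr t)) - restr t b" for b t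
  have restr_vf: "vanishing_family (\<lambda>b t. restr t b)"
    by (rule vanishing_family_subset, rename_tac b, case_tac "b \<in> B") (auto simp: restr_def)
  have h_germ: "analytic_germ (h b)" for b
    unfolding h_def
    by (intro analytic_germ_diff analytic_germ_linear[OF bounded_linear_\<kappa>]
        analytic_germ_subst[OF germ restr_vf, simplified] vanishing_family_analytic_germ[OF restr_vf])
  have restr0: "restr (\<lambda>_. 0) = (\<lambda>_. 0)" by (auto simp: restr_def)
  have h0: "h b (\<lambda>_. 0) = 0" for b by (simp add: h_def restr0 zero linear_0[OF linear_\<kappa>] restr_def)
  have h_out: "h b = (\<lambda>_. 0)" if "b \<notin> B" for b
    using that by (simp add: h_def restr_def \<kappa>_outside fun_eq_iff)
  have h_deriv: "((\<lambda>\<tau>. h b ((\<lambda>_. 0)(c := \<tau>))) has_vector_derivative 0) (at 0)" for b c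
  proof (cases "c \<in> B \<and> b \<in> B")
    case True
    have "restr ((\<lambda>_. 0)(c := \<tau>)) = (\<lambda>_. 0)(c := \<tau>)" for \<tau> using True by (auto simp: restr_def)
    then have eq: "h b ((\<lambda>_. 0)(c := \<tau>)) = \<kappa> b (f ((\<lambda>_. 0)(c := \<tau>))) - (if b = c then \<tau> else 0)" for \<tau>
      by (simp add: h_def)
    have "((\<lambda>\<tau>. \<kappa> b (f ((\<lambda>_. 0)(c := \<tau>)))) has_vector_derivative \<kappa> b c) (at 0)"
      using True by (intro bounded_linear.has_vector_derivative[OF bounded_linear_\<kappa>] deriv) simp
    moreover have "((\<lambda>\<tau>::real. if b = c then \<tau> else 0) has_vector_derivative (if b = c then 1 else 0)) (at 0)"
      by (auto intro: has_vector_derivative_id)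
    ultimately have "((\<lambda>\<tau>. h b ((\<lambda>_. 0)(c := \<tau>))) has_vector_derivative
        \<kappa> b c - (if b = c then 1 else 0)) (at 0)"
      unfolding eq by (rule has_vector_derivative_diff)
    then show ?thesis using True \<kappa>_basis by simp
  next
    case False
    then have d: "c \<notin> B \<or> b \<notin> B" by blast
    have "h b ((\<lambda>_. 0)(c := \<tau>)) = 0" for \<tau>
      using d
    proof
      assume "c \<notin> B"
      then have "restr ((\<lambda>_. 0)(c := \<tau>)) = (\<lambda>_. 0)" by (auto simp: restr_def)
      then show ?thesis by (simp add: h_def zero linear_0[OF linear_\<kappa>])
    qed (simp add: h_out)
    then show ?thesis by simp
  qed

  \<comment> \<open>Letters \<open>Inl\<close> are the coordinates of the target point, letters
    \<open>Inr\<close> those of the sought preimage.\<close>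
  define G :: "'a \<Rightarrow> ('a + 'a \<Rightarrow> real) \<Rightarrow> real"
    where "G b T = restr (\<lambda>c. T (Inl c)) b - h b (\<lambda>c. T (Inr c))" for b T
  have "\<exists>\<sigma>. vanishing_family \<sigma> \<and>
    (\<forall>\<^sub>F t in polydisc_filter. \<forall>b. \<sigma> b t = G b (case_sum t (\<lambda>b. \<sigma> b t)))"
  proof (rule analytic_germ_implicit_function[of B G])
    show "finite B" by (rule finite_B)
    show "G b = (\<lambda>_. 0)" if "b \<notin> B" for b using that by (simp add: G_def restr_def h_out fun_eq_iff)
    have "vanishing_family (\<lambda>b T. T (Inr b :: 'a + 'a))" by (rule vanishing_family_subset) blast
    moreover have "vanishing_family (\<lambda>b (T :: 'a + 'a \<Rightarrow> real). restr (\<lambda>c. T (Inl c)) b)"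
      by (rule vanishing_family_subset, rename_tac b, case_tac "b \<in> B") (auto simp: restr_def)
    ultimately show "analytic_germ (G b)" for b unfolding G_def
      by (intro analytic_germ_diff analytic_germ_subst[OF h_germ] vanishing_family_analytic_germ[of _ b])
    show "G b (\<lambda>_. 0) = 0" for b by (simp add: G_def h0 restr_def)
    show "((\<lambda>\<tau>. G b ((\<lambda>_. 0)(Inr k := \<tau>))) has_vector_derivative 0) (at 0)" for b k
    proof -
      have "G b ((\<lambda>_. 0)(Inr k := \<tau>)) = 0 - h b ((\<lambda>_. 0)(k := \<tau>))" for \<tau>
      proof -
        have "(\<lambda>c. ((\<lambda>_. 0)(Inr k := \<tau>)) (Inr c :: 'a + 'a)) = (\<lambda>_. 0)(k := \<tau>)" by (auto simp: fun_eq_iff)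
        moreover have "(\<lambda>c. ((\<lambda>_. 0)(Inr k := \<tau>)) (Inl c :: 'a + 'a)) = (\<lambda>_. 0)" by auto
        ultimately show ?thesis by (simp only: G_def restr0)
      qed
      moreover have "((\<lambda>\<tau>. 0 - h b ((\<lambda>_. 0)(k := \<tau>))) has_vector_derivative 0 - 0) (at 0)"
        by (intro has_vector_derivative_diff has_vector_derivative_const h_deriv)
      ultimately show ?thesis by simp
    qed
  qed blast
  then obtain \<sigma> where \<sigma>: "vanishing_family \<sigma>"
    "\<forall>\<^sub>F t in polydisc_filter. \<forall>b. \<sigma> b t = G b (case_sum t (\<lambda>b. \<sigma> b t))" by blast
  define g where "g t = (\<Sum>b\<in>B. \<sigma> b t *\<^sub>R b)" for t
  define \<omega> where "\<omega> x = g (\<lambda>b. \<kappa> b x)" for x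
  have g_germ: "analytic_germ g" unfolding g_def
    by (intro analytic_germ_sum analytic_germ_scaleR analytic_germ_const vanishing_family_analytic_germ \<sigma>)
  have "\<exists>\<epsilon>>0. \<forall>V F x. norm x < \<epsilon> \<longrightarrow>
      (\<forall>h. h \<in> V \<longrightarrow> norm h < \<epsilon> \<longrightarrow> F (x + h) = g (\<lambda>b. \<kappa> b (x + h))) \<longrightarrow> real_analytic_at V F x"
    by (rule analytic_germ_imp_real_analytic_at[where \<kappa> = \<kappa>, OF g_germ C(1) linear_\<kappa> C(2)]) auto
  then obtain \<epsilon>1 where \<epsilon>1: "0 < \<epsilon>1" "\<forall>V F x. norm x < \<epsilon>1 \<longrightarrow>
      (\<forall>h. h \<in> V \<longrightarrow> norm h < \<epsilon>1 \<longrightarrow> F (x + h) = g (\<lambda>b. \<kappa> b (x + h))) \<longrightarrow> real_analytic_at V F x"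
    by blast
  have \<omega>an: "real_analytic_at V \<omega> x" if "norm x < \<epsilon>1" for V x
    by (rule \<epsilon>1(2)[rule_format]) (use that \<omega>_def in auto)
  have \<omega>ran: "\<omega> x \<in> span B" for x unfolding \<omega>_def g_def by (intro span_sum span_scale span_base)

  \<comment> \<open>The right inverse property concerns letter values supported in \<open>B\<close>,
    which is always the case for coordinates of a point.\<close>
  have "\<forall>\<^sub>F t in polydisc_filter. f (\<lambda>b. \<kappa> b (g t)) = (\<Sum>b\<in>B. t b *\<^sub>R b) \<or> \<not> (\<forall>b. b \<notin> B \<longrightarrow> t b = 0)"
    using \<sigma>(2)
  proof eventually_elim
    case (elim t)
    have \<kappa>\<sigma>: "\<kappa> b (g t) = \<sigma> b t" for b
    proof (cases "b \<in> B")
      case False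
      then have "\<sigma> b t = 0" using elim[rule_format, of b] by (simp add: G_def restr_def h_out)
      then show ?thesis using False by (simp add: \<kappa>_outside)
    qed (simp add: g_def \<kappa>_sum)
    then have \<kappa>g: "(\<lambda>b. \<kappa> b (g t)) = (\<lambda>b. \<sigma> b t)" by (rule ext)
    have rs: "restr (\<lambda>b. \<sigma> b t) = (\<lambda>b. \<sigma> b t)"
    proof
      show "restr (\<lambda>b. \<sigma> b t) b = \<sigma> b t" for b
        using \<kappa>\<sigma>[of b] \<kappa>_outside[of b "g t"] by (simp add: restr_def)
    qed
    have "\<kappa> b (f (\<lambda>b. \<sigma> b t)) = t b" if "b \<in> B" for b
    proof -
      have "\<sigma> b t = G b (case_sum t (\<lambda>b. \<sigma> b t))" using elim by blast
      also have "\<dots> = t b - (\<kappa> b (f (\<lambda>b. \<sigma> b t)) - \<sigma> b t)"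
        using that by (simp add: G_def h_def rs) (simp add: restr_def)
      finally show ?thesis by simp
    qed
    then have "f (\<lambda>b. \<sigma> b t) = (\<Sum>b\<in>B. t b *\<^sub>R b)"
      using expand[OF ran[of "\<lambda>b. \<sigma> b t"]] by (auto intro: sum.cong)
    then show ?case unfolding \<kappa>g by blast
  qed
  from tendsto_\<kappa>[THEN filterlim_iff[THEN iffD1], rule_format, OF this]
  have "\<forall>\<^sub>F x in nhds 0. x \<in> span B \<longrightarrow> \<phi> (\<omega> x) = x"
    by eventually_elim (use expand \<kappa>_outside in \<open>auto simp: \<phi> \<omega>_def\<close>)
  then obtain \<epsilon>2 where \<epsilon>2: "0 < \<epsilon>2" "\<And>x. norm x < \<epsilon>2 \<Longrightarrow> x \<in> span B \<Longrightarrow> \<phi> (\<omega> x) = x"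
    unfolding eventually_nhds_metric by auto

  \<comment> \<open>So far there is only a right inverse. Injectivity follows because every
    component of the nonlinear part \<open>h\<close> has Lipschitz constant 1/2 in the sup
    norm.\<close>
  have "\<exists>\<rho>>0. \<forall>b\<in>B. \<forall>x y \<delta>. (\<forall>j. \<bar>x j\<bar> \<le> \<rho>) \<longrightarrow> (\<forall>j. \<bar>y j\<bar> \<le> \<rho>) \<longrightarrow>
      (\<forall>j. \<bar>x j - y j\<bar> \<le> \<delta>) \<longrightarrow> \<bar>h b x - h b y\<bar> \<le> 1 / 2 * \<delta>"
    using finite_B
  proof (induction rule: finite_induct)
    case empty
    then show ?case by (auto intro!: exI[of _ 1])
  next
    case (insert b F)
    then obtain \<rho>1 where \<rho>1: "0 < \<rho>1" "\<forall>b\<in>F. \<forall>x y \<delta>. (\<forall>j. \<bar>x j\<bar> \<le> \<rho>1) \<longrightarrow> (\<forall>j. \<bar>y j\<bar> \<le> \<rho>1) \<longrightarrow>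
      (\<forall>j. \<bar>x j - y j\<bar> \<le> \<delta>) \<longrightarrow> \<bar>h b x - h b y\<bar> \<le> 1 / 2 * \<delta>" by blast
    have "\<exists>\<rho>>0. \<forall>x y \<delta>. (\<forall>j. \<bar>x j\<bar> \<le> \<rho>) \<longrightarrow> (\<forall>j. \<bar>y j\<bar> \<le> \<rho>) \<longrightarrow>
      (\<forall>j. \<bar>x j - y j\<bar> \<le> \<delta>) \<longrightarrow> \<bar>h b x - h b y\<bar> \<le> 1 / 2 * \<delta>"
      by (rule analytic_germ_pointwise_lipschitz[OF h_germ[of b] _ h_deriv[of b], of "1 / 2"]) auto
    then obtain \<rho>2 where \<rho>2: "0 < \<rho>2" "\<forall>x y \<delta>. (\<forall>j. \<bar>x j\<bar> \<le> \<rho>2) \<longrightarrow> (\<forall>j. \<bar>y j\<bar> \<le> \<rho>2) \<longrightarrow>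
      (\<forall>j. \<bar>x j - y j\<bar> \<le> \<delta>) \<longrightarrow> \<bar>h b x - h b y\<bar> \<le> 1 / 2 * \<delta>" by blast
    show ?case using \<rho>1 \<rho>2 by (intro exI[of _ "min \<rho>1 \<rho>2"]) auto
  qed
  then obtain \<rho> where \<rho>: "0 < \<rho>" "\<And>b x y \<delta>. b \<in> B \<Longrightarrow> (\<And>j. \<bar>x j\<bar> \<le> \<rho>) \<Longrightarrow> (\<And>j. \<bar>y j\<bar> \<le> \<rho>) \<Longrightarrow>
      (\<And>j. \<bar>x j - y j\<bar> \<le> \<delta>) \<Longrightarrow> \<bar>h b x - h b y\<bar> \<le> 1 / 2 * \<delta>" by blast
  have inj: "x = y" if xy: "x \<in> span B" "y \<in> span B" "norm x < \<rho> / C" "norm y < \<rho> / C" "\<phi> x = \<phi> y" for x y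
  proof -
    have small: "\<bar>\<kappa> b z\<bar> \<le> \<rho>" if "norm z < \<rho> / C" for b z
    proof -
      have "C * norm z \<le> \<rho>" using that C(1) by (simp add: field_simps)
      then show ?thesis using C(2)[of b z] by linarith
    qed
    have r\<kappa>: "restr (\<lambda>b. \<kappa> b z) = (\<lambda>b. \<kappa> b z)" for z by (auto simp: restr_def \<kappa>_outside)
    \<comment> \<open>The sup distance of the coordinates, which turns out to be at most half of
      itself; the inserted 0 takes care of an empty basis.\<close>
    define D where "D = Max (insert 0 ((\<lambda>b. \<bar>\<kappa> b x - \<kappa> b y\<bar>) ` B))"
    have D: "\<bar>\<kappa> b x - \<kappa> b y\<bar> \<le> D" for b
      unfolding D_def by (cases "b \<in> B") (auto intro!: Max_ge simp: finite_B \<kappa>_outside)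
    have step: "\<bar>\<kappa> b x - \<kappa> b y\<bar> \<le> 1 / 2 * D" if "b \<in> B" for b
    proof -
      have "h b (\<lambda>b. \<kappa> b z) = \<kappa> b (\<phi> z) - \<kappa> b z" for z by (simp add: h_def r\<kappa> \<phi>)
      then have "h b (\<lambda>b. \<kappa> b x) - h b (\<lambda>b. \<kappa> b y) = - (\<kappa> b x - \<kappa> b y)" using xy(5) by simp
      then have "\<bar>\<kappa> b x - \<kappa> b y\<bar> = \<bar>h b (\<lambda>b. \<kappa> b x) - h b (\<lambda>b. \<kappa> b y)\<bar>" by simp
      also have "\<dots> \<le> 1 / 2 * D" by (rule \<rho>(2)[OF that]) (use small xy D in auto)
      finally show ?thesis .
    qed
    have "D \<in> insert 0 ((\<lambda>b. \<bar>\<kappa> b x - \<kappa> b y\<bar>) ` B)"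
      unfolding D_def by (rule Max_in) (simp_all add: finite_B)
    then consider "D = 0" | b where "b \<in> B" "D = \<bar>\<kappa> b x - \<kappa> b y\<bar>" by blast
    then have "D \<le> 0"
    proof cases
      case (2 b)
      then show ?thesis using step[of b] by simp
    qed simp
    then have "\<kappa> b x = \<kappa> b y" for b using D[of b] by simp
    then have "(\<Sum>b\<in>B. \<kappa> b x *\<^sub>R b) = (\<Sum>b\<in>B. \<kappa> b y *\<^sub>R b)" by (simp only:)
    then show "x = y" by (simp only: expand[OF xy(1)] expand[OF xy(2)])
  qed

  \<comment> \<open>\<open>W'\<close> will be a ball and \<open>W\<close> its preimage inside the
    ball of injectivity; continuity of the right inverse at 0 ensures that it maps \<open>W'\<close>
    into \<open>W\<close>.\<close>
  define \<delta> where "\<delta> = min (\<rho> / C) \<epsilon>0"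
  have \<delta>: "0 < \<delta>" "\<delta> \<le> \<rho> / C" "\<delta> \<le> \<epsilon>0" using \<rho>(1) C(1) \<epsilon>0(1) by (auto simp: \<delta>_def)
  have \<omega>0: "\<omega> 0 = 0"
  proof -
    have "\<bar>\<sigma> b (\<lambda>_. 0)\<bar> \<le> e" if "0 < e" for b e
    proof -
      have "\<forall>\<^sub>F \<theta> in at_right (0::real). 0 < \<theta> \<and> (\<forall>j. word_series \<theta> (\<sigma> j) e)"
        using \<sigma>(1) that eventually_at_right_less[of "0::real"]
        unfolding vanishing_family_def by (auto intro: eventually_conj)
      from eventually_happens'[OF _ this] obtain \<theta> where "0 < \<theta>" "word_series \<theta> (\<sigma> b) e" by auto
      then show ?thesis using word_series_norm_le[of \<theta> "\<sigma> b" e "\<lambda>_. 0"] by simp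
    qed
    then have "\<sigma> b (\<lambda>_. 0) = 0" for b by (metis abs_le_zero_iff dense_ge)
    then show ?thesis by (simp add: \<omega>_def g_def linear_0[OF linear_\<kappa>])
  qed
  have "isCont \<omega> 0" using \<omega>an[of 0 UNIV] \<epsilon>1(1) by (intro real_analytic_at_isCont) simp
  then obtain \<epsilon>3 where \<epsilon>3: "0 < \<epsilon>3" "\<And>x. norm x < \<epsilon>3 \<Longrightarrow> norm (\<omega> x) < \<delta>"
    unfolding continuous_at_eps_delta using \<delta>(1) \<omega>0 by (metis dist_0_norm dist_commute)
  define \<epsilon> where "\<epsilon> = min \<epsilon>1 (min \<epsilon>2 \<epsilon>3)"
  have \<epsilon>: "0 < \<epsilon>" "\<epsilon> \<le> \<epsilon>1" "\<epsilon> \<le> \<epsilon>2" "\<epsilon> \<le> \<epsilon>3" using \<epsilon>1(1) \<epsilon>2(1) \<epsilon>3(1) by (auto simp: \<epsilon>_def)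
  define W where "W = {x \<in> span B. norm x < \<delta> \<and> norm (\<phi> x) < \<epsilon>}"
  define W' where "W' = {x \<in> span B. norm x < \<epsilon>}"
  have injW: "inj_on \<phi> W" unfolding W_def using inj \<delta> by (auto intro!: inj_onI)
  have \<omega>W: "\<omega> x \<in> W" "\<phi> (\<omega> x) = x" if "x \<in> W'" for x
    using that \<epsilon>2(2)[of x] \<epsilon>3(2)[of x] \<epsilon> \<omega>ran by (auto simp: W_def W'_def)
  have bij: "bij_betw \<phi> W W'"
    unfolding bij_betw_def
  proof (intro conjI injW equalityI subsetI)
    show "x \<in> W'" if "x \<in> \<phi> ` W" for x using that \<phi>ran by (auto simp: W_def W'_def)
    show "x \<in> \<phi> ` W" if "x \<in> W'" for x using \<omega>W[OF that] by (metis imageI)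
  qed
  have inv: "inv_into W \<phi> x = \<omega> x" if "x \<in> W'" for x
    using \<omega>W[OF that] injW by (auto intro: inv_into_f_eq)
  have "continuous_on (ball 0 \<delta>) \<phi>"
    using \<phi>an[of _ UNIV] \<delta> by (intro continuous_at_imp_continuous_on ballI real_analytic_at_isCont) auto
  then have "open (ball 0 \<delta> \<inter> \<phi> -` ball 0 \<epsilon>)" by (rule continuous_open_preimage) auto
  moreover have "W = span B \<inter> (ball 0 \<delta> \<inter> \<phi> -` ball 0 \<epsilon>)" by (auto simp: W_def)
  ultimately have openW: "openin (top_of_set (span B)) W" by (metis openin_open_Int)
  have "W' = span B \<inter> ball 0 \<epsilon>" by (auto simp: W'_def)
  then have openW': "openin (top_of_set (span B)) W'" by (metis open_ball openin_open_Int)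
  have "real_analytic_at (span B) (inv_into W \<phi>) x" if x: "x \<in> W'" for x
  proof (rule real_analytic_at_cong)
    show "real_analytic_at (span B) \<omega> x" using x \<epsilon> by (intro \<omega>an) (auto simp: W'_def)
    show "0 < \<epsilon> - norm x" using x by (simp add: W'_def)
    fix h assume h: "h \<in> span B" "norm h < \<epsilon> - norm x"
    then have "x + h \<in> W'"
      using x norm_triangle_ineq[of x h] by (auto simp: W'_def intro: span_add)
    then show "\<omega> (x + h) = inv_into W \<phi> (x + h)" by (simp add: inv)
  qed
  moreover have "real_analytic_at (span B) \<phi> x" if "x \<in> W" for x
    using that \<delta> by (intro \<phi>an) (auto simp: W_def)
  moreover have "0 \<in> W" using \<phi>0 \<delta>(1) \<epsilon>(1) by (simp add: W_def span_zero)
  ultimately show "analytic_local_diffeo (span B) \<phi>"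
    unfolding analytic_local_diffeo_def real_analytic_on_def
    using \<phi>0 bij openW openW' by blast

  \<comment> \<open>The derivative on the whole space is computed on basis vectors only, so it is
    known to be the identity just on their span.\<close>
  have "real_analytic_at UNIV \<phi> 0" using \<epsilon>0(1) by (intro \<phi>an) simp
  then obtain Q r where Q: "real_analytic_at UNIV Q 0" "0 < r"
    "\<And>x y. norm x < r \<Longrightarrow> norm y < r \<Longrightarrow> \<phi> y - \<phi> x = blinfun_apply (Q (x, y)) (y - x)"
    by (rule real_analytic_difference_quotient) blast
  have der: "(\<phi> has_derivative blinfun_apply (Q (0, 0))) (at 0)"
    using eventually_nhds_x_imp_x[OF real_analytic_has_derivative_diagonal[OF Q]] .
  have Qb: "blinfun_apply (Q (0, 0)) b = b" if "b \<in> B" for b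
  proof -
    have "(\<lambda>c. \<kappa> c (\<tau> *\<^sub>R b)) = (\<lambda>_. 0)(b := \<tau>)" for \<tau>
    proof
      show "\<kappa> c (\<tau> *\<^sub>R b) = ((\<lambda>_. 0)(b := \<tau>)) c" for c
        using that \<kappa>_basis[of c b] \<kappa>_outside[of c b]
        by (cases "c \<in> B") (auto simp: linear_scale[OF linear_\<kappa>])
    qed
    then have eq: "\<phi> (\<tau> *\<^sub>R b) = f ((\<lambda>_. 0)(b := \<tau>))" for \<tau> by (simp add: \<phi>)
    have "((\<lambda>\<tau>::real. \<tau> *\<^sub>R b) has_derivative (\<lambda>\<tau>. \<tau> *\<^sub>R b)) (at 0)"
      by (rule bounded_linear_imp_has_derivative[OF bounded_linear_scaleR_left])
    from has_derivative_compose[OF this, of \<phi> "blinfun_apply (Q (0, 0))"] der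
    have "((\<lambda>\<tau>. \<phi> (\<tau> *\<^sub>R b)) has_derivative (\<lambda>\<tau>. \<tau> *\<^sub>R blinfun_apply (Q (0, 0)) b)) (at 0)"
      by (simp add: blinfun.scaleR_right)
    then have "((\<lambda>\<tau>. f ((\<lambda>_. 0)(b := \<tau>))) has_vector_derivative blinfun_apply (Q (0, 0)) b) (at 0)"
      unfolding has_vector_derivative_def eq .
    then show ?thesis using deriv[OF that] vector_derivative_unique_at by blast
  qed
  have Qid: "blinfun_apply (Q (0, 0)) x = x" if "x \<in> span B" for x
  proof -
    have "blinfun_apply (Q (0, 0)) (\<Sum>b\<in>B. \<kappa> b x *\<^sub>R b) = (\<Sum>b\<in>B. \<kappa> b x *\<^sub>R b)"
      by (simp add: blinfun.sum_right blinfun.scaleR_right Qb)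
    then show ?thesis using expand[OF that] by simp
  qed
  have "(\<phi> has_derivative blinfun_apply (Q (0, 0))) (at 0 within span B)"
    using der by (rule has_derivative_at_withinI)
  then have "((\<lambda>y. (\<phi> y - \<phi> 0 - blinfun_apply (Q (0, 0)) (y - 0)) /\<^sub>R norm (y - 0)) \<longlongrightarrow> 0) (at 0 within span B)"
    unfolding has_derivative_at_within by simp
  then have "((\<lambda>y. (\<phi> y - \<phi> 0 - (y - 0)) /\<^sub>R norm (y - 0)) \<longlongrightarrow> 0) (at 0 within span B)"
    by (rule Lim_transform_eventually) (auto simp: eventually_at_filter Qid)
  then show "(\<phi> has_derivative (\<lambda>h. h)) (at 0 within span B)"
    unfolding has_derivative_at_within by (simp add: bounded_linear_ident)
qed

section \<open>Splittings and Lyapunov--Schmidt germs\<close>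

text \<open>The basis is a parameter, so that two splittings of the same operator share their
  letters.\<close>

locale ls_splitting =
  fixes p :: "'y::banach \<Rightarrow> 'x::banach \<Rightarrow> real" and L :: "'x \<Rightarrow> 'y" and Z B :: "'x set"
  assumes bilinear: "bounded_bilinear p" and fredholm: "fredholm L"
    and splitting: "compatible_splitting p L Z"
    and finite_basis: "finite B" and independent: "independent B" and span_basis: "span B = null_space L"
begin

interpretation p: bounded_bilinear p by (rule bilinear)

lemma bounded_linear_L: "bounded_linear L"
  using fredholm by (simp add: fredholm_def)

lemma subspace_Z: "subspace Z"
  using splitting by (simp add: compatible_splitting_def direct_sum_def)

lemma subspace_annihilator: "subspace (annihilator p Z)"
  by (auto simp: annihilator_def intro!: subspaceI simp: p.add_left p.scaleR_left p.zero_left)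

text \<open>Surjectivity of the restriction map, applied to the coordinate functional of
  \<open>b\<close>, which is continuous by the equivalence of norms on the kernel.\<close>

lemma ex_dual_vector:
  assumes "b \<in> B"
  shows "\<exists>y. y \<in> annihilator p Z \<and> (\<forall>b'\<in>B. p y b' = (if b = b' then 1 else 0))"
proof -
  define K where "K = null_space L"
  define f where "f = restrict (\<lambda>x. representation B x b) K"
  obtain c where c: "\<And>t. (\<Sum>b\<in>B. \<bar>t b\<bar>) \<le> c * norm (\<Sum>b\<in>B. t b *\<^sub>R b)"
    using finite_independent_coordinates_bounded[OF finite_basis independent] by blast
  have K: "K = span B" by (simp add: K_def span_basis)
  have "\<bar>f x\<bar> \<le> c * norm x" if "x \<in> K" for x
  proof -
    have "\<bar>f x\<bar> \<le> (\<Sum>b\<in>B. \<bar>representation B x b\<bar>)"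
      using member_le_sum[of b B "\<lambda>b. \<bar>representation B x b\<bar>"] assms finite_basis that
      by (simp add: f_def)
    also have "\<dots> \<le> c * norm (\<Sum>b\<in>B. representation B x b *\<^sub>R b)" by (rule c)
    also have "(\<Sum>b\<in>B. representation B x b *\<^sub>R b) = x"
      using real_vector.sum_representation_eq[OF independent, of x B] that finite_basis
      by (simp add: K)
    finally show ?thesis .
  qed
  moreover have "linear_map_on K f"
    unfolding linear_map_on_def f_def K
    by (auto simp: real_vector.representation_add[OF independent]
        real_vector.representation_scale[OF independent] intro: span_add span_scale)
  ultimately have "f \<in> dual_on K" by (auto simp: dual_on_def f_def)
  moreover have "bij_betw (\<lambda>y. restrict (p y) K) (annihilator p Z) (dual_on K)"
    using splitting by (simp add: compatible_splitting_def K_def)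
  ultimately have "f \<in> (\<lambda>y. restrict (p y) K) ` annihilator p Z"
    by (simp only: bij_betw_imp_surj_on)
  then obtain y where y: "y \<in> annihilator p Z" "restrict (p y) K = f" by (rule imageE) (rule that, auto)
  have "p y b' = (if b = b' then 1 else 0)" if "b' \<in> B" for b'
  proof -
    have "b' \<in> K" using that by (simp add: K span_base)
    then have "p y b' = f b'" using y(2) by (metis restrict_apply')
    also have "\<dots> = (if b = b' then 1 else 0)"
      using \<open>b' \<in> K\<close> real_vector.representation_basis[OF independent that] by (simp add: f_def)
    finally show ?thesis .
  qed
  with y(1) show ?thesis by blast
qed

definition dual_vector :: "'x \<Rightarrow> 'y" where
  "dual_vector b = (SOME y. y \<in> annihilator p Z \<and> (\<forall>b'\<in>B. p y b' = (if b = b' then 1 else 0)))"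

lemma dual_vector:
  assumes "b \<in> B"
  shows "dual_vector b \<in> annihilator p Z" "b' \<in> B \<Longrightarrow> p (dual_vector b) b' = (if b = b' then 1 else 0)"
  using someI_ex[OF ex_dual_vector[OF assms]] unfolding dual_vector_def by blast+

text \<open>The difference of the two sides pairs to 0 with the kernel and is 0 by injectivity of
  the restriction map. Applied to \<open>M x0\<close> this expresses it through the derivatives of
  the reduced energy.\<close>

lemma annihilator_expand:
  assumes "y \<in> annihilator p Z"
  shows "(\<Sum>b\<in>B. p y b *\<^sub>R dual_vector b) = y"
proof -
  define w where "w = y - (\<Sum>b\<in>B. p y b *\<^sub>R dual_vector b)"
  have wZ: "w \<in> annihilator p Z" unfolding w_def
    using assms dual_vector(1) subspace_annihilator
    by (intro subspace_diff subspace_sum subspace_scale) auto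
  have wb: "p w b = 0" if "b \<in> B" for b
  proof -
    have "p (\<Sum>c\<in>B. p y c *\<^sub>R dual_vector c) b = (\<Sum>c\<in>B. p y c * p (dual_vector c) b)"
      by (simp add: p.sum_left p.scaleR_left)
    also have "\<dots> = (\<Sum>c\<in>B. if c = b then p y c else 0)"
      by (rule sum.cong) (use that dual_vector(2) in auto)
    finally show ?thesis using that finite_basis by (simp add: w_def p.diff_left)
  qed
  have "p w x = 0" if "x \<in> null_space L" for x
  proof -
    have "x \<in> range (\<lambda>u. \<Sum>v\<in>B. u v *\<^sub>R v)"
      using that span_basis unfolding span_finite[OF finite_basis] by simp
    then obtain t where x: "x = (\<Sum>c\<in>B. t c *\<^sub>R c)" by blast
    show ?thesis unfolding x by (simp add: p.sum_right p.scaleR_right wb)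
  qed
  then have "restrict (p w) (null_space L) = restrict (p 0) (null_space L)"
    by (auto simp: restrict_def p.zero_left)
  moreover have "inj_on (\<lambda>y. restrict (p y) (null_space L)) (annihilator p Z)"
    using splitting by (simp add: compatible_splitting_def bij_betw_def)
  moreover have "0 \<in> annihilator p Z" using subspace_annihilator by (rule subspace_0)
  ultimately have "w = 0" using wZ by (auto dest: inj_onD)
  then show ?thesis by (simp add: w_def)
qed

text \<open>Dual vectors annihilate \<open>Z\<close>, so these are the coordinates of the kernel
  component along \<open>Z\<close>. Continuity of the projection thus comes from that of the
  pairing.\<close>

definition coord :: "'x \<Rightarrow> 'x \<Rightarrow> real" where
  "coord b x = (if b \<in> B then p (dual_vector b) x else 0)"

sublocale coordinates B coord
proof (rule coordinates.intro)
  show "bounded_linear (coord b)" for b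
    unfolding coord_def by (cases "b \<in> B") (auto intro: p.bounded_linear_right bounded_linear_zero)
qed (auto simp: coord_def finite_basis dual_vector(2))

definition kernel_proj :: "'x \<Rightarrow> 'x" where
  "kernel_proj x = (\<Sum>b\<in>B. coord b x *\<^sub>R b)"

lemma bounded_linear_kernel_proj: "bounded_linear kernel_proj"
  unfolding kernel_proj_def
  by (intro bounded_linear_sum bounded_linear_scaleR_const bounded_linear_\<kappa>)

lemma kernel_proj_in: "kernel_proj x \<in> null_space L"
  unfolding kernel_proj_def span_basis[symmetric] by (intro span_sum span_scale span_base)

lemma kernel_proj_id: "x \<in> null_space L \<Longrightarrow> kernel_proj x = x"
  unfolding kernel_proj_def by (rule expand) (simp add: span_basis)

lemma kernel_proj_Z: "z \<in> Z \<Longrightarrow> kernel_proj z = 0"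
  unfolding kernel_proj_def using dual_vector(1) by (auto simp: coord_def annihilator_def intro!: sum.neutral)

lemma minus_kernel_proj: "x - kernel_proj x \<in> Z"
proof -
  interpret bounded_linear kernel_proj by (rule bounded_linear_kernel_proj)
  obtain k z where "k \<in> null_space L" "z \<in> Z" "x = k + z"
    using splitting unfolding compatible_splitting_def direct_sum_def by blast
  then show ?thesis by (simp add: add kernel_proj_id kernel_proj_Z)
qed

lemma range_proj:
  shows "proj_along (range L) (annihilator p Z) y \<in> range L"
    and "y - proj_along (range L) (annihilator p Z) y \<in> annihilator p Z"
    and "y \<in> range L \<Longrightarrow> proj_along (range L) (annihilator p Z) y = y"
    and "y \<in> annihilator p Z \<Longrightarrow> proj_along (range L) (annihilator p Z) y = 0"
proof -
  have ds: "subspace (range L)" "subspace (annihilator p Z)" "range L \<inter> annihilator p Z = {0}"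
    "\<exists>a\<in>range L. \<exists>b\<in>annihilator p Z. y = a + b"
    using splitting unfolding compatible_splitting_def topological_splitting_def direct_sum_def by blast+
  have uniq: "a = a'" if "a \<in> range L" "y - a \<in> annihilator p Z" "a' \<in> range L" "y - a' \<in> annihilator p Z" for a a'
  proof -
    have "a - a' \<in> range L" using ds(1) that by (intro subspace_diff)
    moreover have "(y - a') - (y - a) \<in> annihilator p Z" by (rule subspace_diff[OF ds(2) that(4,2)])
    ultimately have "a - a' \<in> range L \<inter> annihilator p Z" by simp
    then show ?thesis using ds(3) by auto
  qed
  then have eq: "proj_along (range L) (annihilator p Z) y = a"
    if "a \<in> range L" "y - a \<in> annihilator p Z" for a
    unfolding proj_along_def using that by (intro the_equality) auto
  obtain a b where ab: "a \<in> range L" "b \<in> annihilator p Z" "y = a + b" using ds(4) by blast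
  then have "y - a \<in> annihilator p Z" by simp
  with eq[OF ab(1)] ab(1) show "proj_along (range L) (annihilator p Z) y \<in> range L"
    "y - proj_along (range L) (annihilator p Z) y \<in> annihilator p Z" by auto
  show "y \<in> range L \<Longrightarrow> proj_along (range L) (annihilator p Z) y = y"
    using eq[of y] subspace_0[OF ds(2)] by simp
  show "y \<in> annihilator p Z \<Longrightarrow> proj_along (range L) (annihilator p Z) y = 0"
    using eq[of 0] subspace_0[OF ds(1)] by simp
qed

lemma bounded_linear_range_proj: "bounded_linear (proj_along (range L) (annihilator p Z))"
  using splitting unfolding compatible_splitting_def topological_splitting_def by blast

lemma range_proj_eq_0_imp: "proj_along (range L) (annihilator p Z) y = 0 \<Longrightarrow> y \<in> annihilator p Z"
  using range_proj(2)[of y] by simp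

lemma L_kernel_proj: "L (kernel_proj x) = 0"
  using kernel_proj_in[of x] by (simp add: null_space_def)

text \<open>The projection to the range followed by the inverse of \<open>L\<close> on
  \<open>Z\<close>. It is bounded since the closed range admits preimages of controlled norm, and
  subtracting the kernel part of a preimage moves it continuously into \<open>Z\<close>.\<close>

lemma ex_partial_inverse:
  obtains P :: "'y \<Rightarrow>\<^sub>L 'x" where "\<And>z. z \<in> Z \<Longrightarrow> blinfun_apply P (L z) = z"
    "\<And>y. y \<in> annihilator p Z \<Longrightarrow> blinfun_apply P y = 0"
proof -
  interpret L: bounded_linear L by (rule bounded_linear_L)
  interpret K: bounded_linear kernel_proj by (rule bounded_linear_kernel_proj)
  define R where "R = proj_along (range L) (annihilator p Z)"
  interpret R: bounded_linear R unfolding R_def by (rule bounded_linear_range_proj)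
  have inj: "z = z'" if "z \<in> Z" "z' \<in> Z" "L z = L z'" for z z'
  proof -
    have "z - z' \<in> Z" using subspace_Z that by (intro subspace_diff)
    moreover have "z - z' \<in> null_space L" using that(3) by (simp add: null_space_def L.diff)
    ultimately have "z - z' = 0" using kernel_proj_id kernel_proj_Z by metis
    then show ?thesis by simp
  qed
  obtain C where C: "\<And>y. y \<in> range L \<Longrightarrow> \<exists>x. L x = y \<and> norm x \<le> C * norm y"
    using bounded_linear_bounded_preimage[OF bounded_linear_L] fredholm by (auto simp: fredholm_def)
  have "\<exists>z. z \<in> Z \<and> L z = R y \<and> norm z \<le> norm y * ((1 + onorm kernel_proj) * (\<bar>C\<bar> * onorm R))" for y
  proof -
    obtain x where x: "L x = R y" "norm x \<le> C * norm (R y)"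
      using C[of "R y"] range_proj(1) by (auto simp: R_def)
    define z where "z = x - kernel_proj x"
    have "norm z \<le> norm x + onorm kernel_proj * norm x"
      unfolding z_def using norm_triangle_ineq4[of x "kernel_proj x"] onorm[OF bounded_linear_kernel_proj, of x]
      by linarith
    also have "\<dots> = (1 + onorm kernel_proj) * norm x" by (simp add: algebra_simps)
    also have "norm x \<le> \<bar>C\<bar> * (onorm R * norm y)"
    proof -
      have "norm x \<le> \<bar>C\<bar> * norm (R y)"
        using x(2) mult_right_mono[OF abs_ge_self[of C] norm_ge_zero[of "R y"]] by linarith
      also have "\<dots> \<le> \<bar>C\<bar> * (onorm R * norm y)"
        by (intro mult_left_mono onorm R.bounded_linear_axioms) auto
      finally show ?thesis .
    qed
    finally have "norm z \<le> (1 + onorm kernel_proj) * (\<bar>C\<bar> * (onorm R * norm y))"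
      using onorm_pos_le[OF bounded_linear_kernel_proj] by (simp add: mult_left_mono)
    moreover have "L z = R y" using x(1) by (simp add: z_def L.diff L_kernel_proj)
    moreover have "z \<in> Z" unfolding z_def by (rule minus_kernel_proj)
    ultimately show ?thesis by (auto simp: mult_ac)
  qed
  then obtain f where f: "\<And>y. f y \<in> Z" "\<And>y. L (f y) = R y"
    "\<And>y. norm (f y) \<le> norm y * ((1 + onorm kernel_proj) * (\<bar>C\<bar> * onorm R))" by metis
  have "bounded_linear f"
  proof (rule bounded_linear_intro)
    show "f (x + y) = f x + f y" for x y
      by (rule inj) (use f subspace_Z in \<open>auto simp: L.add R.add intro: subspace_add\<close>)
    show "f (c *\<^sub>R x) = c *\<^sub>R f x" for c x
      by (rule inj) (use f subspace_Z in \<open>auto simp: L.scaleR R.scaleR intro: subspace_scale\<close>)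
  qed (rule f)
  moreover have "f (L z) = z" if "z \<in> Z" for z
    by (rule inj) (use f that range_proj(3)[of "L z"] in \<open>auto simp: R_def\<close>)
  moreover have "f y = 0" if "y \<in> annihilator p Z" for y
    by (rule inj) (use f range_proj(4)[OF that] subspace_0[OF subspace_Z] in \<open>auto simp: R_def L.zero\<close>)
  ultimately show ?thesis using that[of "Blinfun f"] by (simp add: bounded_linear_Blinfun_apply)
qed

end

text \<open>Extends a map that is analytic on a subspace only to an analytic map on the whole space,
  by precomposing with a projection.\<close>

lemma real_analytic_at_compose_linear:
  fixes \<psi> :: "'a::real_normed_vector \<Rightarrow> 'b::real_normed_vector"
    and P :: "'c::real_normed_vector \<Rightarrow> 'a"
  assumes "real_analytic_at V \<psi> 0" "bounded_linear P" "\<And>x. P x \<in> V"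
  shows "real_analytic_at UNIV (\<lambda>x. \<psi> (P x)) 0"
proof -
  interpret P: bounded_linear P by fact
  obtain r m c where "0 < r \<and> (\<forall>n. bounded_multilinear_on V n (m n) (c n)) \<and>
      summable (\<lambda>n. c n * r ^ n) \<and>
      (\<forall>h\<in>V. norm h < r \<longrightarrow> (\<lambda>n. m n (replicate n h)) sums \<psi> (0 + h))"
    using assms(1) unfolding real_analytic_at_def by blast
  then have r: "0 < r" "\<And>n. bounded_multilinear_on V n (m n) (c n)" "summable (\<lambda>n. c n * r ^ n)"
    "\<And>h. h \<in> V \<Longrightarrow> norm h < r \<Longrightarrow> (\<lambda>n. m n (replicate n h)) sums \<psi> h" by auto
  have c: "0 \<le> c n" for n using r(2)[of n] unfolding bounded_multilinear_on_def by blast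
  obtain K where K: "0 < K" "\<And>x. norm (P x) \<le> norm x * K" using P.pos_bounded by blast
  define q where "q n xs = m n (map P xs)" for n xs
  have q: "bounded_multilinear_on UNIV n (q n) (c n * K ^ n)" for n
    unfolding bounded_multilinear_on_def
  proof (intro conjI allI impI)
    show "0 \<le> c n * K ^ n" using c K(1) by simp
  next
    fix xs :: "'c list" and i assume xs: "length xs = n \<and> set xs \<subseteq> UNIV" and i: "i < n"
    have "linear_map_on V (\<lambda>y. m n ((map P xs)[i := y]))"
      using r(2)[of n] xs i assms(3) unfolding bounded_multilinear_on_def by (auto simp: image_subset_iff)
    then show "linear_map_on UNIV (\<lambda>y. q n (xs[i := y]))"
      using assms(3) unfolding linear_map_on_def q_def by (simp add: map_update P.add P.scaleR)
  next
    fix xs :: "'c list" assume xs: "length xs = n \<and> set xs \<subseteq> UNIV"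
    have "length (map P xs) = n \<and> set (map P xs) \<subseteq> V" using xs assms(3) by auto
    then have "norm (q n xs) \<le> c n * prod_list (map norm (map P xs))"
      using r(2)[of n] unfolding bounded_multilinear_on_def q_def by blast
    also have "\<dots> \<le> c n * prod_list (map (\<lambda>x. norm (norm x * K)) xs)"
      using prod_list_norm_mono[of xs P "\<lambda>x. norm x * K"] K c
      by (intro mult_left_mono) (auto simp: comp_def)
    also have "prod_list (map (\<lambda>x. norm (norm x * K)) xs) = K ^ length xs * prod_list (map norm xs)"
      using K(1) by (induction xs) (auto simp: abs_mult mult_ac)
    finally show "norm (q n xs) \<le> c n * K ^ n * prod_list (map norm xs)" using xs by (simp add: mult_ac)
  qed
  have "(\<lambda>n. c n * K ^ n * (r / K) ^ n) = (\<lambda>n. c n * r ^ n)" using K(1) by (simp add: power_divide)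
  then have "summable (\<lambda>n. c n * K ^ n * (r / K) ^ n)" using r(3) by (simp only:)
  moreover have "(\<lambda>n. q n (replicate n h)) sums \<psi> (P (0 + h))" if "norm h < r / K" for h
  proof -
    have "norm h * K < r" using that K(1) by (simp add: pos_less_divide_eq)
    then show ?thesis using r(4)[OF assms(3), of h] K(2)[of h] by (simp add: q_def map_replicate)
  qed
  ultimately show ?thesis unfolding real_analytic_at_def
    using r(1) K(1) q by (intro exI[of _ "r / K"] conjI exI[of _ q] exI[of _ "\<lambda>n. c n * K ^ n"]) auto
qed

lemma eventually_compose_bounded_linear:
  assumes "eventually Q (nhds 0)" "bounded_linear h"
  shows "\<forall>\<^sub>F x in nhds 0. Q (h x)"
proof -
  interpret bounded_linear h by fact
  have "(h \<longlongrightarrow> h 0) (nhds 0)"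
    using tendsto[OF tendsto_ident_at, of 0 UNIV] by (simp add: tendsto_nhds_iff)
  then show ?thesis using assms(1) zero by (simp add: filterlim_iff)
qed

context ls_splitting
begin

text \<open>The derivative \<open>T\<close> at 0 vanishes because its values lie in
  \<open>Z\<close>, where \<open>\<psi>\<close> takes its values, and also in the kernel, by
  differentiating the defining equation.\<close>

lemma lyapunov_schmidt_germ_properties:
  assumes "lyapunov_schmidt_germ p M L Z \<psi>" "(M has_derivative L) (at 0)"
  defines "\<Psi> \<equiv> \<lambda>x. \<psi> (kernel_proj x)"
  shows "real_analytic_at UNIV \<Psi> 0" "\<Psi> 0 = 0" "(\<Psi> has_derivative (\<lambda>_. 0)) (at 0)"
    "\<forall>\<^sub>F x in nhds 0. \<Psi> x \<in> Z \<and> M (kernel_proj x + \<Psi> x) \<in> annihilator p Z"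
proof -
  interpret L: bounded_linear L by (rule bounded_linear_L)
  interpret P: bounded_linear kernel_proj by (rule bounded_linear_kernel_proj)
  define R where "R = proj_along (range L) (annihilator p Z)"
  interpret R: bounded_linear R unfolding R_def by (rule bounded_linear_range_proj)
  obtain W where W: "0 \<in> W" "real_analytic_on (null_space L) \<psi> W"
    "\<And>x. x \<in> W \<Longrightarrow> \<psi> x \<in> Z \<and> R (M (x + \<psi> x)) = 0" and \<psi>0: "\<psi> 0 = 0"
    using assms(1) unfolding lyapunov_schmidt_germ_def R_def by blast
  show an: "real_analytic_at UNIV \<Psi> 0" unfolding \<Psi>_def
    using W(1,2) kernel_proj_in bounded_linear_kernel_proj
    by (intro real_analytic_at_compose_linear[of "null_space L"]) (auto simp: real_analytic_on_def)
  show \<Psi>0: "\<Psi> 0 = 0" by (simp add: \<Psi>_def P.zero \<psi>0)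
  obtain S where S: "open S" "W = null_space L \<inter> S"
    using W(2) unfolding real_analytic_on_def openin_open by blast
  have "eventually (\<lambda>x. x \<in> S) (nhds 0)" using S W(1) by (intro eventually_nhds_in_open) auto
  then have "\<forall>\<^sub>F x in nhds 0. kernel_proj x \<in> S"
    by (rule eventually_compose_bounded_linear[OF _ bounded_linear_kernel_proj])
  then have ev: "\<forall>\<^sub>F x in nhds 0. \<Psi> x \<in> Z \<and> R (M (kernel_proj x + \<Psi> x)) = 0"
    by eventually_elim (use W(3) S(2) kernel_proj_in in \<open>auto simp: \<Psi>_def\<close>)
  then show "\<forall>\<^sub>F x in nhds 0. \<Psi> x \<in> Z \<and> M (kernel_proj x + \<Psi> x) \<in> annihilator p Z"
    by eventually_elim (use range_proj_eq_0_imp in \<open>auto simp: R_def\<close>)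
  obtain D r where D: "real_analytic_at UNIV D 0" "0 < r"
    "\<And>x y. norm x < r \<Longrightarrow> norm y < r \<Longrightarrow> \<Psi> y - \<Psi> x = blinfun_apply (D (x, y)) (y - x)"
    using an by (rule real_analytic_difference_quotient) blast
  define T where "T = blinfun_apply (D (0, 0))"
  have T: "(\<Psi> has_derivative T) (at 0)"
    unfolding T_def using eventually_nhds_x_imp_x[OF real_analytic_has_derivative_diagonal[OF D]] .
  have "((\<lambda>x. kernel_proj (\<Psi> x)) has_derivative (\<lambda>x. kernel_proj (T x))) (at 0)"
    by (rule P.has_derivative[OF T])
  moreover have "((\<lambda>x. kernel_proj (\<Psi> x)) has_derivative (\<lambda>x. 0)) (at 0)"
  proof (rule has_derivative_transform_eventually[OF has_derivative_const])
    have "\<forall>\<^sub>F x in nhds 0. 0 = kernel_proj (\<Psi> x)"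
      using ev by eventually_elim (simp add: kernel_proj_Z)
    then show "\<forall>\<^sub>F x in at 0. 0 = kernel_proj (\<Psi> x)"
      by (simp add: eventually_at_filter eventually_mono)
  qed (auto simp: \<Psi>0 P.zero)
  ultimately have PT: "kernel_proj (T x) = 0" for x
    using has_derivative_unique by (metis (no_types))
  \<comment> \<open>Differentiating the projected equation gives \<open>R (L (T x)) = 0\<close>, and
    \<open>R\<close> is the identity on the range.\<close>
  have "((\<lambda>x. kernel_proj x + \<Psi> x) has_derivative (\<lambda>x. kernel_proj x + T x)) (at 0)"
    by (intro has_derivative_add T bounded_linear_imp_has_derivative bounded_linear_kernel_proj)
  then have "((\<lambda>x. M (kernel_proj x + \<Psi> x)) has_derivative (\<lambda>x. L (kernel_proj x + T x))) (at 0)"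
    by (rule has_derivative_compose) (use assms(2) \<Psi>0 in \<open>simp add: P.zero\<close>)
  then have "((\<lambda>x. R (M (kernel_proj x + \<Psi> x))) has_derivative (\<lambda>x. R (L (kernel_proj x + T x)))) (at 0)"
    by (rule R.has_derivative)
  moreover have "((\<lambda>x. R (M (kernel_proj x + \<Psi> x))) has_derivative (\<lambda>x. 0)) (at 0)"
  proof (rule has_derivative_transform_eventually[OF has_derivative_const])
    have "\<forall>\<^sub>F x in nhds 0. 0 = R (M (kernel_proj x + \<Psi> x))"
      using ev by eventually_elim simp
    then show "\<forall>\<^sub>F x in at 0. 0 = R (M (kernel_proj x + \<Psi> x))"
      by (simp add: eventually_at_filter eventually_mono)
    show "0 = R (M (kernel_proj 0 + \<Psi> 0))" using eventually_nhds_x_imp_x[OF ev] by simp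
  qed auto
  ultimately have "R (L (kernel_proj x + T x)) = 0" for x
    using has_derivative_unique by (metis (no_types))
  then have "L (T x) = 0" for x
    using range_proj(3)[of "L (T x)"] by (simp add: R_def L.add L_kernel_proj)
  then have "T x = 0" for x
    using PT[of x] kernel_proj_id[of "T x"] by (simp add: null_space_def)
  then have "T = (\<lambda>_. 0)" by auto
  with T show "(\<Psi> has_derivative (\<lambda>_. 0)) (at 0)" by simp
qed

end

section \<open>Second differences of the energy\<close>

text \<open>With \<open>Q\<close> the difference quotient of the difference quotient D of a
  function, this is the bilinear form behind \<open>D (x, y) - D (x, x)\<close>: only the second
  point of the pair moves, hence the 0 in \<open>(0, a)\<close>.\<close>

definition second_difference ::
    "(('x \<times> 'x) \<times> ('x \<times> 'x) \<Rightarrow> ('x \<times> 'x) \<Rightarrow>\<^sub>L ('x \<Rightarrow>\<^sub>L real)) \<Rightarrow>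
      'x::real_normed_vector \<Rightarrow> 'x \<Rightarrow> 'x \<Rightarrow> 'x \<Rightarrow> real" where
  "second_difference Q x y a b = blinfun_apply (blinfun_apply (Q ((x, x), (x, y))) (0, a)) b"

lemma second_difference_bilinear: "bounded_bilinear (second_difference Q x y)"
proof
  show "second_difference Q x y (a + a') b = second_difference Q x y a b + second_difference Q x y a' b" for a a' b
    using blinfun.add_right[of "Q ((x, x), (x, y))" "(0, a)" "(0, a')"]
    by (simp add: second_difference_def blinfun.add_left)
  show "second_difference Q x y a (b + b') = second_difference Q x y a b + second_difference Q x y a b'" for a b b'
    by (simp add: second_difference_def blinfun.add_right)
  show "second_difference Q x y (r *\<^sub>R a) b = r *\<^sub>R second_difference Q x y a b" for r a b
    using blinfun.scaleR_right[of "Q ((x, x), (x, y))" r "(0, a)"]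
    by (simp add: second_difference_def blinfun.scaleR_left)
  show "second_difference Q x y a (r *\<^sub>R b) = r *\<^sub>R second_difference Q x y a b" for r a b
    by (simp add: second_difference_def blinfun.scaleR_right)
  have "norm (second_difference Q x y a b) \<le> norm a * norm b * norm (Q ((x, x), (x, y)))" for a b
  proof -
    have "norm (second_difference Q x y a b) \<le> norm (blinfun_apply (Q ((x, x), (x, y))) (0, a)) * norm b"
      unfolding second_difference_def by (rule norm_blinfun)
    also have "\<dots> \<le> (norm (Q ((x, x), (x, y))) * norm (0::'a, a)) * norm b"
      by (intro mult_right_mono norm_blinfun) auto
    finally show ?thesis by (simp add: norm_Pair mult_ac)
  qed
  then show "\<exists>K. \<forall>a b. norm (second_difference Q x y a b) \<le> norm a * norm b * K" by blast
qed

lemma analytic_germ_second_difference: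
  fixes x y a b :: "('i \<Rightarrow> real) \<Rightarrow> 'x::banach"
  assumes "real_analytic_at UNIV Q 0" "analytic_germ x" "x (\<lambda>_. 0) = 0" "analytic_germ y" "y (\<lambda>_. 0) = 0"
    "analytic_germ a" "analytic_germ b"
  shows "analytic_germ (\<lambda>t. second_difference Q (x t) (y t) (a t) (b t))"
  unfolding second_difference_def
  by (intro analytic_germ_blinfun_apply analytic_germ_comp[OF assms(1)] analytic_germ_Pair
      analytic_germ_const assms(2,4,6,7)) (simp add: assms zero_prod_def)

text \<open>An exact second-order Taylor formula whose remainder is a bilinear form depending
  analytically on both endpoints. The first-order term is the diagonal value of the first quotient,
  which uniqueness of derivatives identifies with \<open>p (M x)\<close>.\<close>

lemma ex_second_difference:
  fixes p :: "'y::real_normed_vector \<Rightarrow> 'x::banach \<Rightarrow> real"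
  assumes "open U" "0 \<in> U" "real_analytic_at UNIV E 0"
    and dE: "\<And>x. x \<in> U \<Longrightarrow> (E has_derivative (\<lambda>v. p (M x) v)) (at x)"
  shows "\<exists>Q r. real_analytic_at UNIV Q 0 \<and> 0 < r \<and> (\<forall>x y. norm x < r \<longrightarrow> norm y < r \<longrightarrow>
    E y - E x = p (M x) (y - x) + second_difference Q x y (y - x) (y - x))"
proof -
  obtain D r where D: "real_analytic_at UNIV D 0" "0 < r"
    "\<And>x y. norm x < r \<Longrightarrow> norm y < r \<Longrightarrow> E y - E x = blinfun_apply (D (x, y)) (y - x)"
    using assms(3) by (rule real_analytic_difference_quotient) blast
  obtain Q s where Q: "real_analytic_at UNIV Q 0" "0 < s"
    "\<And>z w. norm z < s \<Longrightarrow> norm w < s \<Longrightarrow> D w - D z = blinfun_apply (Q (z, w)) (w - z)"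
    using D(1) by (rule real_analytic_difference_quotient) blast
  have "\<forall>\<^sub>F x in nhds 0. (E has_derivative blinfun_apply (D (x, x))) (at x)"
    by (rule real_analytic_has_derivative_diagonal[OF D])
  with eventually_nhds_in_open[OF assms(1,2)]
  have "\<forall>\<^sub>F x in nhds 0. x \<in> U \<and> (E has_derivative blinfun_apply (D (x, x))) (at x)"
    by eventually_elim simp
  then have "\<forall>\<^sub>F x in nhds 0. blinfun_apply (D (x, x)) = p (M x)"
  proof eventually_elim
    case (elim x)
    then show ?case using has_derivative_unique[OF _ dE[of x]] by blast
  qed
  then obtain q where q: "0 < q" "\<And>x. norm x < q \<Longrightarrow> blinfun_apply (D (x, x)) = p (M x)"
    unfolding eventually_nhds_metric by auto
  define \<rho> where "\<rho> = min q (min r (s / 2))"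
  have \<rho>: "0 < \<rho>" "\<rho> \<le> q" "\<rho> \<le> r" "2 * \<rho> \<le> s" using q(1) D(2) Q(2) by (auto simp: \<rho>_def)
  have "E y - E x = p (M x) (y - x) + second_difference Q x y (y - x) (y - x)"
    if "norm x < \<rho>" "norm y < \<rho>" for x y
  proof -
    have "norm (x, x) < s" "norm (x, y) < s"
      using norm_Pair_le[of x x] norm_Pair_le[of x y] that \<rho> by linarith+
    then have eq: "D (x, y) = D (x, x) + blinfun_apply (Q ((x, x), (x, y))) (0, y - x)"
      using Q(3)[of "(x, x)" "(x, y)"] by (simp add: algebra_simps)
    have "E y - E x = blinfun_apply (D (x, y)) (y - x)" using D(3)[of x y] that \<rho> by simp
    also have "\<dots> = p (M x) (y - x) + second_difference Q x y (y - x) (y - x)"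
      unfolding eq second_difference_def using q(2)[of x] that \<rho> by (simp add: blinfun.add_left)
    finally show ?thesis .
  qed
  then show ?thesis using Q(1) \<rho>(1) by blast
qed

lemma second_difference_tendsto:
  fixes Q :: "('x::banach \<times> 'x) \<times> ('x \<times> 'x) \<Rightarrow> ('x \<times> 'x) \<Rightarrow>\<^sub>L ('x \<Rightarrow>\<^sub>L real)"
  assumes "real_analytic_at UNIV Q 0"
  shows "((\<lambda>\<tau>. second_difference Q (\<tau> *\<^sub>R x) (\<tau> *\<^sub>R y) a b) \<longlongrightarrow> second_difference Q 0 0 a b) (at 0)"
proof -
  have "((\<lambda>\<tau>::real. ((\<tau> *\<^sub>R x, \<tau> *\<^sub>R x), (\<tau> *\<^sub>R x, \<tau> *\<^sub>R y))) \<longlongrightarrow>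
      ((0 *\<^sub>R x, 0 *\<^sub>R x), (0 *\<^sub>R x, 0 *\<^sub>R y))) (at 0)"
    by (intro tendsto_intros)
  then have "((\<lambda>\<tau>::real. ((\<tau> *\<^sub>R x, \<tau> *\<^sub>R x), (\<tau> *\<^sub>R x, \<tau> *\<^sub>R y))) \<longlongrightarrow> 0) (at 0)"
    by (simp add: zero_prod_def)
  with real_analytic_at_tendsto[OF assms]
  have "((\<lambda>\<tau>. Q ((\<tau> *\<^sub>R x, \<tau> *\<^sub>R x), (\<tau> *\<^sub>R x, \<tau> *\<^sub>R y))) \<longlongrightarrow> Q 0) (at 0)"
    by (rule filterlim_compose)
  then show ?thesis unfolding second_difference_def
    by (intro blinfun.tendsto tendsto_const) (simp_all add: zero_prod_def)
qed

text \<open>\<open>second_difference Q 0 0\<close> need not be symmetric, but its symmetrization is the Hessian of \<open>E\<close>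
  at \<open>0\<close>, whose radical contains the kernel of \<open>L\<close>: compare the quadratic parts of \<open>E\<close> at \<open>k + v\<close>,
  \<open>k\<close> and \<open>v\<close>.\<close>

lemma second_difference_kernel:
  fixes p :: "'y::real_normed_vector \<Rightarrow> 'x::banach \<Rightarrow> real"
  assumes "bounded_bilinear p" and Q: "real_analytic_at UNIV Q 0" "0 < r"
    "\<And>x y. norm x < r \<Longrightarrow> norm y < r \<Longrightarrow>
      E y - E x = p (M x) (y - x) + second_difference Q x y (y - x) (y - x)"
    and M: "(M has_derivative L) (at 0)" "\<And>v. p (M 0) v = 0" and k: "L k = 0"
  shows "second_difference Q 0 0 k v + second_difference Q 0 0 v k = 0"
proof -
  interpret p: bounded_bilinear p by fact
  interpret e: bounded_bilinear "second_difference Q x y" for x y by (rule second_difference_bilinear)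
  have small: "\<forall>\<^sub>F \<tau> in at 0. norm (\<tau> *\<^sub>R w) < r" for w :: 'x
  proof -
    have "((\<lambda>\<tau>. norm (\<tau> *\<^sub>R w)) \<longlongrightarrow> norm (0 *\<^sub>R w)) (at 0)" by (intro tendsto_intros)
    then show ?thesis by (rule order_tendstoD(2)) (simp add: Q(2))
  qed
  \<comment> \<open>The energy at \<open>\<tau> *\<^sub>R (k + v)\<close> is reached directly and by
    way of \<open>\<tau> *\<^sub>R k\<close>; the two expressions are divided by
    \<open>\<tau>\<^sup>2\<close>.\<close>
  have ev: "\<forall>\<^sub>F \<tau> in at 0. second_difference Q (\<tau> *\<^sub>R 0) (\<tau> *\<^sub>R k) k k + p (M (\<tau> *\<^sub>R k)) v / \<tau> +
      second_difference Q (\<tau> *\<^sub>R k) (\<tau> *\<^sub>R (k + v)) v v =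
      second_difference Q (\<tau> *\<^sub>R 0) (\<tau> *\<^sub>R (k + v)) (k + v) (k + v)"
    using small[of "k + v"] small[of k] eventually_neq_at_within[of 0]
  proof eventually_elim
    case (elim \<tau>)
    have 1: "E (\<tau> *\<^sub>R w) - E 0 = \<tau>\<^sup>2 * second_difference Q 0 (\<tau> *\<^sub>R w) w w" if "norm (\<tau> *\<^sub>R w) < r" for w
      using Q(3)[of 0 "\<tau> *\<^sub>R w"] Q(2) that
      by (simp add: M(2) e.scaleR_left e.scaleR_right power2_eq_square)
    have "\<tau> *\<^sub>R (k + v) - \<tau> *\<^sub>R k = \<tau> *\<^sub>R v" by (simp add: scaleR_add_right)
    then have 2: "E (\<tau> *\<^sub>R (k + v)) - E (\<tau> *\<^sub>R k) =
        \<tau> * p (M (\<tau> *\<^sub>R k)) v + \<tau>\<^sup>2 * second_difference Q (\<tau> *\<^sub>R k) (\<tau> *\<^sub>R (k + v)) v v"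
      using Q(3)[of "\<tau> *\<^sub>R k" "\<tau> *\<^sub>R (k + v)"] elim
      by (simp add: p.scaleR_right e.scaleR_left e.scaleR_right power2_eq_square)
    have "\<tau>\<^sup>2 * second_difference Q 0 (\<tau> *\<^sub>R (k + v)) (k + v) (k + v) =
        \<tau>\<^sup>2 * (second_difference Q 0 (\<tau> *\<^sub>R k) k k + p (M (\<tau> *\<^sub>R k)) v / \<tau> +
          second_difference Q (\<tau> *\<^sub>R k) (\<tau> *\<^sub>R (k + v)) v v)"
      using 1[of "k + v"] 1[of k] 2 elim by (simp add: distrib_left power2_eq_square)
    then show ?case using elim by simp
  qed
  \<comment> \<open>The cross term survives division by \<tau> only through \<open>L k\<close>,
    which is 0.\<close>
  have "((\<lambda>\<tau>. p (M (\<tau> *\<^sub>R k)) v / \<tau>) \<longlongrightarrow> 0) (at 0)"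
  proof -
    have "((\<lambda>\<tau>::real. \<tau> *\<^sub>R k) has_derivative (\<lambda>\<tau>. \<tau> *\<^sub>R k)) (at 0)"
      by (rule bounded_linear_imp_has_derivative[OF bounded_linear_scaleR_left])
    from has_derivative_compose[OF this, of M L] M(1)
    have "((\<lambda>\<tau>. M (\<tau> *\<^sub>R k)) has_derivative (\<lambda>\<tau>. L (\<tau> *\<^sub>R k))) (at 0)" by simp
    moreover have "L (\<tau> *\<^sub>R k) = 0" for \<tau>
      using has_derivative_bounded_linear[OF M(1)] k by (simp add: linear_simps)
    ultimately have "((\<lambda>\<tau>. M (\<tau> *\<^sub>R k)) has_derivative (\<lambda>\<tau>. 0)) (at 0)" by simp
    from bounded_linear.has_derivative[OF p.bounded_linear_left[of v] this]
    have "((\<lambda>\<tau>. p (M (\<tau> *\<^sub>R k)) v) has_real_derivative 0) (at 0)"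
      by (simp add: has_field_derivative_def p.zero_left lambda_zero)
    then show ?thesis unfolding DERIV_def by (simp add: M(2))
  qed
  then have "((\<lambda>\<tau>. second_difference Q (\<tau> *\<^sub>R 0) (\<tau> *\<^sub>R k) k k + p (M (\<tau> *\<^sub>R k)) v / \<tau> +
      second_difference Q (\<tau> *\<^sub>R k) (\<tau> *\<^sub>R (k + v)) v v) \<longlongrightarrow>
      second_difference Q 0 0 k k + 0 + second_difference Q 0 0 v v) (at 0)"
    by (intro tendsto_add second_difference_tendsto[OF Q(1)])
  then have "((\<lambda>\<tau>. second_difference Q (\<tau> *\<^sub>R 0) (\<tau> *\<^sub>R (k + v)) (k + v) (k + v)) \<longlongrightarrow>
      second_difference Q 0 0 k k + 0 + second_difference Q 0 0 v v) (at 0)"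
    using ev by (rule Lim_transform_eventually)
  then have "second_difference Q 0 0 (k + v) (k + v) = second_difference Q 0 0 k k + 0 + second_difference Q 0 0 v v"
    using second_difference_tendsto[OF Q(1), of 0 "k + v" "k + v" "k + v"]
    by (intro tendsto_unique[of "at (0::real)"]) auto
  then show ?thesis by (simp add: e.add_left e.add_right)
qed

section \<open>Properties that hold near 0, along germs and on coordinate sections\<close>

lemma eventually_tendsto_0:
  assumes "analytic_germ f" "f (\<lambda>_. 0) = 0" "eventually P (nhds 0)"
  shows "\<forall>\<^sub>F t in polydisc_filter. P (f t)"
  using analytic_germ_tendsto[OF assms(1)] assms(2,3) by (auto simp: filterlim_iff)

lemma eventually_norm_less_nhds_0: "0 < r \<Longrightarrow> \<forall>\<^sub>F x in nhds 0. norm x < r"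
  unfolding eventually_nhds_metric by (intro exI[of _ r]) auto

text \<open>A function vanishing on a section that contains a coordinate axis has derivative 0 along
  it. This verifies the derivative hypothesis of the implicit function theorem without
  differentiating in the matrix entries.\<close>

lemma has_vector_derivative_0_of_section:
  fixes F :: "('l \<Rightarrow> real) \<Rightarrow> 'b::real_normed_vector"
  assumes "\<forall>\<^sub>F T in polydisc_filter. R T \<longrightarrow> F T = 0" "\<And>\<tau>. R ((\<lambda>_. 0)(l := \<tau>))"
  shows "((\<lambda>\<tau>. F ((\<lambda>_. 0)(l := \<tau>))) has_vector_derivative 0) (at 0)"
proof -
  obtain \<rho> where \<rho>: "0 < \<rho>" "\<And>T. (\<And>i. \<bar>T i\<bar> \<le> \<rho>) \<Longrightarrow> R T \<longrightarrow> F T = 0"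
    using assms(1) unfolding eventually_polydisc_filter by blast
  have F0: "F ((\<lambda>_. 0)(l := \<tau>)) = 0" if "\<bar>\<tau>\<bar> < \<rho>" for \<tau>
    using \<rho>(2)[of "(\<lambda>_. 0)(l := \<tau>)"] \<rho>(1) assms(2)[of \<tau>] that by simp
  show ?thesis unfolding has_vector_derivative_def
  proof (rule has_derivative_transform_eventually[of "\<lambda>_. 0"])
    show "\<forall>\<^sub>F \<tau> in at 0. 0 = F ((\<lambda>_. 0)(l := \<tau>))"
      using F0 \<rho>(1) unfolding eventually_at by (intro exI[of _ \<rho>]) (auto simp: dist_norm)
    show "0 = F ((\<lambda>_. 0)(l := 0))" using F0[of 0] \<rho>(1) by simp
  qed auto
qed

section \<open>Comparison of two reductions\<close>

locale ls_splitting_pair =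
  S0: ls_splitting p L Z0 B + S1: ls_splitting p L Z1 B
  for p :: "'y::banach \<Rightarrow> 'x::banach \<Rightarrow> real" and L :: "'x \<Rightarrow> 'y" and Z0 Z1 B :: "'x set" +
  fixes U :: "'x set" and E :: "'x \<Rightarrow> real" and M :: "'x \<Rightarrow> 'y" and \<psi>0 \<psi>1 :: "'x \<Rightarrow> 'x"
  assumes open_U: "open U" and zero_U: "0 \<in> U"
    and E_analytic: "real_analytic_at UNIV E 0" and M_analytic: "real_analytic_at UNIV M 0"
    and dE0: "(E has_derivative (\<lambda>v. 0)) (at 0)"
    and dE: "\<And>x. x \<in> U \<Longrightarrow> (E has_derivative (\<lambda>v. p (M x) v)) (at x)"
    and dM: "(M has_derivative L) (at 0)"
    and germ0: "lyapunov_schmidt_germ p M L Z0 \<psi>0" and germ1: "lyapunov_schmidt_germ p M L Z1 \<psi>1"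
begin

interpretation p: bounded_bilinear p by (rule S0.bilinear)
interpretation L: bounded_linear L by (rule S0.bounded_linear_L)
interpretation \<Pi>: bounded_linear S1.kernel_proj by (rule S1.bounded_linear_kernel_proj)

lemma pairing_M0: "p (M 0) v = 0"
  using has_derivative_unique[OF dE[OF zero_U] dE0] by metis

definition "\<Psi>0 x = \<psi>0 (S0.kernel_proj x)"
definition "\<Psi>1 x = \<psi>1 (S1.kernel_proj x)"

lemma \<Psi>0:
  shows "real_analytic_at UNIV \<Psi>0 0" "\<Psi>0 0 = 0" "(\<Psi>0 has_derivative (\<lambda>_. 0)) (at 0)"
    "\<forall>\<^sub>F x in nhds 0. \<Psi>0 x \<in> Z0 \<and> M (S0.kernel_proj x + \<Psi>0 x) \<in> annihilator p Z0"
  using S0.lyapunov_schmidt_germ_properties[OF germ0 dM] unfolding \<Psi>0_def[abs_def] by auto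

lemma \<Psi>1:
  shows "real_analytic_at UNIV \<Psi>1 0" "\<Psi>1 0 = 0" "(\<Psi>1 has_derivative (\<lambda>_. 0)) (at 0)"
    "\<forall>\<^sub>F x in nhds 0. \<Psi>1 x \<in> Z1 \<and> M (S1.kernel_proj x + \<Psi>1 x) \<in> annihilator p Z1"
  using S1.lyapunov_schmidt_germ_properties[OF germ1 dM] unfolding \<Psi>1_def[abs_def] by auto

text \<open>The letters are the coordinates \<open>Inl b\<close> of a point of the kernel and the entries \<open>Inr (i, j)\<close> of
  a matrix, the unknown of the implicit equation.\<close>

definition pt :: "('x + 'x \<times> 'x \<Rightarrow> real) \<Rightarrow> 'x" where "pt T = (\<Sum>b\<in>B. T (Inl b) *\<^sub>R b)"
definition x0 :: "('x + 'x \<times> 'x \<Rightarrow> real) \<Rightarrow> 'x" where "x0 T = pt T + \<Psi>0 (pt T)"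
definition \<eta> :: "('x + 'x \<times> 'x \<Rightarrow> real) \<Rightarrow> 'x" where "\<eta> T = S1.kernel_proj (x0 T)"
definition x1 :: "('x + 'x \<times> 'x \<Rightarrow> real) \<Rightarrow> 'x" where "x1 T = \<eta> T + \<Psi>1 (\<eta> T)"
definition grad :: "'x \<Rightarrow> ('x + 'x \<times> 'x \<Rightarrow> real) \<Rightarrow> real" where "grad j T = p (M (x0 T)) j"

lemma pt_in: "pt T \<in> null_space L"
  unfolding pt_def S0.span_basis[symmetric] by (intro span_sum span_scale span_base)

lemma pt_germ: "analytic_germ pt"
  unfolding pt_def by (intro analytic_germ_sum analytic_germ_scaleR analytic_germ_var analytic_germ_const)

lemma x0_germ: "analytic_germ x0"
  unfolding x0_def by (intro analytic_germ_add pt_germ analytic_germ_comp[OF \<Psi>0(1)]) (simp add: pt_def)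

lemma \<eta>_germ: "analytic_germ \<eta>"
  unfolding \<eta>_def by (intro analytic_germ_linear[OF S1.bounded_linear_kernel_proj] x0_germ)

text \<open>Over the origin of the kernel all these quantities vanish, whatever the matrix entries
  are.\<close>

lemma section_zero:
  assumes "\<And>b. T (Inl b) = 0"
  shows "pt T = 0" "x0 T = 0" "\<eta> T = 0" "x1 T = 0" "grad j T = 0"
proof -
  show pt: "pt T = 0" using assms by (simp add: pt_def)
  show x0: "x0 T = 0" by (simp add: x0_def pt \<Psi>0(2))
  show \<eta>: "\<eta> T = 0" by (simp add: \<eta>_def x0 \<Pi>.zero)
  show "x1 T = 0" by (simp add: x1_def \<eta> \<Psi>1(2))
  show "grad j T = 0" by (simp add: grad_def x0 pairing_M0)
qed

lemma x1_germ: "analytic_germ x1"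
  unfolding x1_def by (intro analytic_germ_add \<eta>_germ analytic_germ_comp[OF \<Psi>1(1)]) (simp add: section_zero)

lemma grad_germ: "analytic_germ (grad j)"
  unfolding grad_def
  by (intro analytic_germ_linear[OF p.bounded_linear_left] analytic_germ_comp[OF M_analytic] x0_germ)
    (simp add: section_zero)

text \<open>Expanding \<open>M (x0 T)\<close> in dual vectors reduces the Neumann series to the
  fixed right-hand sides \<open>P y_j\<close>, one for each basis vector; \<open>zz j\<close> solves
  the equation for the j-th of them. Over the origin the perturbation \<open>N\<close> is 0, whence
  the explicit value of \<open>zz j\<close> there.\<close>

lemma defect_factorization:
  obtains P :: "'y \<Rightarrow>\<^sub>L 'x" and zz :: "'x \<Rightarrow> ('x + 'x \<times> 'x \<Rightarrow> real) \<Rightarrow> 'x"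
  where "\<And>j. analytic_germ (zz j)"
    "\<forall>\<^sub>F T in polydisc_filter. \<forall>j\<in>B. (\<forall>b. T (Inl b) = 0) \<longrightarrow> zz j T = blinfun_apply P (S0.dual_vector j)"
    "\<forall>\<^sub>F T in polydisc_filter. x0 T - x1 T = (\<Sum>j\<in>B. grad j T *\<^sub>R zz j T)"
proof -
  obtain P :: "'y \<Rightarrow>\<^sub>L 'x" where P: "\<And>z. z \<in> Z1 \<Longrightarrow> blinfun_apply P (L z) = z"
    "\<And>y. y \<in> annihilator p Z1 \<Longrightarrow> blinfun_apply P y = 0"
    using S1.ex_partial_inverse by blast
  obtain D r where D: "real_analytic_at UNIV D 0" "0 < r"
    "\<And>x y. norm x < r \<Longrightarrow> norm y < r \<Longrightarrow> M y - M x = blinfun_apply (D (x, y)) (y - x)"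
    using M_analytic by (rule real_analytic_difference_quotient) blast
  have "blinfun_apply (D (0, 0)) = L"
    using eventually_nhds_x_imp_x[OF real_analytic_has_derivative_diagonal[OF D]] dM
    by (rule has_derivative_unique)
  then have DL: "D (0, 0) = Blinfun L"
    by (metis bounded_linear_Blinfun_apply S0.bounded_linear_L blinfun_apply_inject)
  define A where "A T = D (x1 T, x0 T)" for T
  \<comment> \<open>\<open>A T\<close> carries \<open>x0 - x1\<close> exactly to
    \<open>M x0 - M x1\<close>, so \<open>P L\<close> minus \<open>P A T\<close> measures how far
    the increment is from linear; it vanishes over the origin, where \<open>A T\<close> is
    \<open>L\<close>.\<close>
  define N where "N T = P o\<^sub>L (Blinfun L - A T)" for T
  have A0: "A T = Blinfun L" if "\<And>b. T (Inl b) = 0" for T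
    using section_zero[of T] that DL by (simp add: A_def)
  have A_germ: "analytic_germ A" unfolding A_def
    by (intro analytic_germ_comp[OF D(1)] analytic_germ_Pair x0_germ x1_germ) (simp add: section_zero zero_prod_def)
  have N_germ: "analytic_germ N" unfolding N_def
    by (intro analytic_germ_compose analytic_germ_const analytic_germ_diff A_germ)
  have N0: "N T = 0" if "\<And>b. T (Inl b) = 0" for T
    using A0[of T] that by (simp add: N_def)
  define R where "R j z \<longleftrightarrow> analytic_germ z \<and>
      (\<forall>\<^sub>F T in polydisc_filter. z T = blinfun_apply P (S0.dual_vector j) + blinfun_apply (N T) (z T))" for j z
  have "\<exists>z. R j z" for j
    unfolding R_def by (rule analytic_germ_neumann[OF N_germ _ analytic_germ_const]) (auto simp: N0)
  then obtain zz where "\<And>j. R j (zz j)" using choice[of R] by blast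
  then have zz: "\<And>j. analytic_germ (zz j)"
    "\<And>j. \<forall>\<^sub>F T in polydisc_filter. zz j T = blinfun_apply P (S0.dual_vector j) + blinfun_apply (N T) (zz j T)"
    unfolding R_def by blast+
  have zzB: "\<forall>\<^sub>F T in polydisc_filter. \<forall>j\<in>B. zz j T = blinfun_apply P (S0.dual_vector j) + blinfun_apply (N T) (zz j T)"
    by (rule eventually_ball_finite[OF S0.finite_basis]) (use zz(2) in blast)
  have Nsmall: "\<forall>\<^sub>F T in polydisc_filter. norm (N T) < 1 / 2"
    by (rule eventually_tendsto_0[OF N_germ _ eventually_norm_less_nhds_0]) (auto simp: N0)
  have x0r: "\<forall>\<^sub>F T in polydisc_filter. norm (x0 T) < r"
    by (rule eventually_tendsto_0[OF x0_germ _ eventually_norm_less_nhds_0]) (auto simp: section_zero D)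
  have x1r: "\<forall>\<^sub>F T in polydisc_filter. norm (x1 T) < r"
    by (rule eventually_tendsto_0[OF x1_germ _ eventually_norm_less_nhds_0]) (auto simp: section_zero D)
  have e0: "\<forall>\<^sub>F T in polydisc_filter. \<Psi>0 (pt T) \<in> Z0 \<and>
      M (S0.kernel_proj (pt T) + \<Psi>0 (pt T)) \<in> annihilator p Z0"
    by (rule eventually_tendsto_0[OF pt_germ _ \<Psi>0(4)]) (simp add: section_zero)
  have e1: "\<forall>\<^sub>F T in polydisc_filter. \<Psi>1 (\<eta> T) \<in> Z1 \<and>
      M (S1.kernel_proj (\<eta> T) + \<Psi>1 (\<eta> T)) \<in> annihilator p Z1"
    by (rule eventually_tendsto_0[OF \<eta>_germ _ \<Psi>1(4)]) (simp add: section_zero)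
  have "\<forall>\<^sub>F T in polydisc_filter. x0 T - x1 T = (\<Sum>j\<in>B. grad j T *\<^sub>R zz j T)"
    using zzB Nsmall x0r x1r e0 e1
  proof eventually_elim
    case (elim T)
    define z where "z = x0 T - x1 T"
    define \<zeta> where "\<zeta> = (\<Sum>j\<in>B. grad j T *\<^sub>R zz j T)"
    have M0: "M (x0 T) \<in> annihilator p Z0"
      using elim(5) S0.kernel_proj_id[OF pt_in] by (simp add: x0_def)
    have M1: "M (x1 T) \<in> annihilator p Z1"
      using elim(6) S1.kernel_proj_id[OF S1.kernel_proj_in] by (simp add: x1_def \<eta>_def)
    have "z = (x0 T - S1.kernel_proj (x0 T)) - \<Psi>1 (\<eta> T)" by (simp add: z_def x1_def \<eta>_def)
    then have zZ: "z \<in> Z1" using S1.subspace_Z S1.minus_kernel_proj elim(6) by (auto intro: subspace_diff)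
    have "blinfun_apply P (M (x0 T)) = blinfun_apply P (M (x0 T) - M (x1 T))"
      using P(2)[OF M1] by (simp add: blinfun.diff_right)
    also have "M (x0 T) - M (x1 T) = blinfun_apply (A T) z"
      using D(3)[of "x1 T" "x0 T"] elim by (simp add: A_def z_def)
    finally have "blinfun_apply P (M (x0 T)) + blinfun_apply (N T) z = blinfun_apply P (L z)"
      by (simp add: N_def blinfun.diff_left blinfun.diff_right bounded_linear_Blinfun_apply S0.bounded_linear_L)
    then have z_eq: "z = blinfun_apply P (M (x0 T)) + blinfun_apply (N T) z" using P(1)[OF zZ] by simp
    have "\<zeta> = (\<Sum>j\<in>B. grad j T *\<^sub>R (blinfun_apply P (S0.dual_vector j) + blinfun_apply (N T) (zz j T)))"
      unfolding \<zeta>_def using elim(1) by (intro sum.cong) auto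
    also have "\<dots> = blinfun_apply P (\<Sum>j\<in>B. grad j T *\<^sub>R S0.dual_vector j) + blinfun_apply (N T) \<zeta>"
      by (simp add: \<zeta>_def blinfun.sum_right blinfun.scaleR_right scaleR_add_right sum.distrib)
    also have "(\<Sum>j\<in>B. grad j T *\<^sub>R S0.dual_vector j) = M (x0 T)"
      unfolding grad_def by (rule S0.annihilator_expand[OF M0])
    finally have \<zeta>_eq: "\<zeta> = blinfun_apply P (M (x0 T)) + blinfun_apply (N T) \<zeta>" .
    \<comment> \<open>Both vectors satisfy the same affine equation and \<open>N T\<close> has norm
      below 1/2, so they coincide.\<close>
    have "z - \<zeta> = (blinfun_apply P (M (x0 T)) + blinfun_apply (N T) z) -
        (blinfun_apply P (M (x0 T)) + blinfun_apply (N T) \<zeta>)"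
      by (rule arg_cong2[where f = minus, OF z_eq \<zeta>_eq])
    also have "\<dots> = blinfun_apply (N T) (z - \<zeta>)" by (simp add: blinfun.diff_right)
    finally have "z - \<zeta> = blinfun_apply (N T) (z - \<zeta>)" .
    then have "norm (z - \<zeta>) \<le> norm (N T) * norm (z - \<zeta>)" by (metis norm_blinfun)
    also have "\<dots> \<le> 1 / 2 * norm (z - \<zeta>)" using elim(2) by (intro mult_right_mono) auto
    finally show ?case by (simp add: z_def \<zeta>_def)
  qed
  moreover have "\<forall>\<^sub>F T in polydisc_filter. \<forall>j\<in>B. (\<forall>b. T (Inl b) = 0) \<longrightarrow> zz j T = blinfun_apply P (S0.dual_vector j)"
    using zzB
  proof eventually_elim
    case (elim T)
    show ?case
    proof (intro ballI impI)
      fix j assume "j \<in> B" "\<forall>b. T (Inl b) = 0"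
      then show "zz j T = blinfun_apply P (S0.dual_vector j)"
        using bspec[OF elim \<open>j \<in> B\<close>] N0[of T] by simp
    qed
  qed
  ultimately show ?thesis using that zz(1) by blast
qed

text \<open>The point over \<open>\<phi>\<close> is \<open>x0 + uu\<close> with \<open>uu\<close>
  the sum of \<open>grad j * u j\<close>. By the exact Taylor formula the energy difference has the
  coefficients \<open>p (y i) (u j) + e (u i) (u j)\<close> against \<open>grad i * grad j\<close>;
  it vanishes once the first term is minus the symmetrized second one. As
  \<open>p (y i) (ker j)\<close> is the matrix entry \<open>S i j\<close>, this condition can be
  solved for \<open>S\<close>.\<close>

lemma ex_germ_intertwining_energies:
  "\<exists>f. analytic_germ f \<and> (\<forall>t. f t \<in> span B) \<and> f (\<lambda>_. 0) = 0 \<and>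
    (\<forall>b\<in>B. ((\<lambda>\<tau>. f ((\<lambda>_. 0)(b := \<tau>))) has_vector_derivative b) (at 0)) \<and>
    (\<forall>\<^sub>F t in polydisc_filter. E (f t + \<Psi>1 (f t)) =
      E ((\<Sum>b\<in>B. t b *\<^sub>R b) + \<Psi>0 (\<Sum>b\<in>B. t b *\<^sub>R b)))"
proof -
  obtain P :: "'y \<Rightarrow>\<^sub>L 'x" and zz :: "'x \<Rightarrow> ('x + 'x \<times> 'x \<Rightarrow> real) \<Rightarrow> 'x" where
    zz_germ: "\<And>j. analytic_germ (zz j)" and
    zz_section: "\<forall>\<^sub>F T in polydisc_filter. \<forall>j\<in>B. (\<forall>b. T (Inl b) = 0) \<longrightarrow>
      zz j T = blinfun_apply P (S0.dual_vector j)" and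
    zz_sum: "\<forall>\<^sub>F T in polydisc_filter. x0 T - x1 T = (\<Sum>j\<in>B. grad j T *\<^sub>R zz j T)"
    by (rule defect_factorization) (rule that)
  obtain D r where D: "real_analytic_at UNIV D 0" "0 < r"
    "\<And>x y. norm x < r \<Longrightarrow> norm y < r \<Longrightarrow> \<Psi>1 y - \<Psi>1 x = blinfun_apply (D (x, y)) (y - x)"
    using \<Psi>1(1) by (rule real_analytic_difference_quotient) blast
  have D0: "blinfun_apply (D (0, 0)) = (\<lambda>_. 0)"
    using eventually_nhds_x_imp_x[OF real_analytic_has_derivative_diagonal[OF D]] \<Psi>1(3)
    by (rule has_derivative_unique)
  obtain Q q where "real_analytic_at UNIV Q 0 \<and> 0 < q \<and> (\<forall>x y. norm x < q \<longrightarrow> norm y < q \<longrightarrow>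
    E y - E x = p (M x) (y - x) + second_difference Q x y (y - x) (y - x))"
    using ex_second_difference[where p = p, OF open_U zero_U E_analytic dE] by blast
  then have Q: "real_analytic_at UNIV Q 0" "0 < q"
    "\<And>x y. norm x < q \<Longrightarrow> norm y < q \<Longrightarrow>
      E y - E x = p (M x) (y - x) + second_difference Q x y (y - x) (y - x)" by blast+
  interpret e: bounded_bilinear "second_difference Q x y" for x y by (rule second_difference_bilinear)
  define y where "y = S0.dual_vector"
  define sym where "sym a b = second_difference Q 0 0 a b + second_difference Q 0 0 b a" for a b
  have sym_kernel: "sym k v = 0" "sym v k = 0" if "k \<in> null_space L" for k v
    using second_difference_kernel[OF S0.bilinear Q dM pairing_M0, of k v] that
    by (simp_all add: sym_def null_space_def add.commute)
  have sym_diff: "sym (a - a') (b - b') = sym a b - sym a b' - sym a' b + sym a' b'" for a a' b b'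
    by (simp add: sym_def e.diff_left e.diff_right)

  \<comment> \<open>The value of the matrix over the origin, where \<open>J\<close> is the identity
    on the kernel and \<open>zz j\<close> is \<open>P (y j)\<close>. The unknown letters are
    deviations from it, so that they vanish there.\<close>
  define S0c where "S0c i j = p (y i) (blinfun_apply P (y j)) -
    sym (blinfun_apply P (y i)) (blinfun_apply P (y j)) / 2" for i j
  define S where "S i j T = S0c i j + T (Inr (i, j))" for i j and T :: "'x + 'x \<times> 'x \<Rightarrow> real"
  define ker where "ker j T = (\<Sum>i\<in>B. S i j T *\<^sub>R i)" for j T
  define v where "v T = (\<Sum>j\<in>B. grad j T *\<^sub>R ker j T)" for T
  define \<phi> where "\<phi> T = \<eta> T + v T" for T
  \<comment> \<open>Moving the kernel component from \<eta> by \<open>v\<close> moves the point over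
    it by exactly \<open>J v\<close>.\<close>
  define J where "J T = Blinfun S1.kernel_proj + D (\<eta> T, \<phi> T)" for T
  define u where "u j T = blinfun_apply (J T) (ker j T) - zz j T" for j T
  define uu where "uu T = (\<Sum>j\<in>B. grad j T *\<^sub>R u j T)" for T
  define e where "e T = second_difference Q (x0 T) (x0 T + uu T)" for T
  \<comment> \<open>The condition on \<open>p (y i) (u j)\<close>, rearranged as a fixed point
    equation: \<open>S i j\<close> is isolated as \<open>p (y i) (ker j)\<close>, and the deviation
    of \<open>J\<close> from the identity goes to the right-hand side.\<close>
  define G where "G ij T = (if fst ij \<in> B \<and> snd ij \<in> B then
      - p (y (fst ij)) (blinfun_apply (J T) (ker (snd ij) T) - ker (snd ij) T) + p (y (fst ij)) (zz (snd ij) T)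
      - (e T (u (fst ij) T) (u (snd ij) T) + e T (u (snd ij) T) (u (fst ij) T)) / 2 - S0c (fst ij) (snd ij)
    else 0)" for ij T

  have ker_in: "ker j T \<in> null_space L" for j T
    unfolding ker_def S0.span_basis[symmetric] by (intro span_sum span_scale span_base)
  have v_in: "v T \<in> null_space L" for T
    using ker_in unfolding v_def S0.span_basis[symmetric] by (intro span_sum span_scale)
  have \<phi>_in: "\<phi> T \<in> null_space L" for T
    using v_in[of T] S1.kernel_proj_in[of "x0 T"]
    unfolding \<phi>_def \<eta>_def S0.span_basis[symmetric] by (intro span_add)
  have S_germ: "analytic_germ (S i j)" for i j
    unfolding S_def by (intro analytic_germ_add analytic_germ_const analytic_germ_var)
  have ker_germ: "analytic_germ (ker j)" for j
    unfolding ker_def by (intro analytic_germ_sum analytic_germ_scaleR S_germ analytic_germ_const)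
  have v_germ: "analytic_germ v"
    unfolding v_def by (intro analytic_germ_sum analytic_germ_scaleR grad_germ ker_germ)
  have \<phi>_germ: "analytic_germ \<phi>" unfolding \<phi>_def by (intro analytic_germ_add \<eta>_germ v_germ)
  have \<phi>_section: "\<phi> T = 0" if "\<And>b. T (Inl b) = 0" for T
    using section_zero[of T] that by (simp add: \<phi>_def v_def)
  have J_germ: "analytic_germ J" unfolding J_def
    by (intro analytic_germ_add analytic_germ_const analytic_germ_comp[OF D(1)] analytic_germ_Pair \<eta>_germ \<phi>_germ)
      (simp add: section_zero \<phi>_section zero_prod_def)
  have u_germ: "analytic_germ (u j)" for j
    unfolding u_def by (intro analytic_germ_diff analytic_germ_blinfun_apply J_germ ker_germ zz_germ)
  have uu_germ: "analytic_germ uu"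
    unfolding uu_def by (intro analytic_germ_sum analytic_germ_scaleR grad_germ u_germ)
  have uu_section: "uu T = 0" if "\<And>b. T (Inl b) = 0" for T
    using section_zero[of T] that by (simp add: uu_def)
  have e_germ: "analytic_germ (\<lambda>T. e T (u i T) (u j T))" for i j
    unfolding e_def
    by (intro analytic_germ_second_difference Q(1) x0_germ analytic_germ_add uu_germ u_germ)
      (simp_all add: section_zero uu_section)
  have pl: "bounded_linear (p w)" for w by (rule p.bounded_linear_right)
  have G_germ: "analytic_germ (G ij)" for ij
  proof (cases "fst ij \<in> B \<and> snd ij \<in> B")
    case True
    have "G ij = (\<lambda>T. - p (y (fst ij)) (blinfun_apply (J T) (ker (snd ij) T) - ker (snd ij) T)
      + p (y (fst ij)) (zz (snd ij) T)
      - (e T (u (fst ij) T) (u (snd ij) T) + e T (u (snd ij) T) (u (fst ij) T)) / 2 - S0c (fst ij) (snd ij))"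
      using True by (intro ext) (simp only: G_def if_True simp_thms)
    moreover have "analytic_germ (\<lambda>T. p (y (fst ij)) (blinfun_apply (J T) (ker (snd ij) T) - ker (snd ij) T))"
      by (rule analytic_germ_linear[OF pl])
        (intro analytic_germ_diff analytic_germ_blinfun_apply J_germ ker_germ)
    moreover have "analytic_germ (\<lambda>T. p (y (fst ij)) (zz (snd ij) T))"
      by (rule analytic_germ_linear[OF pl zz_germ])
    moreover have "analytic_germ (\<lambda>T. (e T (u (fst ij) T) (u (snd ij) T) + e T (u (snd ij) T) (u (fst ij) T)) / 2)"
      by (rule analytic_germ_linear[OF bounded_linear_divide]) (intro analytic_germ_add e_germ)
    ultimately show ?thesis
      by (simp only:) (intro analytic_germ_diff analytic_germ_add analytic_germ_uminus analytic_germ_const)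
  next
    case False
    then have "G ij = (\<lambda>_. 0)" by (auto simp: G_def fun_eq_iff)
    then show ?thesis by (simp add: analytic_germ_const)
  qed
  have G_section: "\<forall>\<^sub>F T in polydisc_filter. (\<forall>b. T (Inl b) = 0) \<longrightarrow> G ij T = 0" for ij
    using zz_section
  proof eventually_elim
    case (elim T)
    show ?case
    proof (cases "fst ij \<in> B \<and> snd ij \<in> B")
      case True
      obtain i j where ij: "ij = (i, j)" by (cases ij)
      show ?thesis
      proof
        assume T: "\<forall>b. T (Inl b) = 0"
        note sec = section_zero[of T] \<phi>_section[of T] uu_section[of T]
        \<comment> \<open>Here \<open>D (0, 0)\<close>, the derivative of \<open>\<Psi>1\<close> at
          0, vanishes.\<close>
        have "blinfun_apply (J T) k = k" if "k \<in> null_space L" for k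
          using sec T that S1.kernel_proj_id[OF that] D0
          by (simp add: J_def blinfun.add_left bounded_linear_Blinfun_apply S1.bounded_linear_kernel_proj)
        then have Jk: "blinfun_apply (J T) (ker j T) = ker j T" for j using ker_in by blast
        have uj: "u j T = ker j T - blinfun_apply P (y j)" if "j \<in> B" for j
          using elim that T by (simp add: u_def Jk y_def)
        have "e T = second_difference Q 0 0" using sec T by (simp add: e_def)
        then have "e T (u i T) (u j T) + e T (u j T) (u i T) = sym (u i T) (u j T)" by (simp add: sym_def)
        \<comment> \<open>The kernel part of each \<open>u\<close> lies in the radical of
          \<open>sym\<close>, so the unknown matrix disappears.\<close>
        also have "\<dots> = sym (blinfun_apply P (y i)) (blinfun_apply P (y j))"
          using True ij by (simp add: uj sym_diff sym_kernel[OF ker_in])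
        finally have "e T (u i T) (u j T) + e T (u j T) (u i T) = sym (blinfun_apply P (y i)) (blinfun_apply P (y j))" .
        moreover have "zz j T = blinfun_apply P (y j)" using elim T True ij by (simp add: y_def)
        ultimately show "G ij T = 0" using True ij by (simp add: G_def Jk S0c_def p.zero_right)
      qed
    qed (auto simp: G_def)
  qed

  have "\<exists>\<sigma>. vanishing_family \<sigma> \<and>
    (\<forall>\<^sub>F t in polydisc_filter. \<forall>ij. \<sigma> ij t = G ij (case_sum t (\<lambda>ij. \<sigma> ij t)))"
  proof (rule analytic_germ_implicit_function[of "B \<times> B" G])
    show "finite (B \<times> B)" using S0.finite_basis by simp
    show "G ij = (\<lambda>_. 0)" if "ij \<notin> B \<times> B" for ij using that by (cases ij) (auto simp: G_def fun_eq_iff)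
    show "analytic_germ (G ij)" for ij by (rule G_germ)
    show "G ij (\<lambda>_. 0) = 0" for ij
    proof -
      obtain \<rho> where "0 < \<rho>" "\<forall>T. (\<forall>i. \<bar>T i\<bar> \<le> \<rho>) \<longrightarrow> (\<forall>b. T (Inl b) = 0) \<longrightarrow> G ij T = 0"
        using G_section[of ij] unfolding eventually_polydisc_filter by blast
      then show ?thesis by simp
    qed
    \<comment> \<open>\<open>G ij\<close> vanishes over the origin for all small matrix entries, in
      particular along the axis of each of them.\<close>
    show "((\<lambda>\<tau>. G ij ((\<lambda>_. 0)(Inr k := \<tau>))) has_vector_derivative 0) (at 0)" for ij k
      by (rule has_vector_derivative_0_of_section[where R = "\<lambda>T. \<forall>b. T (Inl b) = 0", OF G_section]) simp
  qed blast
  then obtain \<sigma> where \<sigma>: "vanishing_family \<sigma>"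
    "\<forall>\<^sub>F t in polydisc_filter. \<forall>ij. \<sigma> ij t = G ij (case_sum t (\<lambda>ij. \<sigma> ij t))" by blast
  define full where "full t = case_sum t (\<lambda>ij. \<sigma> ij t)" for t
  have full_vf: "vanishing_family (\<lambda>l t. full t l)"
    unfolding full_def by (rule vanishing_family_case_sum[OF \<sigma>(1)])
  have full_germ: "analytic_germ (\<lambda>t. h (full t))" if "analytic_germ h" for h :: "_ \<Rightarrow> 'z::banach"
    using analytic_germ_subst[OF that full_vf] by simp
  define f where "f t = \<phi> (full t)" for t

  text \<open>On solutions of the implicit equation the quadratic form in \<open>grad\<close> is antisymmetric.\<close>

  have key: "\<forall>\<^sub>F T in polydisc_filter. (\<forall>ij. T (Inr ij) = G ij T) \<longrightarrow> E (\<phi> T + \<Psi>1 (\<phi> T)) = E (x0 T)"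
  proof -
    have "\<forall>\<^sub>F T in polydisc_filter. norm (\<eta> T) < r"
      by (rule eventually_tendsto_0[OF \<eta>_germ _ eventually_norm_less_nhds_0]) (auto simp: section_zero D)
    moreover have "\<forall>\<^sub>F T in polydisc_filter. norm (\<phi> T) < r"
      by (rule eventually_tendsto_0[OF \<phi>_germ _ eventually_norm_less_nhds_0]) (auto simp: \<phi>_section D)
    moreover have "\<forall>\<^sub>F T in polydisc_filter. norm (x0 T) < q"
      by (rule eventually_tendsto_0[OF x0_germ _ eventually_norm_less_nhds_0]) (auto simp: section_zero Q)
    moreover have "\<forall>\<^sub>F T in polydisc_filter. norm (x0 T + uu T) < q"
      by (rule eventually_tendsto_0[OF analytic_germ_add[OF x0_germ uu_germ] _ eventually_norm_less_nhds_0])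
        (auto simp: section_zero uu_section Q)
    moreover have "\<forall>\<^sub>F T in polydisc_filter. \<Psi>0 (pt T) \<in> Z0 \<and>
        M (S0.kernel_proj (pt T) + \<Psi>0 (pt T)) \<in> annihilator p Z0"
      by (rule eventually_tendsto_0[OF pt_germ _ \<Psi>0(4)]) (simp add: section_zero)
    ultimately show ?thesis using zz_sum
    proof eventually_elim
      case (elim T)
      show ?case
      proof
        assume sol: "\<forall>ij. T (Inr ij) = G ij T"
        have "M (x0 T) \<in> annihilator p Z0"
          using elim(5) S0.kernel_proj_id[OF pt_in] by (simp add: x0_def)
        then have Mx0: "M (x0 T) = (\<Sum>i\<in>B. grad i T *\<^sub>R y i)"
          unfolding grad_def y_def using S0.annihilator_expand by metis
        have "\<Psi>1 (\<phi> T) - \<Psi>1 (\<eta> T) = blinfun_apply (D (\<eta> T, \<phi> T)) (v T)"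
          using D(3)[OF elim(1,2)] by (simp add: \<phi>_def)
        moreover have "S1.kernel_proj (v T) = v T" by (rule S1.kernel_proj_id[OF v_in])
        ultimately have "\<phi> T + \<Psi>1 (\<phi> T) = x1 T + blinfun_apply (J T) (v T)"
          by (simp add: J_def x1_def \<phi>_def blinfun.add_left bounded_linear_Blinfun_apply
              S1.bounded_linear_kernel_proj algebra_simps)
        moreover have "uu T = blinfun_apply (J T) (v T) - (x0 T - x1 T)"
          unfolding elim(6) uu_def u_def v_def
          by (simp add: blinfun.sum_right blinfun.scaleR_right scaleR_diff_right sum_subtractf)
        ultimately have phi: "\<phi> T + \<Psi>1 (\<phi> T) = x0 T + uu T" by simp
        define s where "s i j = e T (u i T) (u j T)" for i j
        \<comment> \<open>Substituting the fixed point equation into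
          \<open>p (y i) (ker j T)\<close> cancels the \<open>J\<close> and \<open>zz\<close>
          terms.\<close>
        have pu: "p (y i) (u j T) = - (s i j + s j i) / 2" if "i \<in> B" "j \<in> B" for i j
        proof -
          have "p (y i) (ker j T) = (\<Sum>k\<in>B. S k j T * p (y i) k)"
            by (simp add: ker_def p.sum_right p.scaleR_right)
          also have "\<dots> = (\<Sum>k\<in>B. if i = k then S k j T else 0)"
            by (rule sum.cong) (use that S0.dual_vector(2) in \<open>auto simp: y_def\<close>)
          also have "\<dots> = S i j T" using that S0.finite_basis by simp
          finally have "p (y i) (ker j T) = S0c i j + G (i, j) T" using sol by (simp add: S_def)
          moreover have "p (y i) (u j T) = p (y i) (blinfun_apply (J T) (ker j T)) - p (y i) (zz j T)"
            by (simp add: u_def p.diff_right)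
          moreover have "G (i, j) T = p (y i) (ker j T) - p (y i) (blinfun_apply (J T) (ker j T))
              + p (y i) (zz j T) - (s i j + s j i) / 2 - S0c i j"
            using that by (simp add: G_def s_def p.diff_right)
          ultimately show ?thesis by linarith
        qed
        have "p (M (x0 T)) (uu T) = (\<Sum>i\<in>B. grad i T * p (y i) (uu T))"
          by (simp add: Mx0 p.sum_left p.scaleR_left)
        also have "\<dots> = (\<Sum>i\<in>B. \<Sum>j\<in>B. grad i T * grad j T * p (y i) (u j T))"
          by (simp add: uu_def p.sum_right p.scaleR_right sum_distrib_left mult_ac)
        also have "\<dots> = (\<Sum>i\<in>B. \<Sum>j\<in>B. - (grad i T * grad j T * s i j) / 2 - grad i T * grad j T * s j i / 2)"
          by (intro sum.cong refl) (simp add: pu field_simps)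
        also have "\<dots> = - (\<Sum>i\<in>B. \<Sum>j\<in>B. grad i T * grad j T * s i j) / 2 -
            (\<Sum>i\<in>B. \<Sum>j\<in>B. grad i T * grad j T * s j i) / 2"
          by (simp add: sum_subtractf sum_negf sum_divide_distrib)
        \<comment> \<open>Exchanging the indices merges the two halves, and the linear term becomes
          minus the quadratic one.\<close>
        also have "(\<Sum>i\<in>B. \<Sum>j\<in>B. grad i T * grad j T * s j i) = (\<Sum>i\<in>B. \<Sum>j\<in>B. grad i T * grad j T * s i j)"
          by (subst sum.swap) (simp add: mult_ac)
        finally have 1: "p (M (x0 T)) (uu T) = - (\<Sum>i\<in>B. \<Sum>j\<in>B. grad i T * grad j T * s i j)" by simp
        have 2: "e T (uu T) (uu T) = (\<Sum>i\<in>B. \<Sum>j\<in>B. grad i T * grad j T * s i j)"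
        proof -
          have "e T (uu T) (uu T) = (\<Sum>i\<in>B. grad i T * e T (u i T) (uu T))"
            by (subst uu_def) (simp add: e_def e.sum_left e.scaleR_left)
          also have "\<dots> = (\<Sum>i\<in>B. grad i T * (\<Sum>j\<in>B. grad j T * s i j))"
            by (simp add: uu_def e_def s_def e.sum_right e.scaleR_right)
          finally show ?thesis by (simp add: sum_distrib_left mult_ac)
        qed
        have "E (x0 T + uu T) - E (x0 T) = p (M (x0 T)) (uu T) + e T (uu T) (uu T)"
          using Q(3)[OF elim(3,4)] by (simp add: e_def)
        then show "E (\<phi> T + \<Psi>1 (\<phi> T)) = E (x0 T)" unfolding phi 1 2 by simp
      qed
    qed
  qed
  have "\<forall>\<^sub>F t in polydisc_filter. (\<forall>ij. full t (Inr ij) = G ij (full t)) \<longrightarrow>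
      E (\<phi> (full t) + \<Psi>1 (\<phi> (full t))) = E (x0 (full t))"
    using eventually_polydisc_subst[OF full_vf key] by simp
  with \<sigma>(2) have energies: "\<forall>\<^sub>F t in polydisc_filter. E (f t + \<Psi>1 (f t)) =
      E ((\<Sum>b\<in>B. t b *\<^sub>R b) + \<Psi>0 (\<Sum>b\<in>B. t b *\<^sub>R b))"
  proof eventually_elim
    case (elim t)
    have "full t (Inr ij) = G ij (full t)" for ij
      unfolding full_def sum.case by (rule elim(1)[rule_format])
    with elim(2) have "E (f t + \<Psi>1 (f t)) = E (x0 (full t))" unfolding f_def by blast
    then show ?case by (simp add: x0_def pt_def full_def)
  qed

  have deriv: "((\<lambda>\<tau>. f ((\<lambda>_. 0)(b := \<tau>))) has_vector_derivative b) (at 0)" if b: "b \<in> B" for b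
  proof -
    \<comment> \<open>Along a basis direction \<open>\<eta>\<close> has derivative \<open>b\<close>
      because \<open>\<Psi>0\<close> has derivative 0, and the correction \<open>v\<close>
      contributes nothing to first order.\<close>
    define T where "T \<tau> = full ((\<lambda>_. 0)(b := \<tau>))" for \<tau>
    have ptT: "pt (T \<tau>) = \<tau> *\<^sub>R b" for \<tau>
    proof -
      have "pt (T \<tau>) = (\<Sum>c\<in>B. if c = b then \<tau> *\<^sub>R b else 0)"
        unfolding pt_def T_def full_def by (rule sum.cong) auto
      then show ?thesis using b S0.finite_basis by simp
    qed
    have bK: "b \<in> null_space L" using b S0.span_basis span_base by blast
    have lin: "((\<lambda>\<tau>::real. \<tau> *\<^sub>R b) has_derivative (\<lambda>\<tau>. \<tau> *\<^sub>R b)) (at 0)"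
      by (rule bounded_linear_imp_has_derivative[OF bounded_linear_scaleR_left])
    from has_derivative_compose[OF this, of \<Psi>0 "\<lambda>_. 0"] \<Psi>0(3)
    have "((\<lambda>\<tau>. \<Psi>0 (\<tau> *\<^sub>R b)) has_derivative (\<lambda>\<tau>. 0)) (at 0)" by simp
    from has_derivative_add[OF lin this]
    have x0T: "((\<lambda>\<tau>. x0 (T \<tau>)) has_derivative (\<lambda>\<tau>. \<tau> *\<^sub>R b)) (at 0)" by (simp add: x0_def ptT)
    from \<Pi>.has_derivative[OF this] S1.kernel_proj_id[OF bK]
    have \<eta>T: "((\<lambda>\<tau>. \<eta> (T \<tau>)) has_vector_derivative b) (at 0)"
      by (simp add: \<eta>_def has_vector_derivative_def \<Pi>.scaleR)
    have x0T0: "x0 (T 0) = 0" by (simp add: x0_def ptT \<Psi>0(2))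
    from has_derivative_compose[OF x0T, of M L] dM x0T0
    have "((\<lambda>\<tau>. M (x0 (T \<tau>))) has_derivative (\<lambda>\<tau>. L (\<tau> *\<^sub>R b))) (at 0)" by simp
    moreover have "L (\<tau> *\<^sub>R b) = 0" for \<tau> using bK by (simp add: null_space_def L.scaleR)
    ultimately have MT: "((\<lambda>\<tau>. M (x0 (T \<tau>))) has_derivative (\<lambda>\<tau>. 0)) (at 0)" by simp
    have "((\<lambda>\<tau>. grad j (T \<tau>) * S i j (T \<tau>)) has_real_derivative 0) (at 0)" for i j
    proof -
      from bounded_linear.has_derivative[OF p.bounded_linear_left[of j] MT]
      have "((\<lambda>\<tau>. grad j (T \<tau>)) has_real_derivative 0) (at 0)"
        by (simp add: grad_def has_field_derivative_def p.zero_left lambda_zero)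
      \<comment> \<open>\<open>grad\<close> is o(\<tau>) and \<open>S\<close> has a limit, so the
        product has derivative 0 and the solution \<sigma> need not be differentiated.\<close>
      then have "((\<lambda>\<tau>. grad j (T \<tau>) / \<tau>) \<longlongrightarrow> 0) (at 0)"
        unfolding DERIV_def by (simp add: grad_def x0T0 pairing_M0)
      moreover have "((\<lambda>\<tau>. S i j (T \<tau>)) \<longlongrightarrow> S i j (full (\<lambda>_. 0))) (at 0)"
      proof (rule filterlim_compose[OF analytic_germ_tendsto[OF full_germ[OF S_germ]], of "\<lambda>\<tau>. (\<lambda>_. 0)(b := \<tau>)", folded T_def])
        show "filterlim (\<lambda>\<tau>. (\<lambda>_. 0)(b := \<tau>)) polydisc_filter (at 0)"
          unfolding filterlim_iff
        proof (intro allI impI)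
          fix R :: "('x \<Rightarrow> real) \<Rightarrow> bool" assume "eventually R polydisc_filter"
          then obtain \<rho> where \<rho>: "0 < \<rho>" "\<And>t. (\<And>i. \<bar>t i\<bar> \<le> \<rho>) \<Longrightarrow> R t"
            unfolding eventually_polydisc_filter by blast
          have "R ((\<lambda>_. 0)(b := \<tau>))" if "\<bar>\<tau>\<bar> < \<rho>" for \<tau>
            by (rule \<rho>(2)) (use that \<rho>(1) in auto)
          then show "\<forall>\<^sub>F \<tau> in at 0. R ((\<lambda>_. 0)(b := \<tau>))"
            using \<rho>(1) unfolding eventually_at by (intro exI[of _ \<rho>]) (auto simp: dist_norm)
        qed
      qed
      ultimately have "((\<lambda>\<tau>. grad j (T \<tau>) / \<tau> * S i j (T \<tau>)) \<longlongrightarrow> 0 * S i j (full (\<lambda>_. 0))) (at 0)"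
        by (rule tendsto_mult)
      then show ?thesis unfolding DERIV_def by (simp add: grad_def x0T0 pairing_M0)
    qed
    then have "((\<lambda>\<tau>. (grad j (T \<tau>) * S i j (T \<tau>)) *\<^sub>R i) has_vector_derivative 0) (at 0)" for i j
      using bounded_linear.has_vector_derivative[OF bounded_linear_scaleR_left[of i]]
      by (fastforce simp: has_real_derivative_iff_has_vector_derivative)
    then have "((\<lambda>\<tau>. \<Sum>j\<in>B. \<Sum>i\<in>B. (grad j (T \<tau>) * S i j (T \<tau>)) *\<^sub>R i) has_vector_derivative
        (\<Sum>j\<in>B. \<Sum>i\<in>B. 0)) (at 0)"
      by (intro has_vector_derivative_sum)
    then have "((\<lambda>\<tau>. v (T \<tau>)) has_vector_derivative 0) (at 0)"
      by (simp add: v_def ker_def scaleR_sum_right)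
    from has_vector_derivative_add[OF \<eta>T this] show ?thesis by (simp add: f_def \<phi>_def T_def)
  qed
  have "f t \<in> span B" for t using \<phi>_in S0.span_basis by (simp add: f_def)
  moreover have "f (\<lambda>_. 0) = 0" unfolding f_def by (rule \<phi>_section) (simp add: full_def)
  moreover have "analytic_germ f" unfolding f_def by (rule full_germ[OF \<phi>_germ])
  ultimately show ?thesis using deriv energies by blast
qed

end

theorem theorem3p1:
  fixes p :: "'y::banach \<Rightarrow> 'x::banach \<Rightarrow> real"
    and U :: "'x set" and E :: "'x \<Rightarrow> real" and M L :: "'x \<Rightarrow> 'y"
    and Z0 Z1 :: "'x set" and \<psi>0 \<psi>1 :: "'x \<Rightarrow> 'x"
  assumes "bounded_bilinear p"
    and "open U" and "0 \<in> U"
    and "real_analytic_on UNIV E U" and "E 0 = 0" and "(E has_derivative (\<lambda>v. 0)) (at 0)"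
    and "real_analytic_on UNIV M U"
    and "\<And>x. x \<in> U \<Longrightarrow> (E has_derivative (\<lambda>v. p (M x) v)) (at x)"
    and "(M has_derivative L) (at 0)" and "fredholm L"
    and "compatible_splitting p L Z0" and "compatible_splitting p L Z1"
    and "lyapunov_schmidt_germ p M L Z0 \<psi>0" and "lyapunov_schmidt_germ p M L Z1 \<psi>1"
  shows "\<exists>\<phi>. analytic_local_diffeo (null_space L) \<phi> \<and>
      (\<forall>\<^sub>F \<xi> in nhds 0. \<xi> \<in> null_space L \<longrightarrow>
         reduced_energy E \<psi>1 (\<phi> \<xi>) = reduced_energy E \<psi>0 \<xi>) \<and>
      \<phi> 0 = 0 \<and>
      (\<phi> has_derivative (\<lambda>h. h)) (at 0 within null_space L)"
proof -
  obtain F where F: "finite F" "null_space L = span F"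
    using \<open>fredholm L\<close> unfolding fredholm_def by blast
  obtain B where B: "B \<subseteq> F" "independent B" "F \<subseteq> span B"
    by (rule basis_exists[of F])
  have "span F = span B"
    using span_minimal[OF B(3) subspace_span] span_mono[OF B(1)] by (rule subset_antisym)
  then have K: "span B = null_space L" using F by simp
  have finB: "finite B" using B(1) F(1) by (rule finite_subset)
  interpret ls_splitting_pair p L Z0 Z1 B U E M \<psi>0 \<psi>1
  proof (intro ls_splitting_pair.intro ls_splitting.intro ls_splitting_pair_axioms.intro)
    show "real_analytic_at UNIV E 0" "real_analytic_at UNIV M 0"
      using assms(3,4,7) unfolding real_analytic_on_def by blast+
  qed (fact assms K finB B(2))+
  obtain f where "analytic_germ f \<and> (\<forall>t. f t \<in> span B) \<and> f (\<lambda>_. 0) = 0 \<and>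
    (\<forall>b\<in>B. ((\<lambda>\<tau>. f ((\<lambda>_. 0)(b := \<tau>))) has_vector_derivative b) (at 0)) \<and>
    (\<forall>\<^sub>F t in polydisc_filter. E (f t + \<Psi>1 (f t)) =
      E ((\<Sum>b\<in>B. t b *\<^sub>R b) + \<Psi>0 (\<Sum>b\<in>B. t b *\<^sub>R b)))"
    using ex_germ_intertwining_energies by (rule exE)
  then have f: "analytic_germ f" "\<And>t. f t \<in> span B" "f (\<lambda>_. 0) = 0"
    "\<And>b. b \<in> B \<Longrightarrow> ((\<lambda>\<tau>. f ((\<lambda>_. 0)(b := \<tau>))) has_vector_derivative b) (at 0)"
    "\<forall>\<^sub>F t in polydisc_filter. E (f t + \<Psi>1 (f t)) = E ((\<Sum>b\<in>B. t b *\<^sub>R b) + \<Psi>0 (\<Sum>b\<in>B. t b *\<^sub>R b))"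
    by blast+
  \<comment> \<open>On the kernel the coordinates do not depend on the complement; those of
    \<open>Z0\<close> merely extend \<phi> to the whole space.\<close>
  define \<phi> where "\<phi> x = f (\<lambda>b. S0.coord b x)" for x
  note diffeo = S0.analytic_local_diffeo_of_germ[OF f(1-4) \<phi>_def, unfolded K]
  have "\<forall>\<^sub>F x in nhds 0. E (\<phi> x + \<Psi>1 (\<phi> x)) =
      E ((\<Sum>b\<in>B. S0.coord b x *\<^sub>R b) + \<Psi>0 (\<Sum>b\<in>B. S0.coord b x *\<^sub>R b))"
    unfolding \<phi>_def by (rule S0.tendsto_\<kappa>[THEN filterlim_iff[THEN iffD1], rule_format, OF f(5)])
  then have "\<forall>\<^sub>F \<xi> in nhds 0. \<xi> \<in> null_space L \<longrightarrow>
      reduced_energy E \<psi>1 (\<phi> \<xi>) = reduced_energy E \<psi>0 \<xi>"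
  proof eventually_elim
    case (elim \<xi>)
    show ?case
    proof
      assume \<xi>: "\<xi> \<in> null_space L"
      have "\<phi> \<xi> \<in> null_space L" using f(2) by (simp add: \<phi>_def K)
      then have "\<Psi>1 (\<phi> \<xi>) = \<psi>1 (\<phi> \<xi>)" by (simp add: \<Psi>1_def S1.kernel_proj_id)
      moreover have "\<Psi>0 \<xi> = \<psi>0 \<xi>" using \<xi> by (simp add: \<Psi>0_def S0.kernel_proj_id)
      moreover have "(\<Sum>b\<in>B. S0.coord b \<xi> *\<^sub>R b) = \<xi>" using \<xi> by (intro S0.expand) (simp add: K)
      ultimately show "reduced_energy E \<psi>1 (\<phi> \<xi>) = reduced_energy E \<psi>0 \<xi>"
        using elim by (simp add: reduced_energy_def)
    qed
  qed
  moreover have "\<phi> 0 = 0" using diffeo(1) by (simp add: analytic_local_diffeo_def)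
  ultimately show ?thesis using diffeo by blast
qed

end
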